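(* There are absolute constants $C,C'>0$ such that the following holds. Let $1<p\le\infty$ and let $\gamma>3$. Then for all sufficiently large integers $d$ (depending on $p$ and $\gamma$) there exist an integer $s\ge1$ and an isometry $V:S\to A\otimes B$ with $S=\mathbb{C}^s$ and $A=B=\mathbb{C}^d$, such that the quantum channel $\mathcal{N}(\rho)=\mathrm{Tr}_B\,V\rho V^\dagger$ and its complex conjugate $\overline{\mathcal{N}}(\rho)=\mathrm{Tr}_B\,\overline{V}\rho V^T$ satisfy $$H_p^{\min}(\mathcal{N})\ \ge\ \ln d-\gamma-\tfrac12-\ln 2$$ and $$H_p\big((\mathcal{N}\otimes\overline{\mathcal{N}})(\Phi)\big)\ \le\ \ln d+C\left(1+\frac{p}{p-1}\ln\frac{p}{p-1}\right)\ \le\ \ln d+C'\left(1-\frac1p\right)^{-2},$$ where $\Phi$ is the maximally entangled state on $S\otimes S$. These inequalities are inconsistent with maximal $p$-norm multiplicativity: for all sufficiently large $d$, $\nu_p(\mathcal{N}\otimes\overline{\mathcal{N}})>\nu_p(\mathcal{N})\,\nu_p(\overline{\mathcal{N}})$, equivalently $H_p^{\min}(\mathcal{N}\otimes\overline{\mathcal{N}})<H_p^{\min}(\mathcal{N})+H_p^{\min}(\overline{\mathcal{N}})$.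
   Context: For a density operator $\rho$ and $1<p<\infty$, the Rényi entropy is $H_p(\rho)=\frac{1}{1-p}\ln\mathrm{Tr}\rho^p$, and $H_\infty(\rho)=-\ln\|\rho\|_\infty$ (operator norm). For $p=\infty$ read $1/p=0$ and $p/(p-1)=1$. For a quantum channel $\mathcal{N}$, $H_p^{\min}(\mathcal{N})=\min_{|\varphi\rangle}H_p(\mathcal{N}(|\varphi\rangle\langle\varphi|))$, the minimum over unit vectors $|\varphi\rangle$ of the input space, and $\nu_p(\mathcal{N})=\sup\{\|\mathcal{N}(\rho)\|_p:\rho\ge0,\mathrm{Tr}\rho=1\}$ with $\|\cdot\|_p$ the Schatten $p$-norm. Complex conjugation $\overline{V}$ and transposition $V^T$ are taken entrywise with respect to the standard basis of $S$ and the standard product basis of $A\otimes B$. The maximally entangled state is $\Phi=|\Phi\rangle\langle\Phi|$ with $|\Phi\rangle=s^{-1/2}\sum_{i=1}^s|i\rangle|i\rangle$ in the standard basis of $S$. *)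

theory Defs
  imports
    Complex_Main
    "HOL-Library.Extended_Real"
    "HOL-Library.Complex_Order"
    "Jordan_Normal_Form.Schur_Decomposition"
begin

text \<open>
  The dimensions vary inside the statement, so spaces \<open>\<complex>\<^sup>n\<close> and operators between them are the
  vectors and matrices of \<open>Jordan_Normal_Form\<close>, with basis indices starting at 0.
  The standard product basis of \<open>\<complex>\<^sup>m \<otimes> \<complex>\<^sup>n\<close> is ordered lexicographically:
  \<open>|i\<rangle>|j\<rangle>\<close> has index \<open>i * n + j\<close>.
\<close>

definition mat_trace :: "complex mat \<Rightarrow> complex" where
  "mat_trace A = (\<Sum>i<dim_row A. A $$ (i, i))"

definition psd_mat :: "nat \<Rightarrow> complex mat \<Rightarrow> bool" where
  "psd_mat n A \<longleftrightarrow> A \<in> carrier_mat n n \<and> (\<forall>v\<in>carrier_vec n. 0 \<le> (A *\<^sub>v v) \<bullet>c v)"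

definition density_ops :: "nat \<Rightarrow> complex mat set" where
  "density_ops n = {\<rho>. psd_mat n \<rho> \<and> mat_trace \<rho> = 1}"

definition unit_vectors :: "nat \<Rightarrow> complex vec set" where
  "unit_vectors n = {\<phi> \<in> carrier_vec n. \<phi> \<bullet>c \<phi> = 1}"

definition ketbra :: "complex vec \<Rightarrow> complex mat" where
  "ketbra \<phi> = mat (dim_vec \<phi>) (dim_vec \<phi>) (\<lambda>(i, j). \<phi> $ i * cnj (\<phi> $ j))"

definition unitary_mat :: "nat \<Rightarrow> complex mat \<Rightarrow> bool" where
  "unitary_mat n U \<longleftrightarrow>
     U \<in> carrier_mat n n \<and> mat_adjoint U * U = 1\<^sub>m n \<and> U * mat_adjoint U = 1\<^sub>m n"

text \<open>
  Functional calculus \<open>f(A)\<close> for Hermitian \<open>A\<close>: if \<open>A = U diag(l) U\<^sup>\<dagger>\<close> with \<open>U\<close> unitary and \<open>l\<close> real,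
  then \<open>f(A) = U diag(f l) U\<^sup>\<dagger>\<close>, which does not depend on the diagonalisation chosen.
\<close>

definition herm_fun :: "(real \<Rightarrow> real) \<Rightarrow> complex mat \<Rightarrow> complex mat" where
  "herm_fun f A = (THE B. \<exists>U (l :: nat \<Rightarrow> real). unitary_mat (dim_row A) U \<and>
     A = U * mat_diag (dim_row A) (\<lambda>i. complex_of_real (l i)) * mat_adjoint U \<and>
     B = U * mat_diag (dim_row A) (\<lambda>i. complex_of_real (f (l i))) * mat_adjoint U)"

text \<open>Powers \<open>A\<^sup>r\<close> with \<open>r > 0\<close> of positive semidefinite matrices; note \<open>0 powr r = 0\<close>.\<close>

definition mat_powr :: "complex mat \<Rightarrow> real \<Rightarrow> complex mat" where
  "mat_powr A r = herm_fun (\<lambda>x. x powr r) A"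

definition mat_abs :: "complex mat \<Rightarrow> complex mat" where
  "mat_abs A = herm_fun sqrt (mat_adjoint A * A)"

definition op_norm :: "complex mat \<Rightarrow> real" where
  "op_norm A = (SUP v\<in>unit_vectors (dim_col A). sqrt (Re ((A *\<^sub>v v) \<bullet>c (A *\<^sub>v v))))"

definition schatten_norm :: "ereal \<Rightarrow> complex mat \<Rightarrow> real" where
  "schatten_norm p A =
     (if p = \<infinity> then op_norm A
      else Re (mat_trace (mat_powr (mat_abs A) (real_of_ereal p))) powr (1 / real_of_ereal p))"

definition renyi_entropy :: "ereal \<Rightarrow> complex mat \<Rightarrow> real" where
  "renyi_entropy p \<rho> =
     (if p = \<infinity> then - ln (op_norm \<rho>)
      else 1 / (1 - real_of_ereal p) * ln (Re (mat_trace (mat_powr \<rho> (real_of_ereal p)))))"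

text \<open>
  The quantities \<open>1/p\<close> and \<open>p/(p-1)\<close>, the case \<open>p = \<infinity>\<close> being fixed by convention
  (in \<open>ereal\<close>, \<open>\<infinity> / (\<infinity> - 1)\<close> would be 0).
\<close>

definition recip_exp :: "ereal \<Rightarrow> real" where
  "recip_exp p = (if p = \<infinity> then 0 else 1 / real_of_ereal p)"

definition conj_exp :: "ereal \<Rightarrow> real" where
  "conj_exp p = (if p = \<infinity> then 1 else real_of_ereal p / (real_of_ereal p - 1))"

text \<open>
  Below, \<open>n\<close> is the input dimension of the channel \<open>N\<close>. The minimum is attained by compactness of
  the unit sphere, so it is written as an infimum.
\<close>

definition min_renyi_entropy :: "ereal \<Rightarrow> nat \<Rightarrow> (complex mat \<Rightarrow> complex mat) \<Rightarrow> real" where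
  "min_renyi_entropy p n N = (INF \<phi>\<in>unit_vectors n. renyi_entropy p (N (ketbra \<phi>)))"

definition max_output_norm :: "ereal \<Rightarrow> nat \<Rightarrow> (complex mat \<Rightarrow> complex mat) \<Rightarrow> real" where
  "max_output_norm p n N = (SUP \<rho>\<in>density_ops n. schatten_norm p (N \<rho>))"

text \<open>\<open>Tr\<^sub>B\<close> on \<open>A \<otimes> B\<close> with \<open>dim A = a\<close> and \<open>dim B = b\<close>.\<close>

definition partial_trace_B :: "nat \<Rightarrow> nat \<Rightarrow> complex mat \<Rightarrow> complex mat" where
  "partial_trace_B a b X = mat a a (\<lambda>(i, j). \<Sum>k<b. X $$ (i * b + k, j * b + k))"

definition isometry_mat :: "nat \<Rightarrow> nat \<Rightarrow> complex mat \<Rightarrow> bool" where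
  "isometry_mat m n V \<longleftrightarrow> V \<in> carrier_mat m n \<and> mat_adjoint V * V = 1\<^sub>m n"

definition channel :: "nat \<Rightarrow> complex mat \<Rightarrow> complex mat \<Rightarrow> complex mat" where
  "channel d V \<rho> = partial_trace_B d d (V * \<rho> * mat_adjoint V)"

definition conj_channel :: "nat \<Rightarrow> complex mat \<Rightarrow> complex mat \<Rightarrow> complex mat" where
  "conj_channel d V \<rho> = partial_trace_B d d (map_mat cnj V * \<rho> * transpose_mat V)"

definition kron :: "complex mat \<Rightarrow> complex mat \<Rightarrow> complex mat" where
  "kron A B = mat (dim_row A * dim_row B) (dim_col A * dim_col B)
     (\<lambda>(i, j). A $$ (i div dim_row B, j div dim_col B) * B $$ (i mod dim_row B, j mod dim_col B))"

definition mat_unit :: "nat \<Rightarrow> nat \<Rightarrow> nat \<Rightarrow> complex mat" where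
  "mat_unit n i j = mat n n (\<lambda>(k, l). if k = i \<and> l = j then 1 else 0)"

text \<open>
  Tensor product of linear maps \<open>N\<close> from \<open>n \<times> n\<close> to \<open>a \<times> a\<close> matrices and \<open>M\<close> from \<open>m \<times> m\<close> to
  \<open>b \<times> b\<close> matrices: expand the argument as a sum of \<open>x \<cdot> |i\<rangle>\<langle>j| \<otimes> |k\<rangle>\<langle>l|\<close> and send each such term to
  \<open>x \<cdot> N(|i\<rangle>\<langle>j|) \<otimes> M(|k\<rangle>\<langle>l|)\<close>.
\<close>

definition tensor_map ::
  "nat \<Rightarrow> nat \<Rightarrow> (complex mat \<Rightarrow> complex mat) \<Rightarrow> nat \<Rightarrow> nat \<Rightarrow> (complex mat \<Rightarrow> complex mat)
    \<Rightarrow> complex mat \<Rightarrow> complex mat" where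
  "tensor_map n a N m b M X = mat (a * b) (a * b)
     (\<lambda>(r, c). \<Sum>i<n. \<Sum>j<n. \<Sum>k<m. \<Sum>l<m.
        X $$ (i * m + k, j * m + l) * kron (N (mat_unit n i j)) (M (mat_unit m k l)) $$ (r, c))"

abbreviation channel_pair :: "nat \<Rightarrow> nat \<Rightarrow> complex mat \<Rightarrow> complex mat \<Rightarrow> complex mat" where
  "channel_pair d s V \<equiv> tensor_map s d (channel d V) s d (conj_channel d V)"

definition max_entangled :: "nat \<Rightarrow> complex mat" where
  "max_entangled s =
     ketbra (vec (s * s) (\<lambda>x. if x div s = x mod s then complex_of_real (1 / sqrt (real s)) else 0))"

end

theory Submission
  imports Defs "HOL-Analysis.Convex" "HOL-Library.FuncSet"
begin

text \<open>
  Take a random tensor \<open>\<epsilon>\<close> of signs and let \<open>M\<^sub>x\<close> be the \<open>d \<times> d\<close> matrix \<open>\<Sum>\<^sub>i x\<^sub>i \<epsilon>\<^sub>i\<close>. A union bound over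
  Gaussian-integer vectors weighted by \<open>exp(-|z|\<^sup>2)\<close>, carried over to all vectors by rounding, shows
  that with positive probability every \<open>k\<close> orthonormal vectors capture at most \<open>46 k d + 24 s\<close> of
  \<open>\<parallel>M\<^sub>x\<parallel>\<^sup>2\<close>, for all unit \<open>x\<close> and all \<open>k\<close> at once. Hence on a subspace of dimension proportional to \<open>s\<close>
  the eigenvalues of a reduced state that exceed \<open>60/d\<close> have total mass \<open>O(s/d\<^sup>2)\<close>. For
  \<open>s\<close> of order \<open>d\<^bsup>1+1/p\<^esup>(p-1)/p\<close> this yields \<open>Tr \<rho>\<^sup>p \<le> (64/d)\<^bsup>p-1\<^esup>\<close> for every pure input, and
  \<open>64 < exp(\<gamma> + 1/2 + ln 2)\<close> because \<open>\<gamma> > 3\<close>. On the other hand, the output of \<open>\<Phi>\<close> has an eigenvalue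
  of at least \<open>s/d\<^sup>2\<close>, which for large \<open>d\<close> is too much for multiplicativity.
\<close>

section \<open>Random sign matrices\<close>

text \<open>The statement fixes the entropy deficit. As \<open>\<gamma>\<close> may be close to 3,
  the constant c in Tr \<rho>^p \<le> (c/d)^(p-1) must not exceed 2 exp(7/2), about 66.2, for all p
  at once. This forces the chain 46 * 5/4 = 57.5 < 60 < 64 < 66.2: 46 is the noise level, 5/4 the
  loss from normalising the columns of \<open>V\<close>, 60 the cut between bulk and exceptional
  eigenvalues, and 64 leaves room for the latter. Approximating by a net would cost a further
  factor; here rounding enters only as added variance, and the lattice costs ln 9 per complex
  coordinate. Signs turn every expectation into a finite average. The factor (p-1)/p in the
  dimension is there because the room 64^(p-1) - 60^(p-1) is only of order p-1 as p tends to 1. It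
  comes back as the term q ln q, with q = p/(p-1), in the upper bound; there the eigenvalue bound of
  order q d^(1/q) for its inverse yields exactly the leading ln d once its logarithm is multiplied
  by q.\<close>

text \<open>The exponential moment of one sign is cosh. For x \<ge> 0, cosh t * exp(-t^2/2) is
  nonincreasing because sinh t \<le> t cosh t; evenness covers the rest.\<close>

lemma cosh_le_exp_half_square: "cosh x \<le> exp (x\<^sup>2 / 2)" for x :: real
proof -
  have pos: "cosh x \<le> exp (x\<^sup>2 / 2)" if "0 \<le> x" for x :: real
  proof -
    have sc: "sinh t \<le> t * cosh t" if "0 \<le> t" for t :: real
    proof -
      have "(0::real) * cosh 0 - sinh 0 \<le> t * cosh t - sinh t"
        by (rule DERIV_nonneg_imp_nondecreasing[OF that])
          (auto intro!: derivative_eq_intros exI)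
      then show ?thesis by simp
    qed
    have "- (cosh 0 * exp (- 0\<^sup>2 / 2)) \<le> - (cosh x * exp (- x\<^sup>2 / 2))"
    proof (rule DERIV_nonneg_imp_nondecreasing[OF that])
      fix t :: real assume t: "0 \<le> t" "t \<le> x"
      have "((\<lambda>t. - (cosh t * exp (- t\<^sup>2 / 2))) has_real_derivative
          (t * cosh t - sinh t) * exp (- t\<^sup>2 / 2)) (at t)"
        by (auto intro!: derivative_eq_intros simp: algebra_simps)
      then show "\<exists>y. ((\<lambda>t. - (cosh t * exp (- t\<^sup>2 / 2))) has_real_derivative y) (at t) \<and> 0 \<le> y"
        using sc[OF t(1)] by (intro exI conjI) auto
    qed
    then have "cosh x * exp (- x\<^sup>2 / 2) \<le> 1" by simp
    then show ?thesis by (simp add: exp_minus field_simps)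
  qed
  show ?thesis using pos[of "\<bar>x\<bar>"] by simp
qed

lemma sum_sign_patterns_exp_le:
  fixes c :: "'i \<Rightarrow> real"
  assumes "finite I"
  shows "(\<Sum>\<epsilon>\<in>I \<rightarrow>\<^sub>E {-1, 1}. exp (\<Sum>i\<in>I. \<epsilon> i * c i)) \<le> 2 ^ card I * exp ((\<Sum>i\<in>I. (c i)\<^sup>2) / 2)"
proof -
  have "(\<Sum>\<epsilon>\<in>I \<rightarrow>\<^sub>E {-1, 1}. exp (\<Sum>i\<in>I. \<epsilon> i * c i)) = (\<Prod>i\<in>I. \<Sum>e\<in>{-1, 1}. exp (e * c i))"
    using assms by (subst prod_sum_PiE) (auto simp: exp_sum)
  also have "\<dots> \<le> (\<Prod>i\<in>I. 2 * exp ((c i)\<^sup>2 / 2))"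
  proof (rule prod_mono)
    fix i assume "i \<in> I"
    have "(\<Sum>e\<in>{-1, 1}. exp (e * c i)) = 2 * cosh (c i)"
      by (simp add: cosh_field_def)
    then show "0 \<le> (\<Sum>e\<in>{-1, 1}. exp (e * c i)) \<and> (\<Sum>e\<in>{-1, 1}. exp (e * c i)) \<le> 2 * exp ((c i)\<^sup>2 / 2)"
      using cosh_le_exp_half_square[of "c i"] by simp
  qed
  also have "\<dots> = 2 ^ card I * exp ((\<Sum>i\<in>I. (c i)\<^sup>2) / 2)"
    using assms by (simp add: prod.distrib exp_sum sum_divide_distrib)
  finally show ?thesis .
qed

section \<open>Gaussian integers and their weights\<close>

text \<open>The box only keeps the union bound finite; none of the weight estimates depends on
  \<open>R\<close>.\<close>

definition gauss_ints :: "nat \<Rightarrow> complex set" where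
  "gauss_ints R = (\<lambda>(a, b). Complex (of_int a) (of_int b)) ` ({- int R..int R} \<times> {- int R..int R})"

lemma finite_gauss_ints [simp]: "finite (gauss_ints R)"
  by (simp add: gauss_ints_def)

text \<open>Comparison with 1 + 2 (1/2 + 1/4 + ...) = 3. The induction carries the missing tail
  \<open>2 * (1 / 2) ^ R\<close>, without which the step would not close.\<close>

lemma sum_exp_neg_square_ints_le: "(\<Sum>a\<in>{- int R..int R}. exp (- (real_of_int a)\<^sup>2)) \<le> 3"
proof -
  have half: "exp (- (real n)\<^sup>2) \<le> (1 / 2) ^ n" for n
  proof -
    have "exp (- (real n)\<^sup>2) \<le> exp (- real n)"
      by (cases n) (auto simp: power2_eq_square algebra_simps)
    also have "\<dots> = exp (-1) ^ n" by (simp flip: exp_of_nat_mult)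
    also have "\<dots> \<le> (1 / 2) ^ n"
    proof (rule power_mono)
      have "(2::real) \<le> exp 1" using exp_ge_add_one_self[of 1] by simp
      then show "exp (-1) \<le> (1 / 2 :: real)" by (simp add: exp_minus field_simps)
    qed simp
    finally show ?thesis .
  qed
  have "(\<Sum>a\<in>{- int R..int R}. exp (- (real_of_int a)\<^sup>2)) \<le> 3 - 2 * (1 / 2) ^ R"
  proof (induction R)
    case (Suc R)
    have "{- int (Suc R)..int (Suc R)} = {- int R..int R} \<union> {int (Suc R), - int (Suc R)}"
      by auto
    moreover have "{- int R..int R} \<inter> {int (Suc R), - int (Suc R)} = {}" by auto
    ultimately have "(\<Sum>a\<in>{- int (Suc R)..int (Suc R)}. exp (- (real_of_int a)\<^sup>2)) =
       (\<Sum>a\<in>{- int R..int R}. exp (- (real_of_int a)\<^sup>2)) + (\<Sum>a\<in>{int (Suc R), - int (Suc R)}. exp (- (real_of_int a)\<^sup>2))"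
      by (simp add: sum.union_disjoint del: of_nat_Suc)
    also have "(\<Sum>a\<in>{int (Suc R), - int (Suc R)}. exp (- (real_of_int a)\<^sup>2)) = 2 * exp (- (real (Suc R))\<^sup>2)"
      by (subst sum.insert) (auto simp: power2_eq_square algebra_simps)
    finally show ?case using Suc half[of "Suc R"] by simp
  qed simp
  then show ?thesis by (smt (verit) zero_le_power divide_nonneg_pos)
qed

lemma sum_exp_neg_gauss_ints_le: "(\<Sum>z\<in>gauss_ints R. exp (- (cmod z)\<^sup>2)) \<le> 9"
proof -
  let ?I = "{- int R..int R}" and ?f = "\<lambda>a::int. exp (- (real_of_int a)\<^sup>2)"
  have inj: "inj_on (\<lambda>(a, b). Complex (of_int a) (of_int b)) (?I \<times> ?I)"
    by (auto simp: inj_on_def)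
  have "(\<Sum>z\<in>gauss_ints R. exp (- (cmod z)\<^sup>2)) = (\<Sum>(a,b)\<in>?I \<times> ?I. ?f a * ?f b)"
    unfolding gauss_ints_def
    by (subst sum.reindex[OF inj]) (auto simp: cmod_def exp_add[symmetric] intro!: sum.cong)
  also have "\<dots> = (\<Sum>a\<in>?I. ?f a) * (\<Sum>a\<in>?I. ?f a)"
    by (simp add: sum_product sum.cartesian_product)
  also have "\<dots> \<le> 3 * 3"
    by (intro mult_mono sum_exp_neg_square_ints_le) (auto intro: sum_nonneg)
  finally show ?thesis by simp
qed

lemma sum_exp_neg_lattice_le:
  assumes "finite I"
  shows "(\<Sum>x\<in>I \<rightarrow>\<^sub>E gauss_ints R. exp (- (\<Sum>i\<in>I. (cmod (x i))\<^sup>2))) \<le> 9 ^ card I"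
proof -
  have "(\<Sum>x\<in>I \<rightarrow>\<^sub>E gauss_ints R. exp (- (\<Sum>i\<in>I. (cmod (x i))\<^sup>2))) =
      (\<Prod>i\<in>I. \<Sum>z\<in>gauss_ints R. exp (- (cmod z)\<^sup>2))"
    using assms by (subst prod_sum_PiE) (auto simp: exp_sum sum_negf[symmetric])
  also have "\<dots> \<le> (\<Prod>i\<in>I. 9)"
    by (intro prod_mono) (auto intro: sum_nonneg sum_exp_neg_gauss_ints_le)
  finally show ?thesis by simp
qed

section \<open>Rounding to Gaussian integers\<close>

text \<open>Randomised rounding: taking the upper neighbour with probability u and the lower one
  with probability 1 - u has mean t and variance u(1 - u) \<le> 1/4. The linear term is unchanged on
  average, whatever \<open>\<beta>\<close> is, and one of the two outcomes is no worse than the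
  average.\<close>

lemma round_real:
  fixes t \<alpha> \<beta> :: real
  assumes "0 \<le> \<alpha>"
  shows "\<exists>n::int. \<bar>of_int n - t\<bar> \<le> 1 \<and> \<alpha> * (of_int n)\<^sup>2 + \<beta> * of_int n \<le> \<alpha> * t\<^sup>2 + \<beta> * t + \<alpha> / 4"
proof (rule ccontr)
  assume no: "\<not> ?thesis"
  define n where "n = \<lfloor>t\<rfloor>"
  define u where "u = t - of_int n"
  have t: "t = of_int n + u" by (simp add: u_def)
  have u: "0 \<le> u" "u \<le> 1" unfolding u_def n_def by linarith+
  have 1: "\<alpha> * (of_int n)\<^sup>2 + \<beta> * of_int n > \<alpha> * t\<^sup>2 + \<beta> * t + \<alpha> / 4"
  proof -
    have "\<bar>of_int n - t\<bar> \<le> 1" using u by (simp add: t)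
    then show ?thesis using no by (meson not_le)
  qed
  have 2: "\<alpha> * (of_int (n + 1))\<^sup>2 + \<beta> * of_int (n + 1) > \<alpha> * t\<^sup>2 + \<beta> * t + \<alpha> / 4"
  proof -
    have "\<bar>of_int (n + 1) - t\<bar> \<le> 1" using u by (simp add: t)
    then show ?thesis using no by (meson not_le)
  qed
  have "(1 - u) * (\<alpha> * (of_int n)\<^sup>2 + \<beta> * of_int n) + u * (\<alpha> * (of_int (n + 1))\<^sup>2 + \<beta> * of_int (n + 1))
      = \<alpha> * t\<^sup>2 + \<beta> * t + \<alpha> * (u * (1 - u))"
    unfolding t by (simp add: power2_eq_square algebra_simps)
  also have "\<dots> \<le> \<alpha> * t\<^sup>2 + \<beta> * t + \<alpha> / 4"
  proof -
    have "u * (1 - u) \<le> 1 / 4" using zero_le_power2[of "2 * u - 1"] by (simp add: power2_eq_square algebra_simps)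
    then have "\<alpha> * (u * (1 - u)) \<le> \<alpha> * (1 / 4)" using assms by (intro mult_left_mono) auto
    then show ?thesis by simp
  qed
  finally have le: "(1 - u) * (\<alpha> * (of_int n)\<^sup>2 + \<beta> * of_int n) + u * (\<alpha> * (of_int (n + 1))\<^sup>2 + \<beta> * of_int (n + 1))
    \<le> \<alpha> * t\<^sup>2 + \<beta> * t + \<alpha> / 4" .
  define X where "X = \<alpha> * (of_int n)\<^sup>2 + \<beta> * of_int n"
  define Y where "Y = \<alpha> * (of_int (n + 1))\<^sup>2 + \<beta> * of_int (n + 1)"
  define Z where "Z = \<alpha> * t\<^sup>2 + \<beta> * t + \<alpha> / 4"
  have "(1 - u) * (X - Z) + u * (Y - Z) \<le> 0" using le unfolding X_def[symmetric] Y_def[symmetric] Z_def[symmetric]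
    by (simp add: algebra_simps)
  moreover have "X - Z > 0" "Y - Z > 0" using 1 2 by (auto simp: X_def Y_def Z_def)
  ultimately show False using u
    by (smt (verit) mult_nonneg_nonneg mult_pos_pos)
qed

text \<open>The bound 1 on each part serves only to keep rounded points in a box; the cost of
  rounding is measured by the mean square error.\<close>

definition rounds_to :: "complex \<Rightarrow> complex \<Rightarrow> bool" where
  "rounds_to w z \<longleftrightarrow> Re w \<in> \<int> \<and> Im w \<in> \<int> \<and> \<bar>Re w - Re z\<bar> \<le> 1 \<and> \<bar>Im w - Im z\<bar> \<le> 1"

lemma round_complex:
  fixes z \<beta> :: complex
  assumes "0 \<le> \<alpha>"
  shows "\<exists>w. rounds_to w z \<and>
    \<alpha> * (cmod w)\<^sup>2 + Re (\<beta> * w) \<le> \<alpha> * (cmod z)\<^sup>2 + Re (\<beta> * z) + \<alpha> / 2"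
proof -
  obtain m :: int where m: "\<bar>of_int m - Re z\<bar> \<le> 1"
      "\<alpha> * (of_int m)\<^sup>2 + Re \<beta> * of_int m \<le> \<alpha> * (Re z)\<^sup>2 + Re \<beta> * Re z + \<alpha> / 4"
    using round_real[OF assms] by blast
  obtain n :: int where n: "\<bar>of_int n - Im z\<bar> \<le> 1"
      "\<alpha> * (of_int n)\<^sup>2 + (- Im \<beta>) * of_int n \<le> \<alpha> * (Im z)\<^sup>2 + (- Im \<beta>) * Im z + \<alpha> / 4"
    using round_real[OF assms] by blast
  show ?thesis
    using m n by (intro exI[of _ "Complex (of_int m) (of_int n)"])
      (simp add: rounds_to_def cmod_power2 algebra_simps)
qed

text \<open>Method of conditional expectations, one coordinate at a time. The leading coefficient
  \<open>\<alpha> i\<close> is fixed before the base point, so the increments add up although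
  \<open>\<beta>\<close> and \<open>c\<close> change with every coordinate already rounded.\<close>

lemma round_coordinates:
  fixes g :: "('i \<Rightarrow> complex) \<Rightarrow> real"
  assumes "finite I" and "\<And>i. i \<in> I \<Longrightarrow> 0 \<le> \<alpha> i"
    and quad: "\<And>i x. i \<in> I \<Longrightarrow> \<exists>\<beta> c. \<forall>z. g (x(i := z)) = \<alpha> i * (cmod z)\<^sup>2 + Re (\<beta> * z) + c"
  shows "\<exists>y. (\<forall>i\<in>I. rounds_to (y i) (x i))
    \<and> g y \<le> g x + (\<Sum>i\<in>I. \<alpha> i) / 2"
proof -
  have "\<exists>y. (\<forall>i\<in>J. rounds_to (y i) (x i))
    \<and> (\<forall>i. i \<notin> J \<longrightarrow> y i = x i) \<and> g y \<le> g x + (\<Sum>i\<in>J. \<alpha> i) / 2" if "J \<subseteq> I" for J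
    using finite_subset[OF that assms(1)] that
  proof (induction J)
    case empty
    show ?case by (intro exI[of _ x]) simp
  next
    case (insert i J)
    then obtain y where y: "\<forall>i\<in>J. rounds_to (y i) (x i)"
        "\<forall>i. i \<notin> J \<longrightarrow> y i = x i" "g y \<le> g x + (\<Sum>i\<in>J. \<alpha> i) / 2"
      by auto
    have i: "i \<in> I" using insert by auto
    obtain \<beta> c where q: "\<And>z. g (y(i := z)) = \<alpha> i * (cmod z)\<^sup>2 + Re (\<beta> * z) + c"
      using quad[OF i] by blast
    obtain w where w: "rounds_to w (y i)" "\<alpha> i * (cmod w)\<^sup>2 + Re (\<beta> * w) \<le> \<alpha> i * (cmod (y i))\<^sup>2 + Re (\<beta> * y i) + \<alpha> i / 2"
      using round_complex[OF assms(2)[OF i]] by blast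
    have "g (y(i := w)) \<le> g (y(i := y i)) + \<alpha> i / 2"
      unfolding q using w(2) by simp
    then have "g (y(i := w)) \<le> g x + (\<Sum>i\<in>insert i J. \<alpha> i) / 2"
      using y(3) insert.hyps by (simp add: add_divide_distrib)
    moreover have yi: "y i = x i" using y(2) insert.hyps by blast
    moreover have "rounds_to ((y(i := w)) l) (x l)" if "l \<in> insert i J" for l
      using y(1) w(1) that yi by (cases "l = i") auto
    moreover have "(y(i := w)) l = x l" if "l \<notin> insert i J" for l
      using y(2) that by auto
    ultimately show ?case by blast
  qed
  from this[OF order_refl] show ?thesis by blast
qed

section \<open>Functions affine or quadratic in each coordinate\<close>

text \<open>The slope \<open>p\<close> is the same at every base point \<open>x\<close>; only the
  offset may vary. This uniformity is what \<open>round_coordinates\<close> requires of the leading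
  coefficients.\<close>

definition coord_affine :: "(('i \<Rightarrow> complex) \<Rightarrow> complex) \<Rightarrow> 'i \<Rightarrow> complex \<Rightarrow> bool" where
  "coord_affine f i p \<longleftrightarrow> (\<forall>x. \<exists>q. \<forall>z. f (x(i := z)) = p * z + q)"

definition coord_quadratic :: "(('i \<Rightarrow> complex) \<Rightarrow> real) \<Rightarrow> 'i \<Rightarrow> real \<Rightarrow> bool" where
  "coord_quadratic g i \<alpha> \<longleftrightarrow> (\<forall>x. \<exists>\<beta> c. \<forall>z. g (x(i := z)) = \<alpha> * (cmod z)\<^sup>2 + Re (\<beta> * z) + c)"

lemma coord_affine_const: "coord_affine (\<lambda>x. c) i 0"
  by (auto simp: coord_affine_def)

lemma coord_affine_proj: "coord_affine (\<lambda>x. x j) i (if j = i then 1 else 0)"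
  by (auto simp: coord_affine_def)

lemma coord_affine_add:
  assumes "coord_affine f i p" "coord_affine g i q"
  shows "coord_affine (\<lambda>x. f x + g x) i (p + q)"
  unfolding coord_affine_def
proof
  fix x
  obtain a b where "\<And>z. f (x(i := z)) = p * z + a" "\<And>z. g (x(i := z)) = q * z + b"
    using assms unfolding coord_affine_def by meson
  then show "\<exists>c. \<forall>z. f (x(i := z)) + g (x(i := z)) = (p + q) * z + c"
    by (intro exI[of _ "a + b"]) (simp add: algebra_simps)
qed

lemma coord_affine_mult:
  assumes "coord_affine f i p"
  shows "coord_affine (\<lambda>x. c * f x) i (c * p)"
  unfolding coord_affine_def
proof
  fix x
  obtain a where "\<And>z. f (x(i := z)) = p * z + a"
    using assms unfolding coord_affine_def by meson
  then show "\<exists>q. \<forall>z. c * f (x(i := z)) = c * p * z + q"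
    by (intro exI[of _ "c * a"]) (simp add: algebra_simps)
qed

lemma coord_affine_sum:
  assumes "finite J" "\<And>j. j \<in> J \<Longrightarrow> coord_affine (f j) i (p j)"
  shows "coord_affine (\<lambda>x. \<Sum>j\<in>J. f j x) i (\<Sum>j\<in>J. p j)"
  using assms by (induction J) (auto intro: coord_affine_const coord_affine_add)

lemma coord_quadratic_const: "coord_quadratic (\<lambda>x. c) i 0"
  unfolding coord_quadratic_def by (intro allI exI[of _ 0] exI[of _ c]) simp

lemma coord_quadratic_add:
  assumes "coord_quadratic f i p" "coord_quadratic g i q"
  shows "coord_quadratic (\<lambda>x. f x + g x) i (p + q)"
  unfolding coord_quadratic_def
proof
  fix x
  obtain a b a' b' where h: "\<And>z. f (x(i := z)) = p * (cmod z)\<^sup>2 + Re (a * z) + b"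
     "\<And>z. g (x(i := z)) = q * (cmod z)\<^sup>2 + Re (a' * z) + b'"
    using assms unfolding coord_quadratic_def by meson
  show "\<exists>\<beta> c. \<forall>z. f (x(i := z)) + g (x(i := z)) = (p + q) * (cmod z)\<^sup>2 + Re (\<beta> * z) + c"
    by (intro exI[of _ "a + a'"] exI[of _ "b + b'"]) (simp add: h algebra_simps)
qed

lemma coord_quadratic_mult:
  assumes "coord_quadratic f i p"
  shows "coord_quadratic (\<lambda>x. r * f x) i (r * p)"
  unfolding coord_quadratic_def
proof
  fix x
  obtain a b where h: "\<And>z. f (x(i := z)) = p * (cmod z)\<^sup>2 + Re (a * z) + b"
    using assms unfolding coord_quadratic_def by meson
  show "\<exists>\<beta> c. \<forall>z. r * f (x(i := z)) = r * p * (cmod z)\<^sup>2 + Re (\<beta> * z) + c"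
    by (intro exI[of _ "of_real r * a"] exI[of _ "r * b"]) (simp add: h algebra_simps)
qed

lemma coord_quadratic_sum:
  assumes "finite J" "\<And>j. j \<in> J \<Longrightarrow> coord_quadratic (f j) i (p j)"
  shows "coord_quadratic (\<lambda>x. \<Sum>j\<in>J. f j x) i (\<Sum>j\<in>J. p j)"
  using assms by (induction J) (auto intro: coord_quadratic_const coord_quadratic_add)

lemma coord_quadratic_Re:
  assumes "coord_affine f i p"
  shows "coord_quadratic (\<lambda>x. Re (f x)) i 0"
  unfolding coord_quadratic_def
proof
  fix x
  obtain a where "\<And>z. f (x(i := z)) = p * z + a"
    using assms unfolding coord_affine_def by meson
  then show "\<exists>\<beta> c. \<forall>z. Re (f (x(i := z))) = 0 * (cmod z)\<^sup>2 + Re (\<beta> * z) + c"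
    by (intro exI[of _ p] exI[of _ "Re a"]) simp
qed

lemma coord_quadratic_cmod:
  assumes "coord_affine f i p"
  shows "coord_quadratic (\<lambda>x. (cmod (f x))\<^sup>2) i ((cmod p)\<^sup>2)"
  unfolding coord_quadratic_def
proof
  fix x
  obtain a where "\<And>z. f (x(i := z)) = p * z + a"
    using assms unfolding coord_affine_def by meson
  moreover have "(cmod (p * z + a))\<^sup>2 = (cmod p)\<^sup>2 * (cmod z)\<^sup>2 + Re ((2 * p * cnj a) * z) + (cmod a)\<^sup>2" for z
    by (simp only: cmod_power2 mult.assoc) (simp add: power2_eq_square algebra_simps)
  ultimately show "\<exists>\<beta> c. \<forall>z. (cmod (f (x(i := z))))\<^sup>2 = (cmod p)\<^sup>2 * (cmod z)\<^sup>2 + Re (\<beta> * z) + c"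
    by metis
qed

definition sq_norm :: "'i set \<Rightarrow> ('i \<Rightarrow> complex) \<Rightarrow> real" where
  "sq_norm I x = (\<Sum>i\<in>I. (cmod (x i))\<^sup>2)"

lemma coord_quadratic_sq_norm:
  assumes "finite I" "i \<in> I"
  shows "coord_quadratic (sq_norm I) i 1"
proof -
  have "coord_quadratic (\<lambda>x. \<Sum>j\<in>I. (cmod (x j))\<^sup>2) i (\<Sum>j\<in>I. (cmod (if j = i then 1 else 0))\<^sup>2)"
    using assms by (intro coord_quadratic_sum coord_quadratic_cmod coord_affine_proj)
  moreover have "(\<Sum>j\<in>I. (cmod (if j = i then 1 else 0))\<^sup>2) = (\<Sum>j\<in>I. if j = i then 1 else 0)"
    by (intro sum.cong) auto
  ultimately show ?thesis using assms by (simp add: sq_norm_def[abs_def])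
qed

lemma sq_norm_nonneg [simp]: "0 \<le> sq_norm I x"
  by (simp add: sq_norm_def sum_nonneg)

text \<open>\<open>A\<close> and \<open>B\<close> are indexed by pairs \<open>(j, a)\<close> and \<open>(j, b)\<close> with \<open>j < k\<close> and \<open>a, b < d\<close>.\<close>

definition outer_sum :: "nat \<Rightarrow> (nat \<times> nat \<Rightarrow> complex) \<Rightarrow> (nat \<times> nat \<Rightarrow> complex) \<Rightarrow> nat \<Rightarrow> nat \<Rightarrow> complex" where
  "outer_sum k A B a b = (\<Sum>j<k. A (j, a) * B (j, b))"

text \<open>Squared Frobenius norm of the sum over \<open>j\<close> of the outer products of the
  rows of \<open>A\<close> and \<open>B\<close>, a matrix of rank at most \<open>k\<close>.\<close>

definition outer_sq :: "nat \<Rightarrow> nat \<Rightarrow> (nat \<times> nat \<Rightarrow> complex) \<Rightarrow> (nat \<times> nat \<Rightarrow> complex) \<Rightarrow> real" where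
  "outer_sq d k A B = (\<Sum>a<d. \<Sum>b<d. (cmod (outer_sum k A B a b))\<^sup>2)"

text \<open>Real part of a pairing of the random matrix with the rank-\<open>k\<close> matrix. It is
  trilinear in \<open>x\<close>, \<open>A\<close>, \<open>B\<close>, without conjugates, so that
  each argument can be rounded in turn; conjugates are put into \<open>A\<close> and
  \<open>B\<close> when it is applied.\<close>

definition sign_form :: "nat \<Rightarrow> nat \<Rightarrow> nat \<Rightarrow> (nat \<times> nat \<times> nat \<Rightarrow> real) \<Rightarrow> (nat \<Rightarrow> complex) \<Rightarrow>
    (nat \<times> nat \<Rightarrow> complex) \<Rightarrow> (nat \<times> nat \<Rightarrow> complex) \<Rightarrow> real" where
  "sign_form s d k \<epsilon> x A B =
     Re (\<Sum>i<s. \<Sum>a<d. \<Sum>b<d. of_real (\<epsilon> (i, a, b)) * (x i * outer_sum k A B a b))"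

lemma outer_sum_swap: "outer_sum k A B a b = outer_sum k B A b a"
  by (simp add: outer_sum_def mult.commute)

lemma outer_sq_swap: "outer_sq d k A B = outer_sq d k B A"
  unfolding outer_sq_def by (subst sum.swap) (simp add: outer_sum_swap[of k A])

lemma coord_affine_outer_sum:
  assumes "j < k"
  shows "coord_affine (\<lambda>A. outer_sum k A B a b) (j, a') (if a = a' then B (j, b) else 0)"
proof -
  have "coord_affine (\<lambda>A. \<Sum>l<k. B (l, b) * A (l, a)) (j, a') (\<Sum>l<k. B (l, b) * (if (l, a) = (j, a') then 1 else 0))"
    by (intro coord_affine_sum coord_affine_mult coord_affine_proj) auto
  moreover have "(\<Sum>l<k. B (l, b) * (if (l, a) = (j, a') then 1 else 0)) = (\<Sum>l<k. if l = j then (if a = a' then B (j, b) else 0) else 0)"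
    by (intro sum.cong) auto
  ultimately show ?thesis using assms by (simp add: outer_sum_def mult.commute)
qed

lemma coord_quadratic_outer_sq:
  assumes "j < k" "a' < d"
  shows "coord_quadratic (\<lambda>A. outer_sq d k A B) (j, a') (\<Sum>b<d. (cmod (B (j, b)))\<^sup>2)"
proof -
  have "coord_quadratic (\<lambda>A. outer_sq d k A B) (j, a')
     (\<Sum>a<d. \<Sum>b<d. (cmod (if a = a' then B (j, b) else 0))\<^sup>2)"
    unfolding outer_sq_def
    by (intro coord_quadratic_sum coord_quadratic_cmod coord_affine_outer_sum assms) auto
  moreover have "(\<Sum>a<d. \<Sum>b<d. (cmod (if a = a' then B (j, b) else 0))\<^sup>2) =
     (\<Sum>a<d. if a = a' then (\<Sum>b<d. (cmod (B (j, b)))\<^sup>2) else 0)"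
    by (intro sum.cong) auto
  ultimately show ?thesis using assms by simp
qed

lemma coord_quadratic_sign_form_A:
  assumes "j < k"
  shows "coord_quadratic (\<lambda>A. sign_form s d k \<epsilon> x A B) (j, a') 0"
  unfolding sign_form_def
proof (rule coord_quadratic_Re)
  show "coord_affine (\<lambda>A. \<Sum>i<s. \<Sum>a<d. \<Sum>b<d. of_real (\<epsilon> (i, a, b)) * (x i * outer_sum k A B a b)) (j, a')
     (\<Sum>i<s. \<Sum>a<d. \<Sum>b<d. of_real (\<epsilon> (i, a, b)) * (x i * (if a = a' then B (j, b) else 0)))"
    by (intro coord_affine_sum coord_affine_mult coord_affine_outer_sum assms) auto
qed

lemma coord_quadratic_sign_form_B:
  assumes "j < k"
  shows "coord_quadratic (\<lambda>B. sign_form s d k \<epsilon> x A B) (j, b') 0"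
  unfolding sign_form_def outer_sum_swap[of k A]
proof (rule coord_quadratic_Re)
  show "coord_affine (\<lambda>B. \<Sum>i<s. \<Sum>a<d. \<Sum>b<d. of_real (\<epsilon> (i, a, b)) * (x i * outer_sum k B A b a)) (j, b')
     (\<Sum>i<s. \<Sum>a<d. \<Sum>b<d. of_real (\<epsilon> (i, a, b)) * (x i * (if b = b' then A (j, a) else 0)))"
    by (intro coord_affine_sum coord_affine_mult coord_affine_outer_sum assms) auto
qed

lemma coord_quadratic_sign_form_x:
  "coord_quadratic (\<lambda>x. sign_form s d k \<epsilon> x A B) i 0"
proof -
  have *: "of_real e * (z * c) = (of_real e * c) * z" for e :: real and z c :: complex by simp
  show ?thesis
    unfolding sign_form_def *
    by (rule coord_quadratic_Re[where p = "\<Sum>l<s. \<Sum>a<d. \<Sum>b<d. of_real (\<epsilon> (l, a, b)) * outer_sum k A B a b * (if l = i then 1 else 0)"],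
      intro coord_affine_sum coord_affine_mult coord_affine_proj) auto
qed

text \<open>
  Rounding a coordinate raises the potential by the mean square rounding error times its leading
  coefficient, at most \<open>\<alpha>/2\<close>. The terms \<open>d/2\<close>, \<open>d\<^sup>2 k/4\<close> and \<open>s/2\<close> are these increments, collected
  while \<open>B\<close>, \<open>A\<close> and \<open>x\<close> are rounded in this order.
\<close>

lemma round_triple:
  fixes s d k :: nat
  assumes d: "0 \<le> \<theta>2"
  defines "IA \<equiv> {..<k} \<times> {..<d}"
  shows "\<exists>x' A' B'.
     (\<forall>i<s. rounds_to (x' i) (x i)) \<and>
     (\<forall>i\<in>IA. rounds_to (A' i) (A i)) \<and>
     (\<forall>i\<in>IA. rounds_to (B' i) (B i)) \<and>
     \<theta>2 / 2 * (sq_norm {..<s} x' * outer_sq d k A' B') + sq_norm {..<s} x' + sq_norm IA A' + sq_norm IA B'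
        + \<theta> * sign_form s d k \<epsilon> x' A' B'
     \<le> \<theta>2 / 2 * ((sq_norm {..<s} x + s / 2) *
          (outer_sq d k A B + d / 2 * sq_norm IA A + d / 2 * sq_norm IA B + d * d * k / 4))
        + sq_norm {..<s} x + sq_norm IA A + sq_norm IA B + d * k + s / 2
        + \<theta> * sign_form s d k \<epsilon> x A B"
proof -
  have fin: "finite IA" and card: "real (card IA) = k * d" by (auto simp: IA_def)
  have IA: "\<exists>j a. i = (j, a) \<and> j < k \<and> a < d" if "i \<in> IA" for i using that by (auto simp: IA_def)
  \<comment> \<open>Nested potentials: \<open>P0\<close> is the target, \<open>P1\<close> adds the
    cost of rounding \<open>B\<close>, and \<open>P2\<close> adds that of rounding \<open>A\<close>
    as well. The rounding itself is carried out on \<open>x\<close> under \<open>P2\<close>, then on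
    \<open>A\<close> under \<open>P1\<close>, then on \<open>B\<close> under \<open>P0\<close>;
    \<open>e0\<close> and \<open>e1\<close> say that each cost is exactly the difference of two
    consecutive potentials.\<close>
  define Q where "Q = (\<lambda>A B. outer_sq d k A B + d / 2 * sq_norm IA A + d / 2 * sq_norm IA B + d * d * k / 4)"
  define P2 where "P2 = (\<lambda>x A B. (\<theta>2 / 2 * Q A B) * sq_norm {..<s} x + sq_norm {..<s} x + sq_norm IA A + sq_norm IA B
        + d * k + \<theta> * sign_form s d k \<epsilon> x A B)"
  define P1 where "P1 = (\<lambda>x A B. \<theta>2 / 2 * (sq_norm {..<s} x * (outer_sq d k A B + d / 2 * sq_norm IA A))
        + sq_norm {..<s} x + sq_norm IA A + sq_norm IA B + d * k / 2 + \<theta> * sign_form s d k \<epsilon> x A B)"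
  define P0 where "P0 = (\<lambda>x A B. \<theta>2 / 2 * (sq_norm {..<s} x * outer_sq d k A B)
        + sq_norm {..<s} x + sq_norm IA A + sq_norm IA B + \<theta> * sign_form s d k \<epsilon> x A B)"
  have Q0: "0 \<le> Q A B" for A B
    unfolding Q_def outer_sq_def by (intro add_nonneg_nonneg mult_nonneg_nonneg sum_nonneg) auto
  have "\<exists>y. (\<forall>i\<in>{..<s}. rounds_to (y i) (x i))
    \<and> P2 y A B \<le> P2 x A B + (\<Sum>i<s. \<theta>2 / 2 * Q A B + 1) / 2"
  proof (rule round_coordinates)
    fix i x assume "i \<in> {..<s}"
    then have "coord_quadratic (\<lambda>x. (\<theta>2 / 2 * Q A B) * sq_norm {..<s} x + sq_norm {..<s} x + sq_norm IA A + sq_norm IA B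
        + d * k + \<theta> * sign_form s d k \<epsilon> x A B) i ((\<theta>2 / 2 * Q A B) * 1 + 1 + 0 + 0 + 0 + \<theta> * 0)"
      by (intro coord_quadratic_add coord_quadratic_mult coord_quadratic_sq_norm coord_quadratic_sign_form_x
        coord_quadratic_const) auto
    then show "\<exists>\<beta> c. \<forall>z. P2 (x(i := z)) A B = (\<theta>2 / 2 * Q A B + 1) * (cmod z)\<^sup>2 + Re (\<beta> * z) + c"
      unfolding coord_quadratic_def P2_def by (simp only: mult_1_right mult_zero_right add_0_right)
  next
    fix i assume "i \<in> {..<s}"
    show "0 \<le> \<theta>2 / 2 * Q A B + 1" using d Q0[of A B] by (intro add_nonneg_nonneg mult_nonneg_nonneg) simp_all
  qed simp
  then obtain x' where x': "\<forall>i<s. rounds_to (x' i) (x i)"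
     "P2 x' A B \<le> P2 x A B + (\<Sum>i<s. \<theta>2 / 2 * Q A B + 1) / 2" unfolding Ball_def lessThan_iff by blast
  let ?n = "sq_norm {..<s} x'"
  have "\<exists>y. (\<forall>i\<in>IA. rounds_to (y i) (A i))
    \<and> P1 x' y B \<le> P1 x' A B + (\<Sum>i\<in>IA. \<theta>2 / 2 * ?n * ((\<Sum>b<d. (cmod (B (fst i, b)))\<^sup>2) + d / 2) + 1) / 2"
  proof (rule round_coordinates)
    fix i A assume i: "i \<in> IA"
    obtain j a where ja: "i = (j, a)" "j < k" "a < d" using IA[OF i] by blast
    have "coord_quadratic (\<lambda>A. (\<theta>2 / 2 * ?n) * (outer_sq d k A B + d / 2 * sq_norm IA A)
        + ?n + sq_norm IA A + sq_norm IA B + d * k / 2 + \<theta> * sign_form s d k \<epsilon> x' A B) i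
        ((\<theta>2 / 2 * ?n) * ((\<Sum>b<d. (cmod (B (fst i, b)))\<^sup>2) + d / 2 * 1) + 0 + 1 + 0 + 0 + \<theta> * 0)"
      using ja i unfolding ja(1) fst_conv
      by (intro coord_quadratic_add coord_quadratic_mult coord_quadratic_sq_norm coord_quadratic_sign_form_A
        coord_quadratic_const coord_quadratic_outer_sq fin) auto
    then show "\<exists>\<beta> c. \<forall>z. P1 x' (A(i := z)) B = (\<theta>2 / 2 * ?n * ((\<Sum>b<d. (cmod (B (fst i, b)))\<^sup>2) + d / 2) + 1) * (cmod z)\<^sup>2 + Re (\<beta> * z) + c"
      unfolding coord_quadratic_def P1_def by (simp only: mult.assoc mult_1_right mult_zero_right add_0_right)
  next
    fix i assume "i \<in> IA"
    show "0 \<le> \<theta>2 / 2 * ?n * ((\<Sum>b<d. (cmod (B (fst i, b)))\<^sup>2) + d / 2) + 1"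
      using d by (intro add_nonneg_nonneg mult_nonneg_nonneg sum_nonneg) simp_all
  qed (rule fin)
  then obtain A' where A': "\<forall>i\<in>IA. rounds_to (A' i) (A i)"
     "P1 x' A' B \<le> P1 x' A B + (\<Sum>i\<in>IA. \<theta>2 / 2 * ?n * ((\<Sum>b<d. (cmod (B (fst i, b)))\<^sup>2) + d / 2) + 1) / 2" by blast
  have sumIA: "(\<Sum>i\<in>IA. \<Sum>b<d. (cmod (B (fst i, b)))\<^sup>2) = d * sq_norm IA B" for B :: "nat \<times> nat \<Rightarrow> complex"
  proof -
    have "(\<Sum>i\<in>IA. \<Sum>b<d. (cmod (B (fst i, b)))\<^sup>2) = (\<Sum>j<k. \<Sum>a<d. \<Sum>b<d. (cmod (B (j, b)))\<^sup>2)"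
      unfolding IA_def sum.cartesian_product' by simp
    also have "\<dots> = d * sq_norm IA B"
      unfolding IA_def sq_norm_def sum.cartesian_product' by (simp add: sum_distrib_left)
    finally show ?thesis .
  qed
  have sumA: "(\<Sum>i\<in>IA. \<theta>2 / 2 * ?n * ((\<Sum>b<d. (cmod (B (fst i, b)))\<^sup>2) + d / 2) + 1)
     = \<theta>2 / 2 * ?n * (d * sq_norm IA B + k * d * (d / 2)) + k * d"
    unfolding sum.distrib sum_distrib_left[symmetric] sumIA by (simp add: card)
  have "\<exists>y. (\<forall>i\<in>IA. rounds_to (y i) (B i))
    \<and> P0 x' A' y \<le> P0 x' A' B + (\<Sum>i\<in>IA. \<theta>2 / 2 * ?n * (\<Sum>b<d. (cmod (A' (fst i, b)))\<^sup>2) + 1) / 2"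
  proof (rule round_coordinates)
    fix i B assume i: "i \<in> IA"
    obtain j a where ja: "i = (j, a)" "j < k" "a < d" using IA[OF i] by blast
    have "coord_quadratic (\<lambda>B. (\<theta>2 / 2 * ?n) * outer_sq d k B A'
        + ?n + sq_norm IA A' + sq_norm IA B + \<theta> * sign_form s d k \<epsilon> x' A' B) i
        ((\<theta>2 / 2 * ?n) * (\<Sum>b<d. (cmod (A' (fst i, b)))\<^sup>2) + 0 + 0 + 1 + \<theta> * 0)"
      using ja i unfolding ja(1) fst_conv
      by (intro coord_quadratic_add coord_quadratic_mult coord_quadratic_sq_norm coord_quadratic_sign_form_B
        coord_quadratic_const coord_quadratic_outer_sq fin) auto
    then show "\<exists>\<beta> c. \<forall>z. P0 x' A' (B(i := z)) = (\<theta>2 / 2 * ?n * (\<Sum>b<d. (cmod (A' (fst i, b)))\<^sup>2) + 1) * (cmod z)\<^sup>2 + Re (\<beta> * z) + c"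
      unfolding coord_quadratic_def P0_def outer_sq_swap[of d k A'] by (simp only: mult.assoc mult_zero_right add_0_right)
  next
    fix i assume "i \<in> IA"
    show "0 \<le> \<theta>2 / 2 * ?n * (\<Sum>b<d. (cmod (A' (fst i, b)))\<^sup>2) + 1"
      using d by (intro add_nonneg_nonneg mult_nonneg_nonneg sum_nonneg) simp_all
  qed (rule fin)
  then obtain B' where B': "\<forall>i\<in>IA. rounds_to (B' i) (B i)"
     "P0 x' A' B' \<le> P0 x' A' B + (\<Sum>i\<in>IA. \<theta>2 / 2 * ?n * (\<Sum>b<d. (cmod (A' (fst i, b)))\<^sup>2) + 1) / 2" by blast
  have sumB: "(\<Sum>i\<in>IA. \<theta>2 / 2 * ?n * (\<Sum>b<d. (cmod (A' (fst i, b)))\<^sup>2) + 1)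
     = \<theta>2 / 2 * ?n * (d * sq_norm IA A') + k * d"
    unfolding sum.distrib sum_distrib_left[symmetric] sumIA by (simp add: card)
  have e0: "P0 x' A' B + (\<theta>2 / 2 * ?n * (d * sq_norm IA A') + k * d) / 2 = P1 x' A' B"
    unfolding P0_def P1_def by (simp add: field_simps)
  have e1: "P1 x' A B + (\<theta>2 / 2 * ?n * (d * sq_norm IA B + k * d * (d / 2)) + k * d) / 2 = P2 x' A B"
    unfolding P1_def P2_def Q_def by (simp add: field_simps)
  have "P0 x' A' B' \<le> P2 x A B + s * (\<theta>2 / 2 * Q A B + 1) / 2"
    using x'(2)[unfolded sum_constant card_lessThan] A'(2)[unfolded sumA] B'(2)[unfolded sumB] e0 e1 by linarith
  also have "\<dots> = \<theta>2 / 2 * ((sq_norm {..<s} x + s / 2) * Q A B)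
        + sq_norm {..<s} x + sq_norm IA A + sq_norm IA B + d * k + s / 2 + \<theta> * sign_form s d k \<epsilon> x A B"
    unfolding P2_def by (simp add: field_simps)
  finally show ?thesis
    unfolding P0_def Q_def using x'(1) A'(1) B'(1) by blast
qed

section \<open>Union bound over lattice points\<close>

text \<open>The exponent is linear in the independent signs. Bounding each real part by the modulus
  makes the sum of squared coefficients factor into \<open>sq_norm\<close> times
  \<open>outer_sq\<close>.\<close>

lemma sum_sign_form_exp_le:
  fixes \<theta> :: real
  defines "I s d \<equiv> {..<s} \<times> {..<d} \<times> {..<d :: nat}"
  shows "(\<Sum>\<epsilon>\<in>I s d \<rightarrow>\<^sub>E {-1, 1}. exp (\<theta> * sign_form s d k \<epsilon> x A B))
    \<le> 2 ^ card (I s d) * exp (\<theta>\<^sup>2 / 2 * (sq_norm {..<s} x * outer_sq d k A B))"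
proof -
  let ?c = "\<lambda>t. \<theta> * Re (x (fst t) * outer_sum k A B (fst (snd t)) (snd (snd t)))"
  have fin: "finite (I s d)" by (simp add: I_def)
  have "\<theta> * sign_form s d k \<epsilon> x A B = (\<Sum>t\<in>I s d. \<epsilon> t * ?c t)" for \<epsilon>
    unfolding sign_form_def I_def sum.cartesian_product'
    by (simp add: sum_distrib_left algebra_simps)
  then have "(\<Sum>\<epsilon>\<in>I s d \<rightarrow>\<^sub>E {-1, 1}. exp (\<theta> * sign_form s d k \<epsilon> x A B))
     \<le> 2 ^ card (I s d) * exp ((\<Sum>t\<in>I s d. (?c t)\<^sup>2) / 2)"
    using sum_sign_patterns_exp_le[OF fin, of ?c] by simp
  also have "(\<Sum>t\<in>I s d. (?c t)\<^sup>2) \<le> (\<Sum>t\<in>I s d. \<theta>\<^sup>2 * ((cmod (x (fst t)))\<^sup>2 * (cmod (outer_sum k A B (fst (snd t)) (snd (snd t))))\<^sup>2))"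
    unfolding power_mult_distrib[of \<theta>] power_mult_distrib[of "cmod _" "cmod _", symmetric] norm_mult[symmetric]
    by (intro sum_mono mult_left_mono) (simp_all add: cmod_power2 del: times_complex.sel)
  also have "\<dots> = \<theta>\<^sup>2 * (sq_norm {..<s} x * outer_sq d k A B)"
    unfolding sq_norm_def outer_sq_def I_def sum.cartesian_product' sum_product
    by (simp add: sum_distrib_left sum_product mult_ac)
  finally show ?thesis by simp
qed

lemma sq_norm_cong: "(\<And>i. i \<in> I \<Longrightarrow> x i = y i) \<Longrightarrow> sq_norm I x = sq_norm I y"
  by (simp add: sq_norm_def)

lemma outer_sum_cong:
  assumes "\<And>j. j < k \<Longrightarrow> A (j, a) = A' (j, a)" "\<And>j. j < k \<Longrightarrow> B (j, b) = B' (j, b)"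
  shows "outer_sum k A B a b = outer_sum k A' B' a b"
  using assms by (simp add: outer_sum_def)

lemma ex_le_average:
  fixes f :: "'a \<Rightarrow> real" and m :: real
  assumes "finite E" "E \<noteq> {}" "(\<Sum>e\<in>E. f e) \<le> card E * m"
  shows "\<exists>e\<in>E. f e \<le> m"
proof (rule ccontr)
  assume "\<not> ?thesis"
  then have "(\<Sum>e\<in>E. m) < (\<Sum>e\<in>E. f e)"
    using assms by (intro sum_strict_mono) (auto simp: not_le)
  then show False using assms(3) by simp
qed

text \<open>Averaged over the signs, the weighted exponential moments, summed over all lattice
  points and divided by a power of 9, give at most 1 for each \<open>k\<close>, hence at most
  \<open>d\<close> in total. Some sign pattern attains this, and then every single term is at most
  \<open>d\<close>; logarithms give the claim. The parameter \<open>\<theta>\<close> must be chosen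
  in advance, hence may depend on \<open>k\<close> but not on the lattice point.\<close>

lemma ex_signs_below_potential:
  fixes s d R :: nat and \<theta> :: "nat \<Rightarrow> real"
  assumes "1 \<le> d"
  shows "\<exists>\<epsilon>. (\<forall>i<s. \<forall>a<d. \<forall>b<d. \<epsilon> (i, a, b) \<in> {-1, 1}) \<and>
    (\<forall>k\<in>{1..d}. \<forall>x A B. (\<forall>i<s. x i \<in> gauss_ints R) \<longrightarrow>
       (\<forall>i\<in>{..<k} \<times> {..<d}. A i \<in> gauss_ints R \<and> B i \<in> gauss_ints R) \<longrightarrow>
       \<theta> k * sign_form s d k \<epsilon> x A B \<le> (\<theta> k)\<^sup>2 / 2 * (sq_norm {..<s} x * outer_sq d k A B) + sq_norm {..<s} x
         + sq_norm ({..<k} \<times> {..<d}) A + sq_norm ({..<k} \<times> {..<d}) B + (s + 2 * (k * d)) * ln 9 + ln d)"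
proof -
  let ?I = "{..<s} \<times> {..<d} \<times> {..<d}"
  define E where "E = ?I \<rightarrow>\<^sub>E {-1, 1 :: real}"
  let ?J = "\<lambda>k :: nat. {..<k} \<times> {..<d}"
  define T where "T = (\<lambda>k. ({..<s} \<rightarrow>\<^sub>E gauss_ints R) \<times> (?J k \<rightarrow>\<^sub>E gauss_ints R) \<times> (?J k \<rightarrow>\<^sub>E gauss_ints R))"
  define V where "V = (\<lambda>k (x, A, B). (\<theta> k)\<^sup>2 / 2 * (sq_norm {..<s} x * outer_sq d k A B))"
  define N where "N = (\<lambda>k (x, A, B). sq_norm {..<s} x + sq_norm (?J k) A + sq_norm (?J k) B)"
  define F where "F = (\<lambda>\<epsilon> k (x, A, B). \<theta> k * sign_form s d k \<epsilon> x A B)"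
  define W where "W = (\<lambda>\<epsilon> k t. exp (F \<epsilon> k t - V k t - N k t))"
  have finE: "finite E" "E \<noteq> {}" and cardE: "card E = 2 ^ card ?I"
    unfolding E_def by (auto intro!: finite_PiE simp: PiE_eq_empty_iff card_PiE numeral_2_eq_2)
  have finT: "finite (T k)" for k unfolding T_def by (intro finite_cartesian_product finite_PiE) auto
  have FE: "(\<Sum>\<epsilon>\<in>E. W \<epsilon> k t) \<le> card E * exp (- N k t)" for k t
  proof -
    obtain x A B where t: "t = (x, A, B)" by (cases t)
    have e: "exp (a - b - c) = exp a * (exp (- b) * exp (- c))" for a b c :: real
      by (simp add: exp_diff exp_minus exp_add field_simps)
    have "(\<Sum>\<epsilon>\<in>E. W \<epsilon> k t) = (\<Sum>\<epsilon>\<in>E. exp (F \<epsilon> k t)) * (exp (- V k t) * exp (- N k t))"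
      unfolding sum_distrib_right unfolding W_def e ..
    also have "\<dots> \<le> (card E * exp (V k t)) * (exp (- V k t) * exp (- N k t))"
    proof (rule mult_right_mono)
      show "(\<Sum>\<epsilon>\<in>E. exp (F \<epsilon> k t)) \<le> card E * exp (V k t)"
        unfolding cardE
        unfolding E_def F_def V_def t split of_nat_power of_nat_numeral
        by (rule sum_sign_form_exp_le)
    qed simp
    also have "\<dots> = card E * exp (- N k t)" by (simp add: exp_minus)
    finally show ?thesis .
  qed
  have NT: "(\<Sum>t\<in>T k. exp (- N k t)) \<le> 9 ^ (s + 2 * (k * d))" for k
  proof -
    have "(\<Sum>t\<in>T k. exp (- N k t)) = (\<Sum>x\<in>{..<s} \<rightarrow>\<^sub>E gauss_ints R. exp (- sq_norm {..<s} x)) *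
       ((\<Sum>A\<in>?J k \<rightarrow>\<^sub>E gauss_ints R. exp (- sq_norm (?J k) A)) * (\<Sum>B\<in>?J k \<rightarrow>\<^sub>E gauss_ints R. exp (- sq_norm (?J k) B)))"
    proof -
      have e: "exp (- (a + b + c)) = exp (- a) * (exp (- b) * exp (- c))" for a b c :: real
        by (simp only: minus_add_distrib exp_add mult.assoc)
      show ?thesis
        unfolding T_def sum.cartesian_product' N_def split e
        by (simp only: sum_distrib_left[symmetric] sum_distrib_right[symmetric])
    qed
    also have "\<dots> \<le> 9 ^ card {..<s} * (9 ^ card (?J k) * 9 ^ card (?J k))"
      unfolding sq_norm_def
      by (intro mult_mono sum_exp_neg_lattice_le mult_nonneg_nonneg sum_nonneg) auto
    also have "\<dots> = 9 ^ (s + 2 * (k * d))" by (simp add: power_add[symmetric] mult_2)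
    finally show ?thesis .
  qed
  have "(\<Sum>\<epsilon>\<in>E. \<Sum>k\<in>{1..d}. \<Sum>t\<in>T k. W \<epsilon> k t / 9 ^ (s + 2 * (k * d)))
      = (\<Sum>k\<in>{1..d}. \<Sum>t\<in>T k. (\<Sum>\<epsilon>\<in>E. W \<epsilon> k t) / 9 ^ (s + 2 * (k * d)))"
    by (subst sum.swap, intro sum.cong refl, subst sum.swap) (simp add: sum_divide_distrib)
  also have "\<dots> \<le> (\<Sum>k\<in>{1..d}. \<Sum>t\<in>T k. card E * exp (- N k t) / 9 ^ (s + 2 * (k * d)))"
    by (intro sum_mono divide_right_mono FE) auto
  also have "\<dots> = (\<Sum>k\<in>{1..d}. card E * ((\<Sum>t\<in>T k. exp (- N k t)) / 9 ^ (s + 2 * (k * d))))"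
    by (simp add: sum_distrib_left sum_divide_distrib)
  also have "\<dots> \<le> (\<Sum>k\<in>{1..d}. real (card E) * 1)"
    using NT by (intro sum_mono mult_left_mono) (auto simp: divide_le_eq)
  also have "\<dots> = card E * real d" by simp
  finally obtain \<epsilon> where \<epsilon>: "\<epsilon> \<in> E" "(\<Sum>k\<in>{1..d}. \<Sum>t\<in>T k. W \<epsilon> k t / 9 ^ (s + 2 * (k * d))) \<le> d"
    using ex_le_average[OF finE] by blast
  have W0: "0 \<le> W \<epsilon> k t" for k t by (simp add: W_def)
  have main: "F \<epsilon> k t \<le> V k t + N k t + (s + 2 * (k * d)) * ln 9 + ln d" if "k \<in> {1..d}" "t \<in> T k" for k t
  proof -
    have "W \<epsilon> k t / 9 ^ (s + 2 * (k * d)) \<le> (\<Sum>t\<in>T k. W \<epsilon> k t / 9 ^ (s + 2 * (k * d)))"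
      using that finT W0 by (intro member_le_sum) auto
    also have "\<dots> \<le> (\<Sum>k\<in>{1..d}. \<Sum>t\<in>T k. W \<epsilon> k t / 9 ^ (s + 2 * (k * d)))"
      using that W0 by (intro member_le_sum[where f = "\<lambda>k. \<Sum>t\<in>T k. W \<epsilon> k t / 9 ^ (s + 2 * (k * d))"]) (auto intro!: sum_nonneg)
    also have "\<dots> \<le> d" by (rule \<epsilon>(2))
    finally have "W \<epsilon> k t \<le> 9 ^ (s + 2 * (k * d)) * d" by (simp add: field_simps)
    then have "ln (W \<epsilon> k t) \<le> ln (9 ^ (s + 2 * (k * d)) * real d)"
      using assms by (subst ln_le_cancel_iff) (auto simp: W_def)
    also have "\<dots> = (s + 2 * (k * d)) * ln 9 + ln d"
      using assms by (simp add: ln_mult ln_realpow)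
    finally show ?thesis by (simp add: W_def)
  qed
  show ?thesis
  proof (intro exI[of _ \<epsilon>] conjI ballI allI impI)
    show "\<epsilon> (i, a, b) \<in> {-1, 1}" if "i < s" "a < d" "b < d" for i a b
      using \<epsilon>(1) that unfolding E_def by (auto simp: PiE_iff)
    fix k x A B
    assume k: "k \<in> {1..d}" and x: "\<forall>i<s. x i \<in> gauss_ints R"
      and AB: "\<forall>i\<in>?J k. A i \<in> gauss_ints R \<and> B i \<in> gauss_ints R"
    \<comment> \<open>\<open>T k\<close> consists of extensional functions, while \<open>x\<close>,
      \<open>A\<close>, \<open>B\<close> are arbitrary off their index sets; all quantities involved
      look only at the index sets.\<close>
    let ?x = "restrict x {..<s}" and ?A = "restrict A (?J k)" and ?B = "restrict B (?J k)"
    have "(?x, ?A, ?B) \<in> T k" using x AB by (auto simp: T_def)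
    from main[OF k this] have m: "\<theta> k * sign_form s d k \<epsilon> ?x ?A ?B \<le> (\<theta> k)\<^sup>2 / 2 * (sq_norm {..<s} ?x * outer_sq d k ?A ?B) + sq_norm {..<s} ?x
         + sq_norm (?J k) ?A + sq_norm (?J k) ?B + (s + 2 * (k * d)) * ln 9 + ln d"
      by (simp add: F_def V_def N_def add_ac)
    have o: "outer_sum k ?A ?B a b = outer_sum k A B a b" if "a < d" "b < d" for a b
      using that by (intro outer_sum_cong) auto
    have "sign_form s d k \<epsilon> ?x ?A ?B = sign_form s d k \<epsilon> x A B"
      unfolding sign_form_def by (intro arg_cong[where f = Re] sum.cong refl) (auto simp: o)
    moreover have "outer_sq d k ?A ?B = outer_sq d k A B"
      unfolding outer_sq_def by (intro sum.cong refl) (auto simp: o)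
    moreover have "sq_norm {..<s} ?x = sq_norm {..<s} x" "sq_norm (?J k) ?A = sq_norm (?J k) A" "sq_norm (?J k) ?B = sq_norm (?J k) B"
      by (auto intro!: sq_norm_cong)
    ultimately show "\<theta> k * sign_form s d k \<epsilon> x A B \<le> (\<theta> k)\<^sup>2 / 2 * (sq_norm {..<s} x * outer_sq d k A B) + sq_norm {..<s} x
         + sq_norm (?J k) A + sq_norm (?J k) B + (s + 2 * (k * d)) * ln 9 + ln d"
      using m by simp
  qed
qed

section \<open>Existence of flat signs\<close>

lemma ln_9_le: "ln 9 \<le> (9 / 4 :: real)"
proof -
  have "(3::real) \<le> (1445 / 1000) ^ 3" by (simp add: power3_eq_cube)
  also have "\<dots> \<le> exp (3 / 8) ^ 3"
    using exp_lower_Taylor_quadratic[of "3 / 8"] by (intro power_mono) (simp_all add: power2_eq_square)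
  finally have "3 * 3 \<le> (exp (3 / 8) ^ 3) * (exp (3 / 8 :: real) ^ 3)" by (intro mult_mono) auto
  also have "\<dots> = exp (9 / 4)" by (simp flip: exp_of_nat_mult exp_add)
  finally have "(9::real) \<le> exp (9 / 4)" by simp
  then have "ln 9 \<le> ln (exp (9 / 4 :: real))" by (subst ln_le_cancel_iff) auto
  then show ?thesis by simp
qed

lemma gauss_intsI:
  assumes "rounds_to w z" "cmod z \<le> r" "r + 1 \<le> real R"
  shows "w \<in> gauss_ints R"
proof -
  obtain m n :: int where mn: "Re w = of_int m" "Im w = of_int n" using assms(1) by (auto simp: rounds_to_def elim!: Ints_cases)
  have "\<bar>Re z\<bar> \<le> r" "\<bar>Im z\<bar> \<le> r" using assms(2) abs_Re_le_cmod[of z] abs_Im_le_cmod[of z] by linarith+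
  then have "\<bar>of_int m\<bar> \<le> real R" "\<bar>of_int n\<bar> \<le> real R" using assms(1,3) mn unfolding rounds_to_def by linarith+
  then have "m \<in> {- int R..int R}" "n \<in> {- int R..int R}" by auto
  moreover have "w = Complex (of_int m) (of_int n)" using mn by (simp add: complex_eq_iff)
  ultimately show ?thesis unfolding gauss_ints_def by force
qed

lemma cmod_le_of_sq_norm:
  assumes "finite I" "i \<in> I" "sq_norm I x \<le> r\<^sup>2" "0 \<le> r"
  shows "cmod (x i) \<le> r"
proof -
  have "(cmod (x i))\<^sup>2 \<le> sq_norm I x"
    unfolding sq_norm_def using assms by (intro member_le_sum) auto
  then show ?thesis using assms(3,4) by (meson order_trans power2_le_imp_le)
qed

lemma sq_norm_times: "sq_norm ({..<k} \<times> {..<d}) A = (\<Sum>j<k. \<Sum>a<d. (cmod (A (j, a)))\<^sup>2)"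
  unfolding sq_norm_def sum.cartesian_product' by simp

text \<open>Expanding the square produces the Gram matrices of the rows of \<open>A\<close> and of
  \<open>B\<close>; the first kills the cross terms. No orthogonality of \<open>B\<close> enters, so
  \<open>B\<close> is free to be matched to the random matrix.\<close>

lemma outer_sq_orthogonal:
  assumes "\<And>j l. j < k \<Longrightarrow> l < k \<Longrightarrow> (\<Sum>a<d. A (j, a) * cnj (A (l, a))) = (if j = l then of_real r else 0)"
  shows "outer_sq d k A B = r * sq_norm ({..<k} \<times> {..<d}) B"
proof -
  let ?G = "\<lambda>a b j l. (A (j, a) * cnj (A (l, a))) * (B (j, b) * cnj (B (l, b)))"
  have "complex_of_real (outer_sq d k A B) = (\<Sum>a<d. \<Sum>b<d. \<Sum>j<k. \<Sum>l<k. ?G a b j l)"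
    unfolding outer_sq_def outer_sum_def of_real_sum complex_norm_square cnj_sum sum_product
    by (simp add: mult_ac)
  also have "\<dots> = (\<Sum>a<d. \<Sum>j<k. \<Sum>l<k. \<Sum>b<d. ?G a b j l)"
    by (rule sum.cong[OF refl], subst sum.swap, rule sum.cong[OF refl], rule sum.swap)
  also have "\<dots> = (\<Sum>j<k. \<Sum>a<d. \<Sum>l<k. \<Sum>b<d. ?G a b j l)"
    by (rule sum.swap)
  also have "\<dots> = (\<Sum>j<k. \<Sum>l<k. \<Sum>a<d. \<Sum>b<d. ?G a b j l)"
    by (rule sum.cong[OF refl], rule sum.swap)
  also have "\<dots> = (\<Sum>j<k. \<Sum>l<k. (\<Sum>a<d. A (j, a) * cnj (A (l, a))) * (\<Sum>b<d. B (j, b) * cnj (B (l, b))))"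
    by (simp only: sum_product)
  also have "\<dots> = (\<Sum>j<k. \<Sum>l<k. if l = j then of_real r * (\<Sum>b<d. B (j, b) * cnj (B (j, b))) else 0)"
    by (intro sum.cong refl) (auto simp: assms)
  also have "\<dots> = (\<Sum>j<k. of_real r * (\<Sum>b<d. B (j, b) * cnj (B (j, b))))"
    by (intro sum.cong refl) simp
  also have "\<dots> = complex_of_real (r * sq_norm ({..<k} \<times> {..<d}) B)"
    unfolding sq_norm_times of_real_mult of_real_sum complex_norm_square by (simp only: sum_distrib_left)
  finally show ?thesis using of_real_eq_iff by blast
qed

text \<open>For fixed \<open>x\<close> and \<open>u\<close> each squared modulus has mean 1 over
  random signs, so k d is the typical size. The constant 46 and the term 24 s pay for uniformity
  over all frames \<open>u\<close> and all unit \<open>x\<close>.\<close>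

definition flat_signs :: "nat \<Rightarrow> nat \<Rightarrow> (nat \<times> nat \<times> nat \<Rightarrow> real) \<Rightarrow> bool" where
  "flat_signs s d \<epsilon> \<longleftrightarrow> (\<forall>i<s. \<forall>a<d. \<forall>b<d. \<epsilon> (i, a, b) \<in> {-1, 1}) \<and>
    (\<forall>k\<le>d. \<forall>x u. sq_norm {..<s} x = 1 \<longrightarrow>
       (\<forall>j<k. \<forall>l<k. (\<Sum>a<d. u j a * cnj (u l a)) = (if j = l then 1 else 0)) \<longrightarrow>
       (\<Sum>j<k. \<Sum>b<d. (cmod (\<Sum>a<d. \<Sum>i<s. of_real (\<epsilon> (i, a, b)) * (cnj (u j a) * x i)))\<^sup>2)
         \<le> 46 * k * d + 24 * s)"

theorem ex_flat_signs:
  fixes s d :: nat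
  assumes s: "1 \<le> s" and d: "1 \<le> d"
  shows "\<exists>\<epsilon>. flat_signs s d \<epsilon>"
proof -
  \<comment> \<open>Scaled coordinates turn out to have modulus at most 2 s d, and rounding moves
    each part by at most 1.\<close>
  define R where "R = 2 * s * d + 1"
  \<comment> \<open>Everything in the exponent except variance: 2 s + 4 k d from the norms after
    rounding, (s + 2 k d) * 9/4 for the lattice entropy, and ln d \<le> k d. Together 17/4 s + 19/2
    k d, with 17/4 enlarged to 5. The value of \<open>\<theta>\<close> makes the variance term equal
    to \<open>E k\<close>.\<close>
  define E where "E = (\<lambda>k::nat. 19 / 2 * (k * d) + 5 * real s)"
  define \<theta> where "\<theta> = (\<lambda>k::nat. sqrt (E k / (4 * s * d * d * k)))"
  obtain \<epsilon> where signs: "\<forall>i<s. \<forall>a<d. \<forall>b<d. \<epsilon> (i, a, b) \<in> {-1, 1}"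
    and pot: "\<And>k x A B. k \<in> {1..d} \<Longrightarrow> (\<forall>i<s. x i \<in> gauss_ints R) \<Longrightarrow>
       (\<forall>i\<in>{..<k} \<times> {..<d}. A i \<in> gauss_ints R \<and> B i \<in> gauss_ints R) \<Longrightarrow>
       \<theta> k * sign_form s d k \<epsilon> x A B \<le> (\<theta> k)\<^sup>2 / 2 * (sq_norm {..<s} x * outer_sq d k A B) + sq_norm {..<s} x
         + sq_norm ({..<k} \<times> {..<d}) A + sq_norm ({..<k} \<times> {..<d}) B + (s + 2 * (k * d)) * ln 9 + ln d"
    using ex_signs_below_potential[OF d, of s R \<theta>] by metis
  have "(\<Sum>j<k. \<Sum>b<d. (cmod (\<Sum>a<d. \<Sum>i<s. of_real (\<epsilon> (i, a, b)) * (cnj (u j a) * x i)))\<^sup>2) \<le> 46 * k * d + 24 * s"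
    if kd: "k \<le> d" and x1: "sq_norm {..<s} x = 1"
      and u: "\<And>j l. j < k \<Longrightarrow> l < k \<Longrightarrow> (\<Sum>a<d. u j a * cnj (u l a)) = (if j = l then 1 else 0)" for k x u
  proof (cases "k = 0")
    case False
    then have k: "1 \<le> k" by simp
    define w where "w = (\<lambda>j b. \<Sum>a<d. \<Sum>i<s. of_real (\<epsilon> (i, a, b)) * (cnj (u j a) * x i))"
    define T where "T = (\<Sum>j<k. \<Sum>b<d. (cmod (w j b))\<^sup>2)"
    let ?J = "{..<k} \<times> {..<d}"
    have T0: "0 \<le> T" unfolding T_def by (intro sum_nonneg) auto
    have "T \<le> 46 * k * d + 24 * s"
    proof (cases "T = 0")
      case False
      with T0 have T: "0 < T" by simp
      \<comment> \<open>Scaled to mean square \<open>3/2\<close> per coordinate, against a rounding error of mean square \<open>1/2\<close>;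
        \<open>\<theta>\<close> then balances the variance term against the entropy \<open>E\<close>.\<close>
      define x' where "x' = (\<lambda>i. of_real (sqrt (3 * s / 2)) * x i)"
      define A where "A = (\<lambda>(j, a). of_real (sqrt (3 * d / 2)) * cnj (u j a))"
      \<comment> \<open>The conjugate of the vectors captured by the frame, rescaled. With this
        choice \<open>sign_form\<close> becomes a multiple of \<open>T\<close>, so a bound on the
        form is a bound on \<open>T\<close>.\<close>
      define B where "B = (\<lambda>(j, b). of_real (sqrt (3 * (d * k) / 2 / T)) * cnj (w j b))"
      have nx: "sq_norm {..<s} x' = 3 * s / 2"
        unfolding sq_norm_def x'_def norm_mult power_mult_distrib sum_distrib_left[symmetric]
        using x1[unfolded sq_norm_def] by simp
      have "(\<Sum>a<d. (cmod (u j a))\<^sup>2) = 1" if "j < k" for j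
      proof -
        have "complex_of_real (\<Sum>a<d. (cmod (u j a))\<^sup>2) = 1"
          unfolding of_real_sum complex_norm_square using u[OF that that] by simp
        then show ?thesis using of_real_eq_1_iff by blast
      qed
      then have nA: "sq_norm ?J A = 3 * (d * k) / 2"
        unfolding sq_norm_times A_def split norm_mult power_mult_distrib sum_distrib_left[symmetric] by simp
      have nB: "sq_norm ?J B = 3 * (d * k) / 2"
        unfolding sq_norm_times B_def split norm_mult power_mult_distrib sum_distrib_left[symmetric]
        using T by (simp add: T_def[symmetric])
      have oA: "(\<Sum>a<d. A (j, a) * cnj (A (l, a))) = (if j = l then of_real (3 * d / 2) else 0)" if "j < k" "l < k" for j l
      proof -
        have "(\<Sum>a<d. A (j, a) * cnj (A (l, a))) = (\<Sum>a<d. of_real (sqrt (3 * d / 2) * sqrt (3 * d / 2)) * (u l a * cnj (u j a)))"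
          unfolding A_def of_real_mult by (intro sum.cong refl) simp
        also have "\<dots> = of_real (3 * d / 2) * (\<Sum>a<d. u l a * cnj (u j a))"
          unfolding sum_distrib_left by (subst real_sqrt_mult_self) simp
        also have "\<dots> = (if j = l then of_real (3 * d / 2) else 0)"
          unfolding u[OF that(2,1)] by simp
        finally show ?thesis .
      qed
      have nY: "outer_sq d k A B = 9 / 4 * (d * d * k)"
        using outer_sq_orthogonal[of k A d "3 * d / 2" B, OF oA] nB by simp
      have F: "sign_form s d k \<epsilon> x' A B = sqrt (27 / 8 * (s * d * d * k) * T)"
      proof -
        define c where "c = sqrt (3 * s / 2) * sqrt (3 * d / 2) * sqrt (3 * (d * k) / 2 / T)"
        have cT: "complex_of_real T = (\<Sum>j<k. \<Sum>b<d. cnj (w j b) * w j b)"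
          unfolding T_def of_real_sum complex_norm_square by (simp add: mult.commute)
  let ?G = "\<lambda>i a b j. of_real c * (cnj (w j b) * (of_real (\<epsilon> (i, a, b)) * (cnj (u j a) * x i)))"
        have "(\<Sum>i<s. \<Sum>a<d. \<Sum>b<d. of_real (\<epsilon> (i, a, b)) * (x' i * outer_sum k A B a b))
          = (\<Sum>i<s. \<Sum>a<d. \<Sum>b<d. \<Sum>j<k. ?G i a b j)"
          unfolding outer_sum_def x'_def A_def B_def c_def of_real_mult
          by (simp add: sum_distrib_left mult_ac)
        also have "\<dots> = (\<Sum>i<s. \<Sum>a<d. \<Sum>j<k. \<Sum>b<d. ?G i a b j)"
          by (intro sum.cong refl sum.swap)
        also have "\<dots> = (\<Sum>i<s. \<Sum>j<k. \<Sum>a<d. \<Sum>b<d. ?G i a b j)"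
          by (intro sum.cong refl sum.swap)
        also have "\<dots> = (\<Sum>j<k. \<Sum>i<s. \<Sum>a<d. \<Sum>b<d. ?G i a b j)"
          by (rule sum.swap)
        also have "\<dots> = (\<Sum>j<k. \<Sum>i<s. \<Sum>b<d. \<Sum>a<d. ?G i a b j)"
          by (intro sum.cong refl sum.swap)
        also have "\<dots> = (\<Sum>j<k. \<Sum>b<d. \<Sum>i<s. \<Sum>a<d. ?G i a b j)"
          by (intro sum.cong refl sum.swap)
        also have "\<dots> = (\<Sum>j<k. \<Sum>b<d. \<Sum>a<d. \<Sum>i<s. ?G i a b j)"
          by (intro sum.cong refl sum.swap)
        also have "\<dots> = (\<Sum>j<k. \<Sum>b<d. of_real c * (cnj (w j b) * w j b))"
          unfolding w_def by (simp only: sum_distrib_left)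
        also have "\<dots> = complex_of_real (c * T)"
          unfolding of_real_mult cT by (simp only: sum_distrib_left)
        finally have "sign_form s d k \<epsilon> x' A B = c * T"
          unfolding sign_form_def by (metis Re_complex_of_real)
        also have "\<dots> = sqrt (3 * s / 2) * sqrt (3 * d / 2) * sqrt (3 * (d * k) / 2 / T) * sqrt (T * T)"
          using T by (simp add: c_def)
        also have "\<dots> = sqrt (27 / 8 * (s * d * d * k) * T)"
          unfolding real_sqrt_mult[symmetric] using T by (intro arg_cong[where f = sqrt]) (simp add: field_simps)
        finally show ?thesis .
      qed
      have E0: "0 < E k" using s d k by (simp add: E_def add_nonneg_pos)
      have th2: "(\<theta> k)\<^sup>2 = E k / (4 * s * d * d * k)" and th0: "0 \<le> \<theta> k"
        unfolding \<theta>_def using E0 by simp_all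
      \<comment> \<open>Applied with \<open>- \<theta> k\<close>: what must not grow in rounding is
        the potential minus \<open>\<theta> k\<close> times the form, so that a bound at the lattice
        point returns to the original point.\<close>
      obtain y A' B' where y: "\<forall>i<s. rounds_to (y i) (x' i)"
        and A': "\<forall>i\<in>?J. rounds_to (A' i) (A i)"
        and B': "\<forall>i\<in>?J. rounds_to (B' i) (B i)"
        and le: "(\<theta> k)\<^sup>2 / 2 * (sq_norm {..<s} y * outer_sq d k A' B') + sq_norm {..<s} y + sq_norm ?J A' + sq_norm ?J B'
           + (- \<theta> k) * sign_form s d k \<epsilon> y A' B'
          \<le> (\<theta> k)\<^sup>2 / 2 * ((sq_norm {..<s} x' + s / 2) *
          (outer_sq d k A B + d / 2 * sq_norm ?J A + d / 2 * sq_norm ?J B + d * d * k / 4))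
        + sq_norm {..<s} x' + sq_norm ?J A + sq_norm ?J B + d * k + s / 2
        + (- \<theta> k) * sign_form s d k \<epsilon> x' A B"
        using round_triple[OF zero_le_power2[of "\<theta> k"], where \<theta> = "- \<theta> k" and s = s and d = d and k = k and \<epsilon> = \<epsilon> and x = x' and A = A and B = B]
        by auto
      let ?r = "2 * real s * real d"
      have r0: "0 \<le> ?r" and rR: "?r + 1 \<le> real R" by (auto simp: R_def)
      have sd1: "1 \<le> real s" "1 \<le> real d" "real k \<le> real d" using s d kd by auto
      have rx: "3 * s / 2 \<le> ?r\<^sup>2"
      proof -
        have "3 * s / 2 \<le> 4 * (real s * real s)" using sd1 mult_left_mono[of 1 "real s" "real s"] by simp
        also have "\<dots> \<le> 4 * (real s * real s) * (real d * real d)"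
          using sd1 by (simp add: mult_le_cancel_left1 mult_ge1_I)
        finally show ?thesis by (simp add: power2_eq_square mult_ac)
      qed
      have rA: "3 * (d * k) / 2 \<le> ?r\<^sup>2"
      proof -
        have "3 * (d * k) / 2 \<le> 4 * (real d * real d)" using sd1 mult_left_mono[of "real k" "real d" "real d"] mult_mono[of 1 "real d" 1 "real d"] by simp
        also have "\<dots> \<le> 4 * (real d * real d) * (real s * real s)"
          using sd1 by (simp add: mult_le_cancel_left1 mult_ge1_I)
        finally show ?thesis by (simp add: power2_eq_square mult_ac)
      qed
      have "\<forall>i<s. y i \<in> gauss_ints R"
      proof (intro allI impI)
        fix i assume i: "i < s"
        have "cmod (x' i) \<le> ?r"
          using rx nx i by (intro cmod_le_of_sq_norm[of "{..<s}"] r0) auto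
        then show "y i \<in> gauss_ints R" using y i rR by (intro gauss_intsI[of _ "x' i" ?r]) auto
      qed
      moreover have "\<forall>i\<in>?J. A' i \<in> gauss_ints R \<and> B' i \<in> gauss_ints R"
      proof (intro ballI conjI)
        fix i assume i: "i \<in> ?J"
        have "cmod (A i) \<le> ?r"
          using rA nA i by (intro cmod_le_of_sq_norm[of ?J] r0) auto
        then show "A' i \<in> gauss_ints R" using A' i rR by (intro gauss_intsI[of _ "A i" ?r]) blast+
        have "cmod (B i) \<le> ?r"
          using rA nB i by (intro cmod_le_of_sq_norm[of ?J] r0) auto
        then show "B' i \<in> gauss_ints R" using B' i rR by (intro gauss_intsI[of _ "B i" ?r]) blast+
      qed
      moreover have "k \<in> {1..d}" using k kd by simp
      ultimately have "\<theta> k * sign_form s d k \<epsilon> y A' B' \<le> (\<theta> k)\<^sup>2 / 2 * (sq_norm {..<s} y * outer_sq d k A' B') + sq_norm {..<s} y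
         + sq_norm ?J A' + sq_norm ?J B' + (s + 2 * (k * d)) * ln 9 + ln d"
        using pot by blast
      with le have "\<theta> k * sign_form s d k \<epsilon> x' A B \<le> (\<theta> k)\<^sup>2 / 2 * ((sq_norm {..<s} x' + s / 2) *
          (outer_sq d k A B + d / 2 * sq_norm ?J A + d / 2 * sq_norm ?J B + d * d * k / 4))
        + sq_norm {..<s} x' + sq_norm ?J A + sq_norm ?J B + d * k + s / 2 + (s + 2 * (k * d)) * ln 9 + ln d"
        by simp
      \<comment> \<open>The variance factors are (3/2 + 1/2) s and (9/4 + 3/4 + 3/4 + 1/4) d^2 k,
        with product 8 s d^2 k.\<close>
      also have "\<dots> = (\<theta> k)\<^sup>2 * (4 * s * d * d * k) + 2 * s + 4 * (d * k) + (s + 2 * (k * d)) * ln 9 + ln d"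
        unfolding nx nA nB nY by (simp add: field_simps)
      also have "(\<theta> k)\<^sup>2 * (4 * s * d * d * k) = E k"
        unfolding th2 using s d k by simp
      also have "E k + 2 * s + 4 * (d * k) + (s + 2 * (k * d)) * ln 9 + ln d \<le> 2 * E k"
      proof -
        have "(s + 2 * (k * d)) * ln 9 \<le> (s + 2 * (k * d)) * (9 / 4 :: real)"
          by (intro mult_left_mono ln_9_le) auto
        moreover have "ln (real d) \<le> real (d * k)"
        proof -
          have "ln (real d) \<le> real d - 1" using sd1 by (intro ln_le_minus_one) auto
          also have "\<dots> \<le> real d * 1" by simp
          also have "\<dots> \<le> real d * real k" using k by (intro mult_left_mono) auto
          finally show ?thesis by simp
        qed
        moreover have "real (d * k) = real (k * d)" by (simp add: mult.commute)
        ultimately show ?thesis unfolding E_def by (simp add: algebra_simps)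
      qed
      finally have "\<theta> k * sqrt (27 / 8 * (s * d * d * k) * T) \<le> 2 * E k" unfolding F by simp
      then have "(\<theta> k * sqrt (27 / 8 * (s * d * d * k) * T))\<^sup>2 \<le> (2 * E k)\<^sup>2"
        using th0 T by (intro power_mono mult_nonneg_nonneg real_sqrt_ge_zero) auto
      moreover have "(\<theta> k * sqrt (27 / 8 * (s * d * d * k) * T))\<^sup>2 = (\<theta> k)\<^sup>2 * (27 / 8 * (s * d * d * k) * T)"
        unfolding power_mult_distrib using T by (subst real_sqrt_pow2) simp_all
      moreover have "(2 * E k)\<^sup>2 = 4 * (E k * E k)" by (simp add: power2_eq_square)
      ultimately have "E k / (4 * s * d * d * k) * (27 / 8 * (s * d * d * k) * T) \<le> 4 * (E k * E k)"
        by (simp only: th2)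
      moreover have "E k / (4 * s * d * d * k) * (27 / 8 * (s * d * d * k) * T) = E k * (27 / 32 * T)"
        using s d k by (simp add: field_simps)
      ultimately have "E k * (27 / 32 * T) \<le> E k * (4 * E k)" by simp
      then have "27 / 32 * T \<le> 4 * E k" using E0 by (simp only: mult_le_cancel_left_pos)
      \<comment> \<open>Here 128/27 * 19/2 is about 45.04 and 128/27 * 5 about 23.7, the sources of
        46 and 24.\<close>
      then have "T \<le> 128 / 27 * (19 / 2 * (k * d) + 5 * real s)" unfolding E_def by linarith
      also have "\<dots> \<le> 46 * (real k * real d) + 24 * s" by simp
      finally show ?thesis by simp
    qed simp
    then show ?thesis unfolding T_def w_def .
  qed simp
  then show ?thesis using signs unfolding flat_signs_def by (intro exI[of _ \<epsilon>]) blast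
qed

section \<open>Spectral theorem and functional calculus\<close>

lemma index_mult_mat_lessThan:
  assumes "A \<in> carrier_mat n m" "B \<in> carrier_mat m k" "i < n" "j < k"
  shows "(A * B) $$ (i, j) = (\<Sum>t<m. A $$ (i, t) * B $$ (t, j))"
  using assms by (auto simp: scalar_prod_def lessThan_atLeast0 intro!: sum.cong)

lemma mat_adjoint_carrier [intro]: "A \<in> carrier_mat n m \<Longrightarrow> mat_adjoint A \<in> carrier_mat m n"
  by (auto simp: mat_adjoint_def mat_of_rows_def)

lemma index_mat_adjoint [simp]:
  fixes A :: "complex mat"
  assumes "i < dim_col A" "j < dim_row A"
  shows "mat_adjoint A $$ (i, j) = cnj (A $$ (j, i))"
  using assms by (simp add: mat_adjoint_def mat_of_rows_def)

text \<open>Exactly \<open>n\<close> vectors in dimension \<open>n\<close>, so this is a basis.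
  Plain functions make exchanging finite sums easier than matrix products do.\<close>

definition orthonormal :: "nat \<Rightarrow> (nat \<Rightarrow> nat \<Rightarrow> complex) \<Rightarrow> bool" where
  "orthonormal n u \<longleftrightarrow> (\<forall>i<n. \<forall>j<n. (\<Sum>a<n. u i a * cnj (u j a)) = (if i = j then 1 else 0))"

definition unitary_of :: "nat \<Rightarrow> (nat \<Rightarrow> nat \<Rightarrow> complex) \<Rightarrow> complex mat" where
  "unitary_of n u = mat n n (\<lambda>(a, i). u i a)"

lemma unitary_of_carrier [simp]: "unitary_of n u \<in> carrier_mat n n"
  by (simp add: unitary_of_def)

lemma unitary_of_dim [simp]: "dim_row (unitary_of n u) = n" "dim_col (unitary_of n u) = n"
  by (simp_all add: unitary_of_def)

lemma adjoint_mult_unitary_of: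
  assumes "orthonormal n u"
  shows "mat_adjoint (unitary_of n u) * unitary_of n u = 1\<^sub>m n"
proof (rule eq_matI)
  fix i j assume ij: "i < dim_row (1\<^sub>m n :: complex mat)" "j < dim_col (1\<^sub>m n :: complex mat)"
  have "(mat_adjoint (unitary_of n u) * unitary_of n u) $$ (i, j) = (\<Sum>t<n. cnj (u i t) * u j t)"
    using ij by (subst index_mult_mat_lessThan[of _ n n]) (auto simp: unitary_of_def intro!: sum.cong)
  also have "\<dots> = (\<Sum>t<n. u j t * cnj (u i t))" by (simp add: mult.commute)
  finally show "(mat_adjoint (unitary_of n u) * unitary_of n u) $$ (i, j) = 1\<^sub>m n $$ (i, j)"
    using assms ij by (auto simp: orthonormal_def)
qed (use mat_adjoint_carrier[OF unitary_of_carrier[of n u]] in auto)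

lemma unitary_mat_unitary_of:
  assumes "orthonormal n u"
  shows "unitary_mat n (unitary_of n u)"
  unfolding unitary_mat_def
  using mat_mult_left_right_inverse[OF mat_adjoint_carrier[OF unitary_of_carrier] unitary_of_carrier
      adjoint_mult_unitary_of[OF assms]] adjoint_mult_unitary_of[OF assms] by simp

text \<open>A left inverse of a square matrix is also a right inverse, so orthonormality of the
  columns gives that of the rows.\<close>

lemma orthonormal_complete:
  assumes "orthonormal n u" "a < n" "b < n"
  shows "(\<Sum>i<n. u i a * cnj (u i b)) = (if a = b then 1 else 0)"
proof -
  have "(unitary_of n u * mat_adjoint (unitary_of n u)) $$ (a, b) = (\<Sum>i<n. u i a * cnj (u i b))"
    using assms(2,3) by (subst index_mult_mat_lessThan[of _ n n]) (auto simp: unitary_of_def intro!: sum.cong)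
  then show ?thesis
    using unitary_mat_unitary_of[OF assms(1)] assms(2,3) by (auto simp: unitary_mat_def)
qed

lemma orthonormal_columns_unitary:
  assumes "unitary_mat n U"
  shows "orthonormal n (\<lambda>i a. U $$ (a, i))"
  unfolding orthonormal_def
proof (intro allI impI)
  fix i j assume ij: "i < n" "j < n"
  have U: "U \<in> carrier_mat n n" "mat_adjoint U * U = 1\<^sub>m n" using assms by (auto simp: unitary_mat_def)
  have "(mat_adjoint U * U) $$ (j, i) = (\<Sum>a<n. cnj (U $$ (a, j)) * U $$ (a, i))"
    using U ij by (subst index_mult_mat_lessThan[of _ n n]) (auto intro!: sum.cong)
  then show "(\<Sum>a<n. U $$ (a, i) * cnj (U $$ (a, j))) = (if i = j then 1 else 0)"
    using U ij by (auto simp: mult.commute)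
qed

lemma sum_delta_mult:
  fixes g :: "nat \<Rightarrow> complex"
  assumes "b < n"
  shows "(\<Sum>c<n. g c * (if c = b then 1 else 0)) = g b" "(\<Sum>c<n. g c * (if b = c then 1 else 0)) = g b"
    "(\<Sum>c<n. (if c = b then 1 else 0) * g c) = g b"
proof -
  have d: "(\<Sum>c<n. if c = b then g c else 0) = g b" using assms by simp
  show "(\<Sum>c<n. g c * (if c = b then 1 else 0)) = g b" "(\<Sum>c<n. g c * (if b = c then 1 else 0)) = g b"
    "(\<Sum>c<n. (if c = b then 1 else 0) * g c) = g b"
    by (subst d[symmetric], intro sum.cong; auto)+
qed

lemma orthonormal_expand:
  assumes "orthonormal n u" "a < n"
  shows "(\<Sum>i<n. u i a * (\<Sum>b<n. cnj (u i b) * v b)) = v a"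
proof -
  have "(\<Sum>i<n. u i a * (\<Sum>b<n. cnj (u i b) * v b)) = (\<Sum>i<n. \<Sum>b<n. v b * (u i a * cnj (u i b)))"
    by (simp add: sum_distrib_left mult_ac)
  also have "\<dots> = (\<Sum>b<n. v b * (\<Sum>i<n. u i a * cnj (u i b)))"
    by (subst sum.swap) (simp add: sum_distrib_left)
  also have "\<dots> = (\<Sum>b<n. v b * (if a = b then 1 else 0))"
    using orthonormal_complete[OF assms] by simp
  also have "\<dots> = v a" by (rule sum_delta_mult(2)[OF assms(2)])
  finally show ?thesis .
qed

section \<open>Spectral theorem by deflation\<close>

text \<open>Gram-Schmidt applied to a completion of \<open>v\<close> to a basis keeps its first
  vector; normalisation then only rescales it.\<close>

lemma ex_orthonormal_with_first:
  fixes v :: "complex vec"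
  assumes v: "v \<in> carrier_vec n" and v0: "v \<noteq> 0\<^sub>v n"
  shows "\<exists>w c. orthonormal n w \<and> c \<noteq> 0 \<and> (\<forall>a<n. w 0 a = c * v $ a)"
proof -
  interpret cof_vec_space n "TYPE(complex)" .
  have n: "n \<noteq> 0" using v v0 by (metis carrier_vecD eq_vecI index_zero_vec(2) less_nat_zero_code)
  define b where "b = basis_completion v"
  define ws where "ws = gram_schmidt n b"
  from basis_completion[OF v v0, folded b_def]
  have dist_b: "distinct b" and indep: "\<not> lin_dep (set b)" and b: "set b \<subseteq> carrier_vec n" and hdb: "hd b = v"
    and len_b: "length b = n" by auto
  from hdb len_b n obtain vs where bv: "b = v # vs" by (cases b) auto
  from gram_schmidt_result[OF b dist_b indep refl, folded ws_def]
  have ws: "set ws \<subseteq> carrier_vec n" "corthogonal ws" "length ws = n" by (auto simp: len_b)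
  from gram_schmidt_hd[OF v, of vs, folded bv] have hdws: "hd ws = v" unfolding ws_def .
  have wsi: "ws ! i \<in> carrier_vec n" if "i < n" for i using ws that by (simp add: subset_iff)
  have dot: "x \<bullet>c y = (\<Sum>a<n. x $ a * cnj (y $ a))" if "x \<in> carrier_vec n" "y \<in> carrier_vec n" for x y :: "complex vec"
    using that by (auto simp: scalar_prod_def lessThan_atLeast0 intro!: sum.cong)
  define r where "r = (\<lambda>i. \<Sum>a<n. (cmod (ws ! i $ a))\<^sup>2)"
  have dot_r: "ws ! i \<bullet>c ws ! i = of_real (r i)" if "i < n" for i
    unfolding dot[OF wsi[OF that] wsi[OF that]] r_def of_real_sum complex_norm_square ..
  have rpos: "0 < r i" if "i < n" for i
  proof -
    have "ws ! i \<bullet>c ws ! i \<noteq> 0" using corthogonalD[OF ws(2)] ws(3) that by auto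
    then have "r i \<noteq> 0" using dot_r[OF that] by simp
    moreover have "0 \<le> r i" unfolding r_def by (intro sum_nonneg) auto
    ultimately show ?thesis by simp
  qed
  define w where "w = (\<lambda>i a. of_real (1 / sqrt (r i)) * ws ! i $ a)"
  have "orthonormal n w"
    unfolding orthonormal_def
  proof (intro allI impI)
    fix i j assume ij: "i < n" "j < n"
    have "(\<Sum>a<n. w i a * cnj (w j a)) = of_real (1 / sqrt (r i)) * of_real (1 / sqrt (r j)) * (\<Sum>a<n. ws ! i $ a * cnj (ws ! j $ a))"
      by (simp add: w_def sum_distrib_left mult_ac)
    also have "\<dots> = of_real (1 / sqrt (r i)) * of_real (1 / sqrt (r j)) * (ws ! i \<bullet>c ws ! j)"
      using dot wsi ij by simp
    also have "\<dots> = (if i = j then 1 else 0)"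
    proof (cases "i = j")
      case True
      have "of_real (1 / sqrt (r i)) * of_real (1 / sqrt (r i)) * (of_real (r i) :: complex) = of_real (1 / sqrt (r i) * (1 / sqrt (r i)) * r i)"
        by (simp only: of_real_mult)
      also have "1 / sqrt (r i) * (1 / sqrt (r i)) * r i = 1" using rpos[OF ij(1)] by simp
      finally show ?thesis using True dot_r[OF ij(1)] by simp
    next
      case False
      then have "ws ! i \<bullet>c ws ! j = 0" using corthogonalD[OF ws(2)] ws(3) ij by auto
      then show ?thesis using False by simp
    qed
    finally show "(\<Sum>a<n. w i a * cnj (w j a)) = (if i = j then 1 else 0)" .
  qed
  moreover have "ws ! 0 = v" using hdws ws(3) n by (cases ws) auto
  ultimately show ?thesis
    using rpos[of 0] n by (intro exI[of _ w] exI[of _ "of_real (1 / sqrt (r 0))"]) (auto simp: w_def)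
qed

lemma ex_eigenvector:
  fixes H :: "nat \<Rightarrow> nat \<Rightarrow> complex"
  assumes "0 < n"
  shows "\<exists>e v. v \<in> carrier_vec n \<and> v \<noteq> 0\<^sub>v n \<and> (\<forall>a<n. (\<Sum>b<n. H a b * v $ b) = e * v $ a)"
proof -
  define A where "A = mat n n (\<lambda>(a, b). H a b)"
  have A: "A \<in> carrier_mat n n" by (simp add: A_def)
  have "degree (char_poly A) = n" using degree_monic_char_poly[OF A] by simp
  then have "\<exists>e. poly (char_poly A) e = 0"
    using assms by (intro fundamental_theorem_of_algebra_alt) (metis constant_degree degree_pCons_0 less_irrefl)
  then obtain e where "eigenvalue A e" using eigenvalue_root_char_poly[OF A] by auto
  then obtain v where "eigenvector A v e" unfolding eigenvalue_def by auto
  then have v: "v \<in> carrier_vec n" "v \<noteq> 0\<^sub>v n" "A *\<^sub>v v = e \<cdot>\<^sub>v v"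
    using A by (auto simp: eigenvector_def)
  have "(\<Sum>b<n. H a b * v $ b) = e * v $ a" if "a < n" for a
  proof -
    have "(A *\<^sub>v v) $ a = (\<Sum>b<n. H a b * v $ b)"
      using that v(1) by (auto simp: scalar_prod_def lessThan_atLeast0 A_def intro!: sum.cong)
    moreover have "(A *\<^sub>v v) $ a = e * v $ a" unfolding v(3) using v(1) that by simp
    ultimately show ?thesis by simp
  qed
  then show ?thesis using v by blast
qed

text \<open>In an orthonormal basis starting with an eigenvector, the matrix \<open>K\<close> has
  zeros below its first diagonal entry, and by Hermitian symmetry also to the right of it. The
  induction hypothesis diagonalises the remaining block, and its eigenvectors are carried back
  through the basis \<open>w\<close>.\<close>

lemma spectral_theorem_eigen:
  fixes H :: "nat \<Rightarrow> nat \<Rightarrow> complex"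
  assumes "\<And>a b. a < n \<Longrightarrow> b < n \<Longrightarrow> H a b = cnj (H b a)"
  shows "\<exists>u l. orthonormal n u \<and> (\<forall>i<n. \<forall>a<n. (\<Sum>b<n. H a b * u i b) = of_real (l i) * u i a)"
  using assms
proof (induction n arbitrary: H)
  case 0
  then show ?case by (auto simp: orthonormal_def)
next
  case (Suc n)
  obtain e v where v: "v \<in> carrier_vec (Suc n)" "v \<noteq> 0\<^sub>v (Suc n)"
      "\<And>a. a < Suc n \<Longrightarrow> (\<Sum>b<Suc n. H a b * v $ b) = e * v $ a"
    using ex_eigenvector[of "Suc n" H] by auto
  obtain w c where w: "orthonormal (Suc n) w" "c \<noteq> 0" "\<And>a. a < Suc n \<Longrightarrow> w 0 a = c * v $ a"
    using ex_orthonormal_with_first[OF v(1,2)] by blast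
  have wo: "(\<Sum>a<Suc n. w i a * cnj (w j a)) = (if i = j then 1 else 0)" if "i < Suc n" "j < Suc n" for i j
    using w(1) that unfolding orthonormal_def by blast
  have w0: "(\<Sum>b<Suc n. H a b * w 0 b) = e * w 0 a" if "a < Suc n" for a
  proof -
    have "(\<Sum>b<Suc n. H a b * w 0 b) = (\<Sum>b<Suc n. c * (H a b * v $ b))"
      using w(3) by (intro sum.cong) auto
    also have "\<dots> = c * (e * v $ a)" unfolding sum_distrib_left[symmetric] v(3)[OF that] ..
    finally show ?thesis using w(3)[OF that] by simp
  qed
  define K where "K = (\<lambda>j k. \<Sum>a<Suc n. cnj (w j a) * (\<Sum>b<Suc n. H a b * w k b))"
  have Kc: "K j k = cnj (K k j)" for j k
  proof -
    have "K j k = (\<Sum>a<Suc n. \<Sum>b<Suc n. cnj (w j a) * H a b * w k b)"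
      unfolding K_def sum_distrib_left by (simp only: mult.assoc)
    also have "\<dots> = (\<Sum>a<Suc n. \<Sum>b<Suc n. cnj (cnj (w k b) * H b a * w j a))"
    proof (intro sum.cong refl)
      fix a b assume "a \<in> {..<Suc n}" "b \<in> {..<Suc n}"
      then have h: "cnj (H b a) = H a b" by (intro Suc.prems[symmetric]) auto
      show "cnj (w j a) * H a b * w k b = cnj (cnj (w k b) * H b a * w j a)"
        unfolding complex_cnj_mult complex_cnj_cnj h by (simp only: mult_ac)
    qed
    also have "\<dots> = (\<Sum>b<Suc n. \<Sum>a<Suc n. cnj (cnj (w k b) * H b a * w j a))" by (rule sum.swap)
    also have "\<dots> = cnj (K k j)"
      unfolding K_def sum_distrib_left cnj_sum by (simp only: mult.assoc)
    finally show ?thesis .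
  qed
  have K0: "K j 0 = (if j = 0 then e else 0)" if "j < Suc n" for j
  proof -
    have "K j 0 = (\<Sum>a<Suc n. cnj (w j a) * (e * w 0 a))"
      unfolding K_def by (intro sum.cong refl arg_cong2[where f = "(*)"] w0) auto
    also have "\<dots> = e * (\<Sum>a<Suc n. w 0 a * cnj (w j a))" unfolding sum_distrib_left by (intro sum.cong) auto
    also have "\<dots> = (if j = 0 then e else 0)" using wo[of 0 j] that by auto
    finally show ?thesis .
  qed
  have Hw: "(\<Sum>b<Suc n. H a b * w k b) = w 0 a * K 0 k + (\<Sum>j<n. w (Suc j) a * K (Suc j) k)" if "a < Suc n" for a k
  proof -
    have "(\<Sum>b<Suc n. H a b * w k b) = (\<Sum>j<Suc n. w j a * K j k)"
      unfolding K_def by (rule orthonormal_expand[OF w(1) that, symmetric])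
    also have "\<dots> = w 0 a * K 0 k + (\<Sum>j<n. w (Suc j) a * K (Suc j) k)" by (rule sum.lessThan_Suc_shift)
    finally show ?thesis .
  qed
  obtain y l where y: "orthonormal n y"
    "\<And>i j. i < n \<Longrightarrow> j < n \<Longrightarrow> (\<Sum>k<n. K (Suc j) (Suc k) * y i k) = of_real (l i) * y i j"
    using Suc.IH[of "\<lambda>j k. K (Suc j) (Suc k)"] Kc by blast
  have yo: "(\<Sum>a<n. y i a * cnj (y j a)) = (if i = j then 1 else 0)" if "i < n" "j < n" for i j
    using y(1) that unfolding orthonormal_def by blast
  define z where "z = (\<lambda>i a. \<Sum>k<n. y i k * w (Suc k) a)"
  define u where "u = (\<lambda>i. case i of 0 \<Rightarrow> w 0 | Suc i \<Rightarrow> z i)"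
  define m where "m = (\<lambda>i. case i of 0 \<Rightarrow> Re e | Suc i \<Rightarrow> l i)"
  have "cnj e = e" using Kc[of 0 0] K0[of 0] by (metis zero_less_Suc)
  then have e: "e = of_real (Re e)" by (metis Reals_cnj_iff of_real_Re)
  have zw: "(\<Sum>a<Suc n. z i a * cnj (w j a)) = (if j = 0 then 0 else y i (j - 1))" if "i < n" "j < Suc n" for i j
  proof -
    have "(\<Sum>a<Suc n. z i a * cnj (w j a)) = (\<Sum>a<Suc n. \<Sum>k<n. y i k * (w (Suc k) a * cnj (w j a)))"
      unfolding z_def sum_distrib_right by (simp only: mult.assoc)
    also have "\<dots> = (\<Sum>k<n. y i k * (\<Sum>a<Suc n. w (Suc k) a * cnj (w j a)))"
      unfolding sum_distrib_left by (rule sum.swap)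
    also have "\<dots> = (\<Sum>k<n. y i k * (if Suc k = j then 1 else 0))"
      using that by (intro sum.cong refl) (simp add: wo del: sum.lessThan_Suc)
    also have "\<dots> = (if j = 0 then 0 else y i (j - 1))"
    proof (cases j)
      case (Suc j')
      then show ?thesis using that sum_delta_mult(1)[of j' n "y i"] by simp
    qed simp
    finally show ?thesis .
  qed
  have zz: "(\<Sum>a<Suc n. z i a * cnj (z j a)) = (if i = j then 1 else 0)" if "i < n" "j < n" for i j
  proof -
    have zc: "cnj (z j a) = (\<Sum>k<n. cnj (y j k) * cnj (w (Suc k) a))" for a
      unfolding z_def by simp
    have "(\<Sum>a<Suc n. z i a * cnj (z j a)) = (\<Sum>a<Suc n. \<Sum>k<n. cnj (y j k) * (z i a * cnj (w (Suc k) a)))"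
      unfolding zc sum_distrib_left by (intro sum.cong refl) (simp add: mult_ac)
    also have "\<dots> = (\<Sum>k<n. cnj (y j k) * (\<Sum>a<Suc n. z i a * cnj (w (Suc k) a)))"
      unfolding sum_distrib_left by (rule sum.swap)
    also have "\<dots> = (\<Sum>k<n. y i k * cnj (y j k))"
      using that by (intro sum.cong refl) (simp add: zw del: sum.lessThan_Suc)
    finally show ?thesis using yo[OF that] by simp
  qed
  have "orthonormal (Suc n) u"
    unfolding orthonormal_def
  proof (intro allI impI)
    fix i j assume ij: "i < Suc n" "j < Suc n"
    have cw: "(\<Sum>a<Suc n. w 0 a * cnj (z k a)) = 0" if "k < n" for k
    proof -
      have "(\<Sum>a<Suc n. w 0 a * cnj (z k a)) = cnj (\<Sum>a<Suc n. z k a * cnj (w 0 a))"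
        unfolding cnj_sum by (intro sum.cong refl) (simp add: mult.commute)
      then show ?thesis using zw[OF that, of 0] by (simp del: sum.lessThan_Suc)
    qed
    show "(\<Sum>a<Suc n. u i a * cnj (u j a)) = (if i = j then 1 else 0)"
    proof (cases i; cases j)
      assume "i = 0" "j = 0" then show ?thesis using wo[of 0 0] by (simp add: u_def del: sum.lessThan_Suc)
    next
      fix k assume "i = 0" "j = Suc k" then show ?thesis using cw[of k] ij by (simp add: u_def del: sum.lessThan_Suc)
    next
      fix k assume "i = Suc k" "j = 0" then show ?thesis using zw[of k 0] ij by (simp add: u_def del: sum.lessThan_Suc)
    next
      fix k k' assume "i = Suc k" "j = Suc k'" then show ?thesis using zz[of k k'] ij by (simp add: u_def del: sum.lessThan_Suc)
    qed
  qed
  moreover have "(\<Sum>b<Suc n. H a b * u i b) = of_real (m i) * u i a" if "i < Suc n" "a < Suc n" for i a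
  proof (cases i)
    case 0
    then show ?thesis using w0[OF that(2)] e by (simp add: u_def m_def del: sum.lessThan_Suc)
  next
    case (Suc i')
    have i': "i' < n" and a: "a < Suc n" using that Suc by simp_all
    have "(\<Sum>b<Suc n. H a b * z i' b) = (\<Sum>b<Suc n. \<Sum>k<n. y i' k * (H a b * w (Suc k) b))"
      unfolding z_def sum_distrib_left by (intro sum.cong refl) (simp add: mult_ac)
    also have "\<dots> = (\<Sum>k<n. y i' k * (\<Sum>b<Suc n. H a b * w (Suc k) b))"
      unfolding sum_distrib_left by (rule sum.swap)
    also have "\<dots> = (\<Sum>k<n. y i' k * (\<Sum>j<n. w (Suc j) a * K (Suc j) (Suc k)))"
    proof -
      have "(\<Sum>b<Suc n. H a b * w (Suc k) b) = (\<Sum>j<n. w (Suc j) a * K (Suc j) (Suc k))" if "k < n" for k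
      proof -
        have "K 0 (Suc k) = 0" using Kc[of 0 "Suc k"] K0[of "Suc k"] that by simp
        then show ?thesis using Hw[OF a, of "Suc k"] by (simp del: sum.lessThan_Suc)
      qed
      then show ?thesis by (intro sum.cong refl) (simp del: sum.lessThan_Suc)
    qed
    also have "\<dots> = (\<Sum>k<n. \<Sum>j<n. w (Suc j) a * (K (Suc j) (Suc k) * y i' k))"
      unfolding sum_distrib_left by (intro sum.cong refl) (simp add: mult_ac)
    also have "\<dots> = (\<Sum>j<n. w (Suc j) a * (\<Sum>k<n. K (Suc j) (Suc k) * y i' k))"
      unfolding sum_distrib_left by (rule sum.swap)
    also have "\<dots> = (\<Sum>j<n. w (Suc j) a * (of_real (l i') * y i' j))"
      using y(2)[OF i'] by (intro sum.cong refl) simp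
    also have "\<dots> = of_real (l i') * z i' a"
      unfolding z_def sum_distrib_left by (intro sum.cong refl) (simp add: mult_ac)
    finally show ?thesis using Suc by (simp add: u_def m_def del: sum.lessThan_Suc)
  qed
  ultimately show ?case by blast
qed

section \<open>Eigendecompositions and the functional calculus\<close>

text \<open>Sum of rank-one projections written entrywise. The unitary form that
  \<open>herm_fun\<close> asks for is linked to it only by \<open>eig_decI_unitary\<close> and
  \<open>eig_dec_unitary_of\<close>.\<close>

definition eig_dec :: "nat \<Rightarrow> complex mat \<Rightarrow> (nat \<Rightarrow> nat \<Rightarrow> complex) \<Rightarrow> (nat \<Rightarrow> real) \<Rightarrow> bool" where
  "eig_dec n A u l \<longleftrightarrow> A \<in> carrier_mat n n \<and> orthonormal n u \<and>
     (\<forall>a<n. \<forall>b<n. A $$ (a, b) = (\<Sum>i<n. of_real (l i) * (u i a * cnj (u i b))))"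

lemma eig_decD:
  assumes "eig_dec n A u l"
  shows "A \<in> carrier_mat n n" "orthonormal n u"
    "a < n \<Longrightarrow> b < n \<Longrightarrow> A $$ (a, b) = (\<Sum>i<n. of_real (l i) * (u i a * cnj (u i b)))"
  using assms by (auto simp: eig_dec_def)

lemma orthonormalD:
  "orthonormal n u \<Longrightarrow> i < n \<Longrightarrow> j < n \<Longrightarrow> (\<Sum>a<n. u i a * cnj (u j a)) = (if i = j then 1 else 0)"
  by (auto simp: orthonormal_def)

lemma ex_eig_dec:
  assumes A: "A \<in> carrier_mat n n" and herm: "\<And>a b. a < n \<Longrightarrow> b < n \<Longrightarrow> A $$ (a, b) = cnj (A $$ (b, a))"
  shows "\<exists>u l. eig_dec n A u l"
proof -
  obtain u l where u: "orthonormal n u" and eig: "\<And>i a. i < n \<Longrightarrow> a < n \<Longrightarrow> (\<Sum>b<n. A $$ (a, b) * u i b) = of_real (l i) * u i a"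
    using spectral_theorem_eigen[of n "\<lambda>a b. A $$ (a, b)"] herm by blast
  have "A $$ (a, b) = (\<Sum>i<n. of_real (l i) * (u i a * cnj (u i b)))" if "a < n" "b < n" for a b
  proof -
    have "A $$ (a, b) = (\<Sum>c<n. A $$ (a, c) * (if c = b then 1 else 0))"
      using sum_delta_mult(1)[OF that(2), of "\<lambda>c. A $$ (a, c)"] by simp
    also have "\<dots> = (\<Sum>c<n. \<Sum>i<n. (A $$ (a, c) * u i c) * cnj (u i b))"
    proof (rule sum.cong[OF refl])
      fix c assume "c \<in> {..<n}"
      then have "(if c = b then 1 else 0) = (\<Sum>i<n. u i c * cnj (u i b))"
        using orthonormal_complete[OF u, of c b] that by simp
      then show "A $$ (a, c) * (if c = b then 1 else 0) = (\<Sum>i<n. (A $$ (a, c) * u i c) * cnj (u i b))"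
        by (simp only: sum_distrib_left mult.assoc)
    qed
    also have "\<dots> = (\<Sum>i<n. (\<Sum>c<n. A $$ (a, c) * u i c) * cnj (u i b))"
      unfolding sum_distrib_right by (rule sum.swap)
    also have "\<dots> = (\<Sum>i<n. of_real (l i) * (u i a * cnj (u i b)))"
      using that(1) by (intro sum.cong refl) (simp add: eig)
    finally show ?thesis .
  qed
  then show ?thesis using A u unfolding eig_dec_def by blast
qed

lemma eig_dec_right:
  assumes e: "eig_dec n A u l" and "i < n" "a < n"
  shows "(\<Sum>b<n. A $$ (a, b) * u i b) = of_real (l i) * u i a"
proof -
  have "(\<Sum>b<n. A $$ (a, b) * u i b) = (\<Sum>b<n. \<Sum>j<n. of_real (l j) * u j a * (u i b * cnj (u j b)))"
    using eig_decD(3)[OF e assms(3)] by (intro sum.cong refl) (simp add: sum_distrib_left sum_distrib_right mult_ac)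
  also have "\<dots> = (\<Sum>j<n. of_real (l j) * u j a * (\<Sum>b<n. u i b * cnj (u j b)))"
    unfolding sum_distrib_left by (rule sum.swap)
  also have "\<dots> = (\<Sum>j<n. of_real (l j) * u j a * (if i = j then 1 else 0))"
    using orthonormalD[OF eig_decD(2)[OF e] assms(2)] by (intro sum.cong refl) simp
  also have "\<dots> = of_real (l i) * u i a" by (rule sum_delta_mult(2)[OF assms(2)])
  finally show ?thesis .
qed

lemma eig_dec_hermitian:
  assumes e: "eig_dec n A u l" and "a < n" "b < n"
  shows "cnj (A $$ (a, b)) = A $$ (b, a)"
  unfolding eig_decD(3)[OF e assms(2,3)] eig_decD(3)[OF e assms(3,2)] by (simp add: mult_ac)

lemma eig_dec_left:
  assumes e: "eig_dec n A u l" and "i < n" "b < n"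
  shows "(\<Sum>a<n. cnj (u i a) * A $$ (a, b)) = of_real (l i) * cnj (u i b)"
proof -
  have "(\<Sum>a<n. cnj (u i a) * A $$ (a, b)) = cnj (\<Sum>a<n. A $$ (b, a) * u i a)"
    unfolding cnj_sum using assms eig_dec_hermitian[OF e] by (intro sum.cong refl) (simp add: mult.commute)
  then show ?thesis unfolding eig_dec_right[OF assms] by simp
qed

text \<open>The overlap \<open>T j i\<close> of two eigenvectors satisfies l_i T = m_j T, computed
  by letting \<open>A\<close> act to either side. So either the overlap is 0 or the eigenvalues
  agree, and in both cases f(l_i) T = f(m_j) T.\<close>

lemma eig_dec_fun_unique:
  assumes e: "eig_dec n A u l" and e': "eig_dec n A v m" and ab: "a < n" "b < n"
  shows "(\<Sum>i<n. of_real (f (l i)) * (u i a * cnj (u i b))) = (\<Sum>j<n. of_real (f (m j)) * (v j a * cnj (v j b)))"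
proof -
  define T where "T = (\<lambda>j i. \<Sum>c<n. cnj (v j c) * u i c)"
  have eq: "of_real (l i) * T j i = of_real (m j) * T j i" if "i < n" "j < n" for i j
  proof -
    have "of_real (l i) * T j i = (\<Sum>c<n. cnj (v j c) * (\<Sum>d<n. A $$ (c, d) * u i d))"
      unfolding T_def sum_distrib_left[of "of_real (l i)"]
    proof (intro sum.cong refl)
      fix c assume "c \<in> {..<n}"
      then show "of_real (l i) * (cnj (v j c) * u i c) = cnj (v j c) * (\<Sum>d<n. A $$ (c, d) * u i d)"
        using eig_dec_right[OF e that(1), of c] by simp
    qed
    also have "\<dots> = (\<Sum>c<n. \<Sum>d<n. cnj (v j c) * A $$ (c, d) * u i d)"
      by (simp only: sum_distrib_left mult.assoc)
    also have "\<dots> = (\<Sum>d<n. (\<Sum>c<n. cnj (v j c) * A $$ (c, d)) * u i d)"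
      unfolding sum_distrib_right by (rule sum.swap)
    also have "\<dots> = of_real (m j) * T j i"
      unfolding T_def sum_distrib_left using eig_dec_left[OF e' that(2)]
      by (intro sum.cong refl) simp
    finally show ?thesis .
  qed
  have fT: "of_real (f (l i)) * T j i = of_real (f (m j)) * T j i" if "i < n" "j < n" for i j
    using eq[OF that] by (cases "T j i = 0") auto
  have uT: "u i a = (\<Sum>j<n. v j a * T j i)" for i
    unfolding T_def using orthonormal_expand[OF eig_decD(2)[OF e'] ab(1)] by simp
  have vT: "(\<Sum>i<n. T j i * cnj (u i b)) = cnj (v j b)" for j
  proof -
    have "cnj (v j b) = cnj (\<Sum>i<n. u i b * (\<Sum>c<n. cnj (u i c) * v j c))"
      using orthonormal_expand[OF eig_decD(2)[OF e] ab(2)] by simp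
    also have "\<dots> = (\<Sum>i<n. T j i * cnj (u i b))"
      unfolding T_def by (simp add: mult_ac)
    finally show ?thesis by simp
  qed
  have "(\<Sum>i<n. of_real (f (l i)) * (u i a * cnj (u i b))) = (\<Sum>i<n. \<Sum>j<n. v j a * (of_real (f (l i)) * T j i) * cnj (u i b))"
    unfolding uT by (simp add: sum_distrib_left sum_distrib_right mult_ac)
  also have "\<dots> = (\<Sum>i<n. \<Sum>j<n. of_real (f (m j)) * v j a * (T j i * cnj (u i b)))"
  proof (intro sum.cong refl)
    fix i j assume "i \<in> {..<n}" "j \<in> {..<n}"
    then have h: "of_real (f (l i)) * T j i = of_real (f (m j)) * T j i" using fT by simp
    show "v j a * (of_real (f (l i)) * T j i) * cnj (u i b) = of_real (f (m j)) * v j a * (T j i * cnj (u i b))"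
      unfolding h by (simp only: mult_ac)
  qed
  also have "\<dots> = (\<Sum>j<n. of_real (f (m j)) * v j a * (\<Sum>i<n. T j i * cnj (u i b)))"
    unfolding sum_distrib_left by (rule sum.swap)
  finally show ?thesis unfolding vT by (simp only: mult.assoc)
qed

lemma index_unitary_diag_adjoint:
  assumes U: "U \<in> carrier_mat n n" and ab: "a < n" "b < n"
  shows "(U * mat_diag n (\<lambda>i. complex_of_real (l i)) * mat_adjoint U) $$ (a, b) =
    (\<Sum>i<n. of_real (l i) * (U $$ (a, i) * cnj (U $$ (b, i))))"
proof -
  have c: "U * mat_diag n (\<lambda>i. complex_of_real (l i)) \<in> carrier_mat n n" using U by auto
  have "(U * mat_diag n (\<lambda>i. complex_of_real (l i)) * mat_adjoint U) $$ (a, b) =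
     (\<Sum>i<n. (U * mat_diag n (\<lambda>i. complex_of_real (l i))) $$ (a, i) * mat_adjoint U $$ (i, b))"
    using index_mult_mat_lessThan[OF c mat_adjoint_carrier[OF U] ab] .
  also have "\<dots> = (\<Sum>i<n. of_real (l i) * (U $$ (a, i) * cnj (U $$ (b, i))))"
    using U ab by (intro sum.cong refl) (simp add: mat_diag_mult_right[OF U])
  finally show ?thesis .
qed

lemma eig_decI_unitary:
  assumes "unitary_mat n U" "A = U * mat_diag n (\<lambda>i. complex_of_real (l i)) * mat_adjoint U"
  shows "eig_dec n A (\<lambda>i a. U $$ (a, i)) l"
proof -
  have U: "U \<in> carrier_mat n n" using assms(1) by (simp add: unitary_mat_def)
  then have "A \<in> carrier_mat n n" unfolding assms(2)
    by (intro mult_carrier_mat[of _ n n] mat_adjoint_carrier) auto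
  then show ?thesis
    unfolding eig_dec_def using orthonormal_columns_unitary[OF assms(1)] index_unitary_diag_adjoint[OF U]
    by (simp add: assms(2))
qed

lemma eig_dec_unitary_of:
  assumes "eig_dec n A u l"
  shows "A = unitary_of n u * mat_diag n (\<lambda>i. complex_of_real (l i)) * mat_adjoint (unitary_of n u)"
proof (rule eq_matI)
  let ?B = "unitary_of n u * mat_diag n (\<lambda>i. complex_of_real (l i)) * mat_adjoint (unitary_of n u)"
  have B: "?B \<in> carrier_mat n n"
    by (intro mult_carrier_mat[of _ n n] mat_adjoint_carrier) auto
  have A: "A \<in> carrier_mat n n" by (rule eig_decD(1)[OF assms])
  show "dim_row A = dim_row ?B" "dim_col A = dim_col ?B" using A B by (auto dest!: carrier_matD)
  fix a b assume "a < dim_row ?B" "b < dim_col ?B"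
  then have ab: "a < n" "b < n" using B by (auto dest!: carrier_matD)
  show "A $$ (a, b) = ?B $$ (a, b)"
    unfolding index_unitary_diag_adjoint[OF unitary_of_carrier ab] eig_decD(3)[OF assms ab]
    using ab by (intro sum.cong refl) (simp add: unitary_of_def)
qed

text \<open>Makes the definite description in \<open>herm_fun\<close> usable: the given
  decomposition provides a value, and \<open>eig_dec_fun_unique\<close> shows that every other
  diagonalisation yields the same.\<close>

lemma eig_dec_herm_fun:
  assumes e: "eig_dec n A u l"
  shows "eig_dec n (herm_fun f A) u (\<lambda>i. f (l i))"
proof -
  have n: "dim_row A = n" using eig_decD(1)[OF e] by simp
  define B where "B = unitary_of n u * mat_diag n (\<lambda>i. complex_of_real (f (l i))) * mat_adjoint (unitary_of n u)"
  have Bc: "B \<in> carrier_mat n n" unfolding B_def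
    by (intro mult_carrier_mat[of _ n n] mat_adjoint_carrier) auto
  have Be: "B $$ (a, b) = (\<Sum>i<n. of_real (f (l i)) * (u i a * cnj (u i b)))" if "a < n" "b < n" for a b
    unfolding B_def index_unitary_diag_adjoint[OF unitary_of_carrier that]
    using that by (intro sum.cong refl) (simp add: unitary_of_def)
  have "herm_fun f A = B"
    unfolding herm_fun_def n
  proof (rule the_equality)
    show "\<exists>U (l :: nat \<Rightarrow> real). unitary_mat n U \<and> A = U * mat_diag n (\<lambda>i. complex_of_real (l i)) * mat_adjoint U \<and>
       B = U * mat_diag n (\<lambda>i. complex_of_real (f (l i))) * mat_adjoint U"
      using unitary_mat_unitary_of[OF eig_decD(2)[OF e]] eig_dec_unitary_of[OF e] B_def by blast
  next
    fix C assume "\<exists>U (l :: nat \<Rightarrow> real). unitary_mat n U \<and> A = U * mat_diag n (\<lambda>i. complex_of_real (l i)) * mat_adjoint U \<and>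
       C = U * mat_diag n (\<lambda>i. complex_of_real (f (l i))) * mat_adjoint U"
    then obtain U m where U: "unitary_mat n U" "A = U * mat_diag n (\<lambda>i. complex_of_real (m i)) * mat_adjoint U"
       and C: "C = U * mat_diag n (\<lambda>i. complex_of_real (f (m i))) * mat_adjoint U" by blast
    have e': "eig_dec n A (\<lambda>i a. U $$ (a, i)) m" by (rule eig_decI_unitary[OF U])
    have eC: "eig_dec n C (\<lambda>i a. U $$ (a, i)) (\<lambda>i. f (m i))" by (rule eig_decI_unitary[OF U(1) C])
    show "C = B"
    proof (rule eq_matI)
      show "dim_row C = dim_row B" "dim_col C = dim_col B" using Bc eig_decD(1)[OF eC] by auto
      fix a b assume "a < dim_row B" "b < dim_col B"
      then have ab: "a < n" "b < n" using Bc by auto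
      show "C $$ (a, b) = B $$ (a, b)"
        unfolding Be[OF ab] eig_decD(3)[OF eC ab] by (rule eig_dec_fun_unique[OF e' e ab])
    qed
  qed
  then show ?thesis unfolding eig_dec_def using Bc Be eig_decD(2)[OF e] by simp
qed

lemma eig_dec_trace:
  assumes e: "eig_dec n A u l"
  shows "mat_trace A = of_real (\<Sum>i<n. l i)"
proof -
  have "mat_trace A = (\<Sum>a<n. \<Sum>i<n. of_real (l i) * (u i a * cnj (u i a)))"
    unfolding mat_trace_def using eig_decD(1,3)[OF e] by simp
  also have "\<dots> = (\<Sum>i<n. of_real (l i) * (\<Sum>a<n. u i a * cnj (u i a)))"
    unfolding sum_distrib_left by (rule sum.swap)
  also have "\<dots> = (\<Sum>i<n. of_real (l i))"
    using orthonormalD[OF eig_decD(2)[OF e]] by simp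
  finally show ?thesis by simp
qed

section \<open>Quadratic forms and positive semidefinite matrices\<close>

definition coef :: "nat \<Rightarrow> (nat \<Rightarrow> complex) \<Rightarrow> (nat \<Rightarrow> complex) \<Rightarrow> complex" where
  "coef n u v = (\<Sum>a<n. cnj (u a) * v a)"

definition qform :: "nat \<Rightarrow> complex mat \<Rightarrow> (nat \<Rightarrow> complex) \<Rightarrow> complex" where
  "qform n A v = (\<Sum>a<n. \<Sum>b<n. cnj (v a) * A $$ (a, b) * v b)"

lemma parseval:
  assumes "orthonormal n u"
  shows "(\<Sum>i<n. (cmod (coef n (u i) v))\<^sup>2) = (\<Sum>a<n. (cmod (v a))\<^sup>2)"
proof -
  have "complex_of_real (\<Sum>i<n. (cmod (coef n (u i) v))\<^sup>2) = (\<Sum>i<n. coef n (u i) v * (\<Sum>a<n. u i a * cnj (v a)))"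
    unfolding of_real_sum complex_norm_square by (simp add: coef_def)
  also have "\<dots> = (\<Sum>i<n. \<Sum>a<n. cnj (v a) * (u i a * coef n (u i) v))"
    by (simp add: sum_distrib_left mult_ac)
  also have "\<dots> = (\<Sum>a<n. cnj (v a) * (\<Sum>i<n. u i a * coef n (u i) v))"
    unfolding sum_distrib_left by (rule sum.swap)
  also have "\<dots> = (\<Sum>a<n. cnj (v a) * v a)"
    unfolding coef_def using orthonormal_expand[OF assms] by (intro sum.cong refl) simp
  also have "\<dots> = complex_of_real (\<Sum>a<n. (cmod (v a))\<^sup>2)"
    unfolding of_real_sum complex_norm_square by (simp add: mult.commute)
  finally show ?thesis using of_real_eq_iff by blast
qed

lemma coef_eig_dec:
  assumes e: "eig_dec n A u l" and i: "i < n"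
  shows "coef n (u i) (\<lambda>a. \<Sum>b<n. A $$ (a, b) * v b) = of_real (l i) * coef n (u i) v"
proof -
  have "coef n (u i) (\<lambda>a. \<Sum>b<n. A $$ (a, b) * v b) = (\<Sum>a<n. \<Sum>b<n. cnj (u i a) * A $$ (a, b) * v b)"
    unfolding coef_def by (simp only: sum_distrib_left mult.assoc)
  also have "\<dots> = (\<Sum>b<n. (\<Sum>a<n. cnj (u i a) * A $$ (a, b)) * v b)"
    unfolding sum_distrib_right by (rule sum.swap)
  also have "\<dots> = (\<Sum>b<n. of_real (l i) * (cnj (u i b) * v b))"
    using eig_dec_left[OF e i] by (intro sum.cong refl) simp
  finally show ?thesis unfolding coef_def sum_distrib_left .
qed

lemma qform_eig_dec:
  assumes e: "eig_dec n A u l"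
  shows "qform n A v = of_real (\<Sum>i<n. l i * (cmod (coef n (u i) v))\<^sup>2)"
proof -
  have vc: "cnj (v a) = (\<Sum>i<n. cnj (u i a) * cnj (coef n (u i) v))" if "a < n" for a
    using arg_cong[OF orthonormal_expand[OF eig_decD(2)[OF e] that, of v], of cnj] by (simp add: coef_def)
  have "qform n A v = (\<Sum>a<n. cnj (v a) * (\<Sum>b<n. A $$ (a, b) * v b))"
    unfolding qform_def by (simp only: sum_distrib_left mult.assoc)
  also have "\<dots> = (\<Sum>a<n. \<Sum>i<n. cnj (coef n (u i) v) * (cnj (u i a) * (\<Sum>b<n. A $$ (a, b) * v b)))"
  proof (intro sum.cong refl)
    fix a assume "a \<in> {..<n}"
    then have va: "cnj (v a) = (\<Sum>i<n. cnj (u i a) * cnj (coef n (u i) v))" by (simp add: vc)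
    have "cnj (v a) * X = (\<Sum>i<n. cnj (coef n (u i) v) * (cnj (u i a) * X))" for X
      unfolding va sum_distrib_right by (intro sum.cong refl) (simp only: mult_ac)
    then show "cnj (v a) * (\<Sum>b<n. A $$ (a, b) * v b) = (\<Sum>i<n. cnj (coef n (u i) v) * (cnj (u i a) * (\<Sum>b<n. A $$ (a, b) * v b)))" .
  qed
  also have "\<dots> = (\<Sum>i<n. cnj (coef n (u i) v) * coef n (u i) (\<lambda>a. \<Sum>b<n. A $$ (a, b) * v b))"
    unfolding coef_def[of _ _ "\<lambda>a. \<Sum>b<n. A $$ (a, b) * v b"] sum_distrib_left by (rule sum.swap)
  also have "\<dots> = (\<Sum>i<n. of_real (l i) * (coef n (u i) v * cnj (coef n (u i) v)))"
    using coef_eig_dec[OF e] by (intro sum.cong refl) (simp add: mult_ac)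
  finally show ?thesis unfolding of_real_sum of_real_mult complex_norm_square .
qed

lemma coef_orthonormal:
  assumes "orthonormal n u" "i < n" "j < n"
  shows "coef n (u i) (u j) = (if i = j then 1 else 0)"
  using orthonormalD[OF assms(1,3,2)] by (auto simp: coef_def mult.commute)

lemma sum_cmod_orthonormal:
  assumes "orthonormal n u" "i < n"
  shows "(\<Sum>a<n. (cmod (u i a))\<^sup>2) = 1"
proof -
  have "complex_of_real (\<Sum>a<n. (cmod (u i a))\<^sup>2) = 1"
    unfolding of_real_sum complex_norm_square using orthonormalD[OF assms assms(2)] by simp
  then show ?thesis using of_real_eq_1_iff by blast
qed

lemma qform_eigenvector:
  assumes e: "eig_dec n A u l" and i: "i < n"
  shows "qform n A (u i) = of_real (l i)"
proof -
  have "(\<Sum>j<n. l j * (cmod (coef n (u j) (u i)))\<^sup>2) = (\<Sum>j<n. if j = i then l i else 0)"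
    using coef_orthonormal[OF eig_decD(2)[OF e] _ i] by (intro sum.cong refl) auto
  then show ?thesis using qform_eig_dec[OF e, of "u i"] i by simp
qed

lemma qform_vec:
  assumes "A \<in> carrier_mat n n" "v \<in> carrier_vec n"
  shows "(A *\<^sub>v v) \<bullet>c v = qform n A (\<lambda>a. v $ a)"
  using assms by (auto simp: scalar_prod_def qform_def lessThan_atLeast0 sum_distrib_left mult_ac intro!: sum.cong)

lemma qform_cong: "(\<And>a. a < n \<Longrightarrow> v a = w a) \<Longrightarrow> qform n A v = qform n A w"
  by (simp add: qform_def)

lemma psd_mat_iff: "psd_mat n A \<longleftrightarrow> A \<in> carrier_mat n n \<and> (\<forall>v. 0 \<le> qform n A v)"
proof -
  have "0 \<le> qform n A v" if "A \<in> carrier_mat n n" "\<forall>v\<in>carrier_vec n. 0 \<le> (A *\<^sub>v v) \<bullet>c v" for v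
  proof -
    have "0 \<le> qform n A (\<lambda>a. vec n v $ a)" using that qform_vec[OF that(1), of "vec n v"] by (metis vec_carrier)
    also have "qform n A (\<lambda>a. vec n v $ a) = qform n A v" by (rule qform_cong) simp
    finally show ?thesis .
  qed
  then show ?thesis unfolding psd_mat_def using qform_vec by auto
qed

text \<open>The order on complex numbers makes every value of the form real. Polarisation with e_a,
  e_b, e_a + e_b and e_a + i e_b then recovers the symmetry of the entries.\<close>

lemma psd_mat_hermitian:
  assumes psd: "psd_mat n A" and ab: "a < n" "b < n"
  shows "A $$ (a, b) = cnj (A $$ (b, a))"
proof -
  have q: "Im (qform n A v) = 0" for v
    using psd unfolding psd_mat_iff less_eq_complex_def by auto
  have two: "qform n A (\<lambda>x. r * (if x = a then 1 else 0) + t * (if x = b then 1 else 0)) =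
     cnj r * r * A $$ (a, a) + cnj r * t * A $$ (a, b) + cnj t * r * A $$ (b, a) + cnj t * t * A $$ (b, b)" for r t
  proof -
    have inner: "(\<Sum>y<n. A $$ (x, y) * (r * (if y = a then 1 else 0) + t * (if y = b then 1 else 0))) = r * A $$ (x, a) + t * A $$ (x, b)" for x
    proof -
      have "(\<Sum>y<n. A $$ (x, y) * (r * (if y = a then 1 else 0) + t * (if y = b then 1 else 0)))
        = (\<Sum>y<n. (r * A $$ (x, y)) * (if y = a then 1 else 0)) + (\<Sum>y<n. (t * A $$ (x, y)) * (if y = b then 1 else 0))"
        unfolding sum.distrib[symmetric] by (intro sum.cong refl) (simp add: algebra_simps)
      then show ?thesis using sum_delta_mult(1)[OF ab(1), of "\<lambda>y. r * A $$ (x, y)"] sum_delta_mult(1)[OF ab(2), of "\<lambda>y. t * A $$ (x, y)"] by simp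
    qed
    have "qform n A (\<lambda>x. r * (if x = a then 1 else 0) + t * (if x = b then 1 else 0)) =
       (\<Sum>x<n. cnj (r * (if x = a then 1 else 0) + t * (if x = b then 1 else 0)) * (r * A $$ (x, a) + t * A $$ (x, b)))"
      unfolding qform_def mult.assoc sum_distrib_left[symmetric] inner ..
    also have "\<dots> = (\<Sum>x<n. (cnj r * (r * A $$ (x, a) + t * A $$ (x, b))) * (if x = a then 1 else 0)) + (\<Sum>x<n. (cnj t * (r * A $$ (x, a) + t * A $$ (x, b))) * (if x = b then 1 else 0))"
      unfolding sum.distrib[symmetric] by (intro sum.cong refl) (auto simp: algebra_simps)
    also have "\<dots> = cnj r * (r * A $$ (a, a) + t * A $$ (a, b)) + cnj t * (r * A $$ (b, a) + t * A $$ (b, b))"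
      using sum_delta_mult(1)[OF ab(1), of "\<lambda>x. cnj r * (r * A $$ (x, a) + t * A $$ (x, b))"]
        sum_delta_mult(1)[OF ab(2), of "\<lambda>x. cnj t * (r * A $$ (x, a) + t * A $$ (x, b))"] by simp
    finally show ?thesis by (simp add: algebra_simps)
  qed
  have i1: "Im (A $$ (a, a)) = 0" using q[of "\<lambda>x. 1 * (if x = a then 1 else 0) + 0 * (if x = b then 1 else 0)"] unfolding two by simp
  have i2: "Im (A $$ (b, b)) = 0" using q[of "\<lambda>x. 0 * (if x = a then 1 else 0) + 1 * (if x = b then 1 else 0)"] unfolding two by simp
  have i3: "Im (A $$ (a, b)) + Im (A $$ (b, a)) = 0"
    using q[of "\<lambda>x. 1 * (if x = a then 1 else 0) + 1 * (if x = b then 1 else 0)"] i1 i2 unfolding two by simp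
  have i4: "Re (A $$ (a, b)) - Re (A $$ (b, a)) = 0"
    using q[of "\<lambda>x. 1 * (if x = a then 1 else 0) + \<i> * (if x = b then 1 else 0)"] i1 i2 unfolding two by simp
  show ?thesis using i3 i4 by (simp add: complex_eq_iff)
qed

lemma psd_mat_eig_dec:
  assumes "psd_mat n A"
  obtains u l where "eig_dec n A u l" "\<And>i. i < n \<Longrightarrow> 0 \<le> l i"
proof -
  have A: "A \<in> carrier_mat n n" using assms by (simp add: psd_mat_def)
  obtain u l where e: "eig_dec n A u l" using ex_eig_dec[OF A psd_mat_hermitian[OF assms]] by blast
  moreover have "0 \<le> l i" if "i < n" for i
  proof -
    have "0 \<le> qform n A (u i)" using assms by (simp add: psd_mat_iff)
    then show ?thesis unfolding qform_eigenvector[OF e that] by (simp add: less_eq_complex_def)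
  qed
  ultimately show ?thesis using that by blast
qed

section \<open>Convexity of real powers\<close>

text \<open>Bernoulli's inequality for real exponents: t^p - p t is smallest at t = 1.\<close>

lemma powr_above_tangent_1:
  fixes t p :: real
  assumes "1 \<le> p" "0 \<le> t"
  shows "1 + p * (t - 1) \<le> t powr p"
proof (cases "t = 0")
  case False
  then have t: "0 < t" using assms by simp
  let ?f = "\<lambda>t. t powr p - p * t"
  have der: "(?f has_real_derivative p * (x powr (p - 1) - 1)) (at x)" if "0 < x" for x
    using that by (auto intro!: derivative_eq_intros simp: algebra_simps)
  have "?f 1 \<le> ?f t"
  proof (cases "1 \<le> t")
    case True
    show ?thesis
    proof (rule DERIV_nonneg_imp_nondecreasing[OF True])
      fix x assume "1 \<le> x" "x \<le> t"
      then have "(?f has_real_derivative p * (x powr (p - 1) - 1)) (at x)" "0 \<le> p * (x powr (p - 1) - 1)"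
        using assms(1) der[of x] by (auto simp: ge_one_powr_ge_zero)
      then show "\<exists>y. (?f has_real_derivative y) (at x) \<and> 0 \<le> y" by blast
    qed
  next
    case False
    then have "t \<le> 1" by simp
    then show ?thesis
    proof (rule DERIV_nonpos_imp_nonincreasing)
      fix x assume "t \<le> x" "x \<le> 1"
      moreover have "x powr (p - 1) \<le> x powr 0"
        using calculation t assms(1) by (intro powr_mono') auto
      ultimately have "(?f has_real_derivative p * (x powr (p - 1) - 1)) (at x)" "p * (x powr (p - 1) - 1) \<le> 0"
        using t assms(1) der[of x] by (auto intro!: mult_nonneg_nonpos)
      then show "\<exists>y. (?f has_real_derivative y) (at x) \<and> y \<le> 0" by blast
    qed
  qed
  then show ?thesis by (simp add: algebra_simps)
qed (use assms in simp)

text \<open>Average the tangent inequality at the mean \<open>c\<close>, rescaled to 1; the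
  rescaling divides by \<open>c\<close>, so \<open>c = 0\<close> is treated apart.\<close>

lemma powr_jensen:
  fixes w x :: "'a \<Rightarrow> real"
  assumes "finite S" "1 \<le> p" and w: "\<And>i. i \<in> S \<Longrightarrow> 0 \<le> w i" "(\<Sum>i\<in>S. w i) = 1" and x: "\<And>i. i \<in> S \<Longrightarrow> 0 \<le> x i"
  shows "(\<Sum>i\<in>S. w i * x i) powr p \<le> (\<Sum>i\<in>S. w i * x i powr p)"
proof -
  define c where "c = (\<Sum>i\<in>S. w i * x i)"
  have c0: "0 \<le> c" unfolding c_def using w x by (intro sum_nonneg mult_nonneg_nonneg) auto
  show ?thesis
  proof (cases "c = 0")
    case True
    then show ?thesis unfolding c_def[symmetric] using w by (auto intro!: sum_nonneg)
  next
    case False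
    with c0 have c: "0 < c" by simp
    have "c powr p = (\<Sum>i\<in>S. w i * (c powr p * (1 + p * (x i / c - 1))))"
    proof -
      have "(\<Sum>i\<in>S. w i * (c powr p * (1 + p * (x i / c - 1)))) = (\<Sum>i\<in>S. c powr p * (1 - p) * w i + c powr p * p / c * (w i * x i))"
        by (intro sum.cong refl) (simp add: field_simps)
      also have "\<dots> = c powr p * (1 - p) * 1 + c powr p * p / c * c"
        unfolding sum.distrib sum_distrib_left[symmetric] w(2) c_def[symmetric] ..
      finally show ?thesis using c by (simp add: field_simps)
    qed
    also have "\<dots> \<le> (\<Sum>i\<in>S. w i * x i powr p)"
    proof (intro sum_mono mult_left_mono w)
      fix i assume i: "i \<in> S"
      have "c powr p * (1 + p * (x i / c - 1)) \<le> c powr p * (x i / c) powr p"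
        using c x[OF i] assms(2) by (intro mult_left_mono powr_above_tangent_1) auto
      also have "\<dots> = x i powr p" using c x[OF i] by (simp add: powr_mult[symmetric])
      finally show "c powr p * (1 + p * (x i / c - 1)) \<le> x i powr p" .
    qed
    finally show ?thesis by (simp add: c_def)
  qed
qed

section \<open>Schatten norms through eigenvalues\<close>

text \<open>There are no absolute values because the arguments are spectra of positive semidefinite
  matrices; the maximum is taken only for positive dimension.\<close>

definition lp_norm :: "ereal \<Rightarrow> nat \<Rightarrow> (nat \<Rightarrow> real) \<Rightarrow> real" where
  "lp_norm p n l = (if p = \<infinity> then Max (l ` {..<n}) else (\<Sum>i<n. l i powr real_of_ereal p) powr (1 / real_of_ereal p))"

lemma unit_vectors_iff: "\<phi> \<in> unit_vectors n \<longleftrightarrow> \<phi> \<in> carrier_vec n \<and> (\<Sum>a<n. (cmod (\<phi> $ a))\<^sup>2) = 1"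
proof -
  have "\<phi> \<bullet>c \<phi> = complex_of_real (\<Sum>a<n. (cmod (\<phi> $ a))\<^sup>2)" if "\<phi> \<in> carrier_vec n"
    unfolding of_real_sum complex_norm_square using that
    by (auto simp: scalar_prod_def lessThan_atLeast0 intro!: sum.cong)
  then show ?thesis unfolding unit_vectors_def using of_real_eq_1_iff by fastforce
qed

lemma mat_abs_psd:
  assumes e: "eig_dec n A u l" and l: "\<And>i. i < n \<Longrightarrow> 0 \<le> l i"
  shows "mat_abs A = A"
proof -
  have A: "A \<in> carrier_mat n n" by (rule eig_decD(1)[OF e])
  have AA: "eig_dec n (mat_adjoint A * A) u (\<lambda>i. (l i)\<^sup>2)"
    unfolding eig_dec_def
  proof (intro conjI allI impI)
    show "mat_adjoint A * A \<in> carrier_mat n n" using A by (intro mult_carrier_mat[of _ n n] mat_adjoint_carrier)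
    show "orthonormal n u" by (rule eig_decD(2)[OF e])
    fix a b assume ab: "a < n" "b < n"
    have "(mat_adjoint A * A) $$ (a, b) = (\<Sum>c<n. mat_adjoint A $$ (a, c) * A $$ (c, b))"
      using A ab by (intro index_mult_mat_lessThan[of _ n n]) auto
    also have "\<dots> = (\<Sum>c<n. A $$ (a, c) * A $$ (c, b))"
      using A ab eig_dec_hermitian[OF e] by (intro sum.cong refl) simp
    also have "\<dots> = (\<Sum>c<n. \<Sum>i<n. of_real (l i) * u i a * (cnj (u i c) * A $$ (c, b)))"
      using eig_decD(3)[OF e ab(1)] by (intro sum.cong refl) (simp add: sum_distrib_left sum_distrib_right mult_ac)
    also have "\<dots> = (\<Sum>i<n. of_real (l i) * u i a * (\<Sum>c<n. cnj (u i c) * A $$ (c, b)))"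
      unfolding sum_distrib_left by (rule sum.swap)
    also have "\<dots> = (\<Sum>i<n. of_real ((l i)\<^sup>2) * (u i a * cnj (u i b)))"
      using eig_dec_left[OF e _ ab(2)] by (intro sum.cong refl) (simp add: power2_eq_square mult_ac)
    finally show "(mat_adjoint A * A) $$ (a, b) = (\<Sum>i<n. of_real ((l i)\<^sup>2) * (u i a * cnj (u i b)))" .
  qed
  have m: "eig_dec n (mat_abs A) u (\<lambda>i. sqrt ((l i)\<^sup>2))"
    unfolding mat_abs_def by (rule eig_dec_herm_fun[OF AA])
  show ?thesis
  proof (rule eq_matI)
    show "dim_row (mat_abs A) = dim_row A" "dim_col (mat_abs A) = dim_col A" using A eig_decD(1)[OF m] by auto
    fix a b assume "a < dim_row A" "b < dim_col A"
    then have ab: "a < n" "b < n" using A by auto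
    show "mat_abs A $$ (a, b) = A $$ (a, b)"
      unfolding eig_decD(3)[OF m ab] eig_decD(3)[OF e ab] using l by (intro sum.cong refl) simp
  qed
qed

lemma op_norm_eig_dec:
  assumes e: "eig_dec n A u l" and l: "\<And>i. i < n \<Longrightarrow> 0 \<le> l i" and n: "0 < n"
  shows "op_norm A = Max (l ` {..<n})"
proof -
  have A: "A \<in> carrier_mat n n" by (rule eig_decD(1)[OF e])
  let ?g = "\<lambda>v. sqrt (Re ((A *\<^sub>v v) \<bullet>c (A *\<^sub>v v)))"
  let ?M = "Max (l ` {..<n})"
  have lM: "l i \<le> ?M" if "i < n" for i using that by (intro Max_ge) auto
  have g: "?g v = sqrt (\<Sum>i<n. (l i)\<^sup>2 * (cmod (coef n (u i) (\<lambda>a. v $ a)))\<^sup>2)" if v: "v \<in> carrier_vec n" for v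
  proof -
    have Av: "(A *\<^sub>v v) $ a = (\<Sum>b<n. A $$ (a, b) * v $ b)" if "a < n" for a
      using that v A by (auto simp: scalar_prod_def lessThan_atLeast0 intro!: sum.cong)
    have "(A *\<^sub>v v) \<bullet>c (A *\<^sub>v v) = complex_of_real (\<Sum>a<n. (cmod (\<Sum>b<n. A $$ (a, b) * v $ b))\<^sup>2)"
      unfolding of_real_sum complex_norm_square using A v Av
      by (auto simp: scalar_prod_def[of "A *\<^sub>v v"] lessThan_atLeast0 simp del: index_mult_mat_vec intro!: sum.cong)
    also have "(\<Sum>a<n. (cmod (\<Sum>b<n. A $$ (a, b) * v $ b))\<^sup>2) = (\<Sum>i<n. (cmod (coef n (u i) (\<lambda>a. \<Sum>b<n. A $$ (a, b) * v $ b)))\<^sup>2)"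
      by (rule parseval[OF eig_decD(2)[OF e], symmetric])
    also have "\<dots> = (\<Sum>i<n. (l i)\<^sup>2 * (cmod (coef n (u i) (\<lambda>a. v $ a)))\<^sup>2)"
      using coef_eig_dec[OF e] by (intro sum.cong refl) (simp add: norm_mult power_mult_distrib)
    finally show ?thesis by (simp only: Re_complex_of_real)
  qed
  have le: "?g v \<le> ?M" if "v \<in> unit_vectors n" for v
  proof -
    have v: "v \<in> carrier_vec n" "(\<Sum>a<n. (cmod (v $ a))\<^sup>2) = 1" using that by (auto simp: unit_vectors_iff)
    have M0: "0 \<le> ?M" using l[OF n] lM[OF n] by linarith
    have "(\<Sum>i<n. (l i)\<^sup>2 * (cmod (coef n (u i) (\<lambda>a. v $ a)))\<^sup>2) \<le> (\<Sum>i<n. ?M\<^sup>2 * (cmod (coef n (u i) (\<lambda>a. v $ a)))\<^sup>2)"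
      using l lM by (intro sum_mono mult_right_mono power_mono) auto
    also have "\<dots> = ?M\<^sup>2" unfolding sum_distrib_left[symmetric] parseval[OF eig_decD(2)[OF e]] v(2) by simp
    finally show ?thesis unfolding g[OF v(1)] using M0 real_sqrt_le_iff real_le_lsqrt by blast
  qed
  have uu: "vec n (u i) \<in> unit_vectors n" if "i < n" for i
    using sum_cmod_orthonormal[OF eig_decD(2)[OF e] that] by (simp add: unit_vectors_iff)
  have gu: "?g (vec n (u i)) = l i" if i: "i < n" for i
  proof -
    have c: "coef n (u j) (\<lambda>a. vec n (u i) $ a) = (if j = i then 1 else 0)" if "j < n" for j
      using coef_orthonormal[OF eig_decD(2)[OF e] that i] by (simp add: coef_def)
    have "(\<Sum>j<n. (l j)\<^sup>2 * (cmod (coef n (u j) (\<lambda>a. vec n (u i) $ a)))\<^sup>2) = (\<Sum>j<n. if j = i then (l i)\<^sup>2 else 0)"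
      using c by (intro sum.cong refl) auto
    then show ?thesis using g[of "vec n (u i)"] i l[OF i] by simp
  qed
  have dim: "dim_col A = n" using A by simp
  show ?thesis
  proof (rule antisym)
    show "op_norm A \<le> ?M"
      unfolding op_norm_def dim using uu[OF n] le by (intro cSUP_least) auto
    have "?M \<in> l ` {..<n}" using n by (intro Max_in) auto
    then obtain i where i: "i < n" "?M = l i" by auto
    have "l i \<le> op_norm A"
      unfolding op_norm_def dim gu[OF i(1), symmetric]
      using uu[OF i(1)] le by (intro cSUP_upper bdd_aboveI2) auto
    then show "?M \<le> op_norm A" using i by simp
  qed
qed

lemma ereal_gt_1_cases:
  assumes "1 < (p :: ereal)"
  obtains "p = \<infinity>" | r where "p = ereal r" "1 < r"
  using assms by (cases p) auto

lemma schatten_norm_eig_dec: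
  assumes e: "eig_dec n A u l" and l: "\<And>i. i < n \<Longrightarrow> 0 \<le> l i" and n: "0 < n" and p: "1 < p"
  shows "schatten_norm p A = lp_norm p n l"
  using p
proof (cases rule: ereal_gt_1_cases)
  case 1
  then show ?thesis using op_norm_eig_dec[OF e l n] by (simp add: schatten_norm_def lp_norm_def)
next
  case (2 r)
  have abs: "mat_abs A = A" by (rule mat_abs_psd[OF e l])
  have "mat_trace (mat_powr (mat_abs A) r) = of_real (\<Sum>i<n. l i powr r)"
    unfolding abs mat_powr_def by (rule eig_dec_trace[OF eig_dec_herm_fun[OF e]])
  then show ?thesis using 2 by (simp add: schatten_norm_def lp_norm_def)
qed

lemma lp_norm_prob:
  assumes l: "\<And>i. i < n \<Longrightarrow> 0 \<le> l i" and s: "(\<Sum>i<n. l i) = 1" and p: "1 < p"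
  shows "0 < lp_norm p n l" "lp_norm p n l \<le> 1" "i < n \<Longrightarrow> l i \<le> lp_norm p n l"
proof -
  have n: "0 < n" using s by (cases n) auto
  have l1: "l i \<le> 1" if "i < n" for i
    using member_le_sum[of i "{..<n}" l] that l s by auto
  obtain j where j: "j < n" "0 < l j"
    using l s by (metis less_eq_real_def lessThan_iff sum.neutral zero_neq_one)
  have ge: "l i \<le> lp_norm p n l" if i: "i < n" for i
    using p
  proof (cases rule: ereal_gt_1_cases)
    case 1
    then show ?thesis using i by (auto simp: lp_norm_def intro!: Max_ge)
  next
    case (2 r)
    have "l i = (l i powr r) powr (1 / r)" using 2 l[OF i] by (simp add: powr_powr)
    also have "\<dots> \<le> (\<Sum>i<n. l i powr r) powr (1 / r)"
      using 2 i by (intro powr_mono2 member_le_sum) auto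
    finally show ?thesis using 2 by (simp add: lp_norm_def)
  qed
  then show "i < n \<Longrightarrow> l i \<le> lp_norm p n l" .
  show "0 < lp_norm p n l" using ge[OF j(1)] j(2) by linarith
  show "lp_norm p n l \<le> 1"
    using p
  proof (cases rule: ereal_gt_1_cases)
    case 1
    have "Max (l ` {..<n}) \<le> 1" using n l1 by (subst Max_le_iff) (auto simp: lessThan_empty_iff)
    then show ?thesis using 1 by (simp add: lp_norm_def)
  next
    case (2 r)
    have "(\<Sum>i<n. l i powr r) \<le> (\<Sum>i<n. l i powr 1)"
      using 2 l l1 by (intro sum_mono powr_mono') auto
    also have "\<dots> = 1" using s l by simp
    finally have "(\<Sum>i<n. l i powr r) powr (1 / r) \<le> 1 powr (1 / r)"
      using 2 by (intro powr_mono2 sum_nonneg) auto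
    then show ?thesis using 2 by (simp add: lp_norm_def)
  qed
qed

lemma density_ops_eig_dec:
  assumes "\<rho> \<in> density_ops n"
  obtains u l where "eig_dec n \<rho> u l" "\<And>i. i < n \<Longrightarrow> 0 \<le> l i" "(\<Sum>i<n. l i) = 1"
proof -
  have psd: "psd_mat n \<rho>" and tr: "mat_trace \<rho> = 1" using assms by (auto simp: density_ops_def)
  obtain u l where e: "eig_dec n \<rho> u l" "\<And>i. i < n \<Longrightarrow> 0 \<le> l i" using psd_mat_eig_dec[OF psd] by blast
  moreover have "(\<Sum>i<n. l i) = 1" using tr unfolding eig_dec_trace[OF e(1)] using of_real_eq_1_iff by blast
  ultimately show ?thesis using that by blast
qed

lemma density_ops_dim_pos: "\<rho> \<in> density_ops n \<Longrightarrow> 0 < n"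
  by (erule density_ops_eig_dec) (cases n; auto)

text \<open>The entropy formula treats finite and infinite \<open>p\<close> alike from here on. The
  last conclusion holds because a quadratic form at a unit vector is an average of eigenvalues, each
  at most the norm; it will turn an overlap into an entropy bound.\<close>

lemma schatten_norm_density:
  assumes "\<rho> \<in> density_ops n" "1 < p"
  shows "0 < schatten_norm p \<rho>" "schatten_norm p \<rho> \<le> 1"
    "renyi_entropy p \<rho> = - conj_exp p * ln (schatten_norm p \<rho>)"
    "(\<Sum>a<n. (cmod (v a))\<^sup>2) = 1 \<Longrightarrow> Re (qform n \<rho> v) \<le> schatten_norm p \<rho>"
proof -
  obtain u l where e: "eig_dec n \<rho> u l" and l: "\<And>i. i < n \<Longrightarrow> 0 \<le> l i" and s: "(\<Sum>i<n. l i) = 1"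
    using density_ops_eig_dec[OF assms(1)] by blast
  have n: "0 < n" by (rule density_ops_dim_pos[OF assms(1)])
  have S: "schatten_norm p \<rho> = lp_norm p n l" by (rule schatten_norm_eig_dec[OF e l n assms(2)])
  have lp: "0 < lp_norm p n l" "lp_norm p n l \<le> 1" "\<And>i. i < n \<Longrightarrow> l i \<le> lp_norm p n l"
    using lp_norm_prob[OF _ s assms(2)] l by blast+
  show "0 < schatten_norm p \<rho>" "schatten_norm p \<rho> \<le> 1" using S lp(1,2) by auto
  show "renyi_entropy p \<rho> = - conj_exp p * ln (schatten_norm p \<rho>)"
    using assms(2)
  proof (cases rule: ereal_gt_1_cases)
    case 1
    then show ?thesis by (simp add: renyi_entropy_def schatten_norm_def conj_exp_def)
  next
    case (2 r)
    have t: "mat_trace (mat_powr \<rho> r) = of_real (\<Sum>i<n. l i powr r)"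
      unfolding mat_powr_def by (rule eig_dec_trace[OF eig_dec_herm_fun[OF e]])
    have pos: "(\<Sum>i<n. l i powr r) \<noteq> 0"
      using lp(1) 2 by (auto simp: lp_norm_def)
    show ?thesis unfolding S using 2 pos
      by (simp add: renyi_entropy_def conj_exp_def lp_norm_def t ln_powr field_simps)
  qed
  show "Re (qform n \<rho> v) \<le> schatten_norm p \<rho>" if v: "(\<Sum>a<n. (cmod (v a))\<^sup>2) = 1"
  proof -
    have "Re (qform n \<rho> v) = (\<Sum>i<n. l i * (cmod (coef n (u i) v))\<^sup>2)" unfolding qform_eig_dec[OF e] by simp
    also have "\<dots> \<le> (\<Sum>i<n. lp_norm p n l * (cmod (coef n (u i) v))\<^sup>2)"
      using lp(3) by (intro sum_mono mult_right_mono) auto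
    also have "\<dots> = lp_norm p n l"
      unfolding sum_distrib_left[symmetric] parseval[OF eig_decD(2)[OF e]] v by simp
    finally show ?thesis unfolding S .
  qed
qed

section \<open>Maps in Kraus form\<close>

text \<open>The last clause is trace preservation. One notion serves the channel, its conjugate and
  their tensor product; the formula is demanded only for arguments of the right size, where the
  matrix expressions have their meaning.\<close>

definition kraus_form :: "nat \<Rightarrow> nat \<Rightarrow> 'k set \<Rightarrow> ('k \<Rightarrow> nat \<Rightarrow> nat \<Rightarrow> complex) \<Rightarrow> (complex mat \<Rightarrow> complex mat) \<Rightarrow> bool" where
  "kraus_form n a I K T \<longleftrightarrow> finite I \<and>
     (\<forall>X\<in>carrier_mat n n. T X \<in> carrier_mat a a \<and>
       (\<forall>r<a. \<forall>c<a. T X $$ (r, c) = (\<Sum>m\<in>I. \<Sum>i<n. \<Sum>j<n. K m r i * X $$ (i, j) * cnj (K m c j)))) \<and>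
     (\<forall>i<n. \<forall>j<n. (\<Sum>m\<in>I. \<Sum>r<a. cnj (K m r i) * K m r j) = (if i = j then 1 else 0))"

lemma kraus_formD:
  assumes "kraus_form n a I K T"
  shows "finite I" "X \<in> carrier_mat n n \<Longrightarrow> T X \<in> carrier_mat a a"
    "X \<in> carrier_mat n n \<Longrightarrow> r < a \<Longrightarrow> c < a \<Longrightarrow> T X $$ (r, c) = (\<Sum>m\<in>I. \<Sum>i<n. \<Sum>j<n. K m r i * X $$ (i, j) * cnj (K m c j))"
    "i < n \<Longrightarrow> j < n \<Longrightarrow> (\<Sum>m\<in>I. \<Sum>r<a. cnj (K m r i) * K m r j) = (if i = j then 1 else 0)"
  using assms by (auto simp: kraus_form_def)

text \<open>Each Kraus operator is moved to the vector by its adjoint. This gives positivity, and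
  later allows all but a few operators to be dropped.\<close>

lemma qform_kraus:
  assumes k: "kraus_form n a I K T" and X: "X \<in> carrier_mat n n"
  shows "qform a (T X) v = (\<Sum>m\<in>I. qform n X (\<lambda>i. \<Sum>r<a. cnj (K m r i) * v r))"
proof -
  define G where "G = (\<lambda>m i j r c. cnj (v r) * (K m r i * X $$ (i, j) * cnj (K m c j)) * v c)"
  have "qform a (T X) v = (\<Sum>r<a. \<Sum>c<a. \<Sum>m\<in>I. \<Sum>i<n. \<Sum>j<n. G m i j r c)"
    unfolding qform_def G_def using kraus_formD(3)[OF k X]
    by (intro sum.cong refl) (simp add: sum_distrib_left sum_distrib_right)
  also have "\<dots> = (\<Sum>r<a. \<Sum>m\<in>I. \<Sum>c<a. \<Sum>i<n. \<Sum>j<n. G m i j r c)"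
    by (intro sum.cong refl sum.swap)
  also have "\<dots> = (\<Sum>m\<in>I. \<Sum>r<a. \<Sum>c<a. \<Sum>i<n. \<Sum>j<n. G m i j r c)"
    by (rule sum.swap)
  also have "\<dots> = (\<Sum>m\<in>I. qform n X (\<lambda>i. \<Sum>r<a. cnj (K m r i) * v r))"
  proof (rule sum.cong[OF refl])
    fix m
    have "(\<Sum>r<a. \<Sum>c<a. \<Sum>i<n. \<Sum>j<n. G m i j r c) = (\<Sum>r<a. \<Sum>i<n. \<Sum>c<a. \<Sum>j<n. G m i j r c)"
      by (rule sum.cong[OF refl], rule sum.swap)
    also have "\<dots> = (\<Sum>i<n. \<Sum>r<a. \<Sum>c<a. \<Sum>j<n. G m i j r c)"
      by (rule sum.swap)
    also have "\<dots> = (\<Sum>i<n. \<Sum>r<a. \<Sum>j<n. \<Sum>c<a. G m i j r c)"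
      by (rule sum.cong[OF refl], rule sum.cong[OF refl], rule sum.swap)
    also have "\<dots> = (\<Sum>i<n. \<Sum>j<n. \<Sum>r<a. \<Sum>c<a. G m i j r c)"
      by (rule sum.cong[OF refl], rule sum.swap)
    also have "\<dots> = qform n X (\<lambda>i. \<Sum>r<a. cnj (K m r i) * v r)"
      unfolding qform_def
    proof (intro sum.cong refl)
      fix i j
      have "(\<Sum>r<a. \<Sum>c<a. G m i j r c) = (\<Sum>r<a. \<Sum>c<a. (cnj (v r) * K m r i) * (cnj (K m c j) * v c)) * X $$ (i, j)"
        unfolding sum_distrib_right G_def by (intro sum.cong refl) (simp only: mult_ac)
      also have "\<dots> = (\<Sum>r<a. cnj (v r) * K m r i) * (\<Sum>c<a. cnj (K m c j) * v c) * X $$ (i, j)"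
        by (simp only: sum_product)
      also have "\<dots> = cnj (\<Sum>r<a. cnj (K m r i) * v r) * X $$ (i, j) * (\<Sum>c<a. cnj (K m c j) * v c)"
        by (simp add: mult_ac)
      finally show "(\<Sum>r<a. \<Sum>c<a. G m i j r c) = cnj (\<Sum>r<a. cnj (K m r i) * v r) * X $$ (i, j) * (\<Sum>r<a. cnj (K m r j) * v r)" .
    qed
    finally show "(\<Sum>r<a. \<Sum>c<a. \<Sum>i<n. \<Sum>j<n. G m i j r c) = qform n X (\<lambda>i. \<Sum>r<a. cnj (K m r i) * v r)" .
  qed
  finally show ?thesis .
qed

lemma trace_kraus:
  assumes k: "kraus_form n a I K T" and X: "X \<in> carrier_mat n n"
  shows "mat_trace (T X) = mat_trace X"
proof -
  let ?G = "\<lambda>m i j r. K m r i * X $$ (i, j) * cnj (K m r j)"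
  have "mat_trace (T X) = (\<Sum>r<a. \<Sum>m\<in>I. \<Sum>i<n. \<Sum>j<n. ?G m i j r)"
    unfolding mat_trace_def using kraus_formD(2,3)[OF k X] by simp
  also have "\<dots> = (\<Sum>m\<in>I. \<Sum>r<a. \<Sum>i<n. \<Sum>j<n. ?G m i j r)"
    by (rule sum.swap)
  also have "\<dots> = (\<Sum>m\<in>I. \<Sum>i<n. \<Sum>r<a. \<Sum>j<n. ?G m i j r)"
    by (rule sum.cong[OF refl], rule sum.swap)
  also have "\<dots> = (\<Sum>m\<in>I. \<Sum>i<n. \<Sum>j<n. \<Sum>r<a. ?G m i j r)"
    by (rule sum.cong[OF refl], rule sum.cong[OF refl], rule sum.swap)
  also have "\<dots> = (\<Sum>i<n. \<Sum>m\<in>I. \<Sum>j<n. \<Sum>r<a. ?G m i j r)"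
    by (rule sum.swap)
  also have "\<dots> = (\<Sum>i<n. \<Sum>j<n. \<Sum>m\<in>I. \<Sum>r<a. ?G m i j r)"
    by (rule sum.cong[OF refl], rule sum.swap)
  also have "\<dots> = (\<Sum>i<n. \<Sum>j<n. X $$ (i, j) * (\<Sum>m\<in>I. \<Sum>r<a. cnj (K m r j) * K m r i))"
    unfolding sum_distrib_left by (intro sum.cong refl) (simp only: mult_ac)
  also have "\<dots> = (\<Sum>i<n. \<Sum>j<n. X $$ (i, j) * (if j = i then 1 else 0))"
    using kraus_formD(4)[OF k] by (intro sum.cong refl) simp
  also have "\<dots> = (\<Sum>i<n. X $$ (i, i))"
    using sum_delta_mult(1) by (intro sum.cong refl) simp
  also have "\<dots> = mat_trace X" using X by (simp add: mat_trace_def)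
  finally show ?thesis .
qed

lemma density_ops_kraus:
  assumes k: "kraus_form n a I K T" and X: "X \<in> density_ops n"
  shows "T X \<in> density_ops a"
proof -
  have Xc: "X \<in> carrier_mat n n" and q: "0 \<le> qform n X v" and tr: "mat_trace X = 1" for v
    using X by (auto simp: density_ops_def psd_mat_iff)
  have "0 \<le> qform a (T X) v" for v unfolding qform_kraus[OF k Xc] by (intro sum_nonneg q)
  then show ?thesis
    unfolding density_ops_def psd_mat_iff using kraus_formD(2)[OF k Xc] trace_kraus[OF k Xc] tr by simp
qed

lemma ketbra_carrier: "\<phi> \<in> carrier_vec n \<Longrightarrow> ketbra \<phi> \<in> carrier_mat n n"
  by (auto simp: ketbra_def)

lemma index_ketbra: "\<phi> \<in> carrier_vec n \<Longrightarrow> a < n \<Longrightarrow> b < n \<Longrightarrow> ketbra \<phi> $$ (a, b) = \<phi> $ a * cnj (\<phi> $ b)"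
  by (auto simp: ketbra_def)

lemma qform_ketbra:
  assumes "\<phi> \<in> carrier_vec n"
  shows "qform n (ketbra \<phi>) v = of_real ((cmod (coef n (\<lambda>a. \<phi> $ a) v))\<^sup>2)"
proof -
  have "qform n (ketbra \<phi>) v = (\<Sum>a<n. \<Sum>b<n. (cnj (v a) * \<phi> $ a) * (cnj (\<phi> $ b) * v b))"
    unfolding qform_def using index_ketbra[OF assms] by (intro sum.cong refl) simp
  also have "\<dots> = cnj (coef n (\<lambda>a. \<phi> $ a) v) * coef n (\<lambda>a. \<phi> $ a) v"
    unfolding coef_def cnj_sum sum_product by (simp add: mult_ac)
  finally show ?thesis unfolding complex_norm_square by (simp add: mult.commute)
qed

lemma ketbra_density:
  assumes "\<phi> \<in> unit_vectors n"
  shows "ketbra \<phi> \<in> density_ops n"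
proof -
  have \<phi>: "\<phi> \<in> carrier_vec n" "(\<Sum>a<n. (cmod (\<phi> $ a))\<^sup>2) = 1" using assms by (auto simp: unit_vectors_iff)
  have "0 \<le> qform n (ketbra \<phi>) v" for v unfolding qform_ketbra[OF \<phi>(1)] by (simp add: less_eq_complex_def)
  moreover have "mat_trace (ketbra \<phi>) = 1"
  proof -
    have "mat_trace (ketbra \<phi>) = complex_of_real (\<Sum>a<n. (cmod (\<phi> $ a))\<^sup>2)"
      unfolding mat_trace_def of_real_sum complex_norm_square using \<phi>(1) index_ketbra[OF \<phi>(1)] ketbra_carrier[OF \<phi>(1)] by simp
    then show ?thesis using \<phi>(2) by simp
  qed
  ultimately show ?thesis
    unfolding density_ops_def psd_mat_iff using ketbra_carrier[OF \<phi>(1)] by simp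
qed

text \<open>
  Convexity of the Schatten norm on psd matrices: in an eigenbasis of \<open>T \<rho>\<close> the eigenvalues of \<open>T \<rho>\<close>
  are averages of those of the pure-state outputs, and Jensen's inequality applies.
\<close>

lemma schatten_norm_kraus_le:
  assumes k: "kraus_form n a I K T" and p: "1 < p"
    and le: "\<And>\<phi>. \<phi> \<in> unit_vectors n \<Longrightarrow> schatten_norm p (T (ketbra \<phi>)) \<le> m"
    and \<rho>: "\<rho> \<in> density_ops n"
  shows "schatten_norm p (T \<rho>) \<le> m"
proof -
  obtain e r where e: "eig_dec n \<rho> e r" and r: "\<And>i. i < n \<Longrightarrow> 0 \<le> r i" "(\<Sum>i<n. r i) = 1"
    using density_ops_eig_dec[OF \<rho>] by blast
  have T\<rho>: "T \<rho> \<in> density_ops a" by (rule density_ops_kraus[OF k \<rho>])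
  obtain u l where u: "eig_dec a (T \<rho>) u l" and l: "\<And>i. i < a \<Longrightarrow> 0 \<le> l i" "(\<Sum>i<a. l i) = 1"
    using density_ops_eig_dec[OF T\<rho>] by blast
  have a: "0 < a" by (rule density_ops_dim_pos[OF T\<rho>])
  define X where "X = (\<lambda>k. T (ketbra (vec n (e k))))"
  have uv: "vec n (e k) \<in> unit_vectors n" if "k < n" for k
    using sum_cmod_orthonormal[OF eig_decD(2)[OF e] that] by (simp add: unit_vectors_iff)
  have Xd: "X k \<in> density_ops a" if "k < n" for k
    unfolding X_def by (rule density_ops_kraus[OF k ketbra_density[OF uv[OF that]]])
  have ex: "\<exists>w q. eig_dec a (X k) w q \<and> (\<forall>i<a. 0 \<le> q i)" if k: "k < n" for k
  proof -
    obtain w q where "eig_dec a (X k) w q" "\<And>i. i < a \<Longrightarrow> 0 \<le> q i"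
      using density_ops_eig_dec[OF Xd[OF k]] by blast
    then show ?thesis by blast
  qed
  then obtain w q where w: "\<And>k. k < n \<Longrightarrow> eig_dec a (X k) (w k) (q k)" and q: "\<And>k i. k < n \<Longrightarrow> i < a \<Longrightarrow> 0 \<le> q k i"
    by metis
  have \<rho>c: "\<rho> \<in> carrier_mat n n" using eig_decD(1)[OF e] .
  have kc: "ketbra (vec n (e k)) \<in> carrier_mat n n" for k by (intro ketbra_carrier) simp
  have TX: "T \<rho> $$ (x, y) = (\<Sum>k<n. of_real (r k) * X k $$ (x, y))" if "x < a" "y < a" for x y
  proof -
  let ?G = "\<lambda>m i j k. of_real (r k) * (K m x i * (e k i * cnj (e k j)) * cnj (K m y j))"
    have "T \<rho> $$ (x, y) = (\<Sum>m\<in>I. \<Sum>i<n. \<Sum>j<n. \<Sum>k<n. ?G m i j k)"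
      unfolding kraus_formD(3)[OF k \<rho>c that] using eig_decD(3)[OF e]
      by (intro sum.cong refl) (simp add: sum_distrib_left sum_distrib_right mult_ac)
    also have "\<dots> = (\<Sum>m\<in>I. \<Sum>i<n. \<Sum>k<n. \<Sum>j<n. ?G m i j k)"
      by (rule sum.cong[OF refl], rule sum.cong[OF refl], rule sum.swap)
    also have "\<dots> = (\<Sum>m\<in>I. \<Sum>k<n. \<Sum>i<n. \<Sum>j<n. ?G m i j k)"
      by (rule sum.cong[OF refl], rule sum.swap)
    also have "\<dots> = (\<Sum>k<n. \<Sum>m\<in>I. \<Sum>i<n. \<Sum>j<n. ?G m i j k)"
      by (rule sum.swap)
    also have "\<dots> = (\<Sum>k<n. of_real (r k) * X k $$ (x, y))"
    proof (rule sum.cong[OF refl])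
      fix k' assume "k' \<in> {..<n}"
      have "X k' $$ (x, y) = (\<Sum>m\<in>I. \<Sum>i<n. \<Sum>j<n. K m x i * (e k' i * cnj (e k' j)) * cnj (K m y j))"
        unfolding X_def kraus_formD(3)[OF k kc that]
        by (intro sum.cong refl) (simp add: index_ketbra[of _ n])
      then show "(\<Sum>m\<in>I. \<Sum>i<n. \<Sum>j<n. of_real (r k') * (K m x i * (e k' i * cnj (e k' j)) * cnj (K m y j))) = of_real (r k') * X k' $$ (x, y)"
        by (simp only: sum_distrib_left)
    qed
    finally show ?thesis .
  qed
  have qT: "qform a (T \<rho>) v = (\<Sum>k<n. of_real (r k) * qform a (X k) v)" for v
  proof -
    have "qform a (T \<rho>) v = (\<Sum>x<a. \<Sum>y<a. \<Sum>k<n. of_real (r k) * (cnj (v x) * X k $$ (x, y) * v y))"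
      unfolding qform_def using TX by (intro sum.cong refl) (simp add: sum_distrib_left sum_distrib_right mult_ac)
    also have "\<dots> = (\<Sum>x<a. \<Sum>k<n. \<Sum>y<a. of_real (r k) * (cnj (v x) * X k $$ (x, y) * v y))"
      by (rule sum.cong[OF refl], rule sum.swap)
    also have "\<dots> = (\<Sum>k<n. \<Sum>x<a. \<Sum>y<a. of_real (r k) * (cnj (v x) * X k $$ (x, y) * v y))"
      by (rule sum.swap)
    finally show ?thesis unfolding qform_def by (simp only: sum_distrib_left)
  qed
  \<comment> \<open>For each \<open>k\<close> this is the doubly stochastic matrix of squared
    overlaps of two orthonormal bases. \<open>Ci\<close> normalises the weights for Jensen's
    inequality, and \<open>Cj\<close> removes them after summing over \<open>j\<close>.\<close>
  define C where "C = (\<lambda>j k i. (cmod (coef a (w k i) (u j)))\<^sup>2)"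
  have C0: "0 \<le> C j k i" for j k i by (simp add: C_def)
  have lj: "l j = (\<Sum>k<n. r k * (\<Sum>i<a. q k i * C j k i))" if "j < a" for j
  proof -
    have "complex_of_real (l j) = (\<Sum>k<n. of_real (r k) * qform a (X k) (u j))"
      using qform_eigenvector[OF u that] qT by simp
    also have "\<dots> = (\<Sum>k<n. of_real (r k) * of_real (\<Sum>i<a. q k i * C j k i))"
      using qform_eig_dec[OF w] by (intro sum.cong refl) (simp add: C_def)
    also have "\<dots> = complex_of_real (\<Sum>k<n. r k * (\<Sum>i<a. q k i * C j k i))" by simp
    finally show ?thesis using of_real_eq_iff by blast
  qed
  have Ci: "(\<Sum>i<a. C j k i) = 1" if "j < a" "k < n" for j k
    unfolding C_def parseval[OF eig_decD(2)[OF w[OF that(2)]]] by (rule sum_cmod_orthonormal[OF eig_decD(2)[OF u] that(1)])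
  have Cj: "(\<Sum>j<a. C j k i) = 1" if "i < a" "k < n" for i k
  proof -
    have "C j k i = (cmod (coef a (u j) (w k i)))\<^sup>2" for j
    proof -
      have "coef a (w k i) (u j) = cnj (coef a (u j) (w k i))" by (simp add: coef_def mult.commute)
      then show ?thesis by (simp add: C_def)
    qed
    then have "(\<Sum>j<a. C j k i) = (\<Sum>j<a. (cmod (coef a (u j) (w k i)))\<^sup>2)" by simp
    also have "\<dots> = 1" unfolding parseval[OF eig_decD(2)[OF u]] by (rule sum_cmod_orthonormal[OF eig_decD(2)[OF w[OF that(2)]] that(1)])
    finally show ?thesis .
  qed
  have S: "schatten_norm p (X k) = lp_norm p a (q k)" if "k < n" for k
    by (rule schatten_norm_eig_dec[OF w[OF that] q[OF that] a p])
  have Sm: "lp_norm p a (q k) \<le> m" if "k < n" for k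
    using S[OF that] le[OF uv[OF that]] by (simp add: X_def)
  have "lp_norm p a l \<le> m"
    using p
  proof (cases rule: ereal_gt_1_cases)
    case 1
    have "l j \<le> m" if j: "j < a" for j
    proof -
      have "q k i \<le> m" if "k < n" "i < a" for k i
      proof -
        have "q k i \<le> Max (q k ` {..<a})" using that(2) by (intro Max_ge) auto
        also have "\<dots> \<le> m" using Sm[OF that(1)] 1 by (simp add: lp_norm_def)
        finally show ?thesis .
      qed
      then have "l j \<le> (\<Sum>k<n. r k * (\<Sum>i<a. m * C j k i))"
        unfolding lj[OF j] using r C0 by (intro sum_mono mult_left_mono mult_right_mono) auto
      also have "\<dots> = (\<Sum>k<n. r k * m)"
        unfolding sum_distrib_left[symmetric] using Ci[OF j] by (intro sum.cong refl) simp
      also have "\<dots> = m" using r(2) by (simp add: sum_distrib_right[symmetric])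
      finally show ?thesis .
    qed
    then have "Max (l ` {..<a}) \<le> m" using a by (subst Max_le_iff) (auto simp: lessThan_empty_iff)
    then show ?thesis using 1 by (simp add: lp_norm_def)
  next
    case (2 t)
    have m0: "0 \<le> m"
    proof -
      obtain k where "k < n" using density_ops_dim_pos[OF \<rho>] by blast
      then show ?thesis using Sm[of k] 2 by (auto simp: lp_norm_def intro: order_trans[OF powr_ge_zero])
    qed
    have qm: "(\<Sum>i<a. q k i powr t) \<le> m powr t" if "k < n" for k
    proof -
      have "((\<Sum>i<a. q k i powr t) powr (1 / t)) powr t \<le> m powr t"
        using Sm[OF that] 2 by (intro powr_mono2) (auto simp: lp_norm_def)
      then show ?thesis using 2 by (simp add: powr_powr sum_nonneg)
    qed
    have jen: "l j powr t \<le> (\<Sum>k<n. r k * (\<Sum>i<a. C j k i * q k i powr t))" if j: "j < a" for j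
    proof -
      let ?S = "{..<n} \<times> {..<a}"
      have "l j = (\<Sum>z\<in>?S. (r (fst z) * C j (fst z) (snd z)) * q (fst z) (snd z))"
        unfolding lj[OF j] sum.cartesian_product' by (simp add: sum_distrib_left mult_ac)
      also have "\<dots> powr t \<le> (\<Sum>z\<in>?S. (r (fst z) * C j (fst z) (snd z)) * q (fst z) (snd z) powr t)"
      proof (rule powr_jensen)
        show "(\<Sum>z\<in>?S. r (fst z) * C j (fst z) (snd z)) = 1"
          unfolding sum.cartesian_product' using Ci[OF j] r(2) by (simp add: sum_distrib_left[symmetric])
      qed (use 2 r q C0 in auto)
      also have "\<dots> = (\<Sum>k<n. r k * (\<Sum>i<a. C j k i * q k i powr t))"
        unfolding sum.cartesian_product' by (simp add: sum_distrib_left mult_ac)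
      finally show ?thesis .
    qed
    have "(\<Sum>j<a. l j powr t) \<le> (\<Sum>j<a. \<Sum>k<n. r k * (\<Sum>i<a. C j k i * q k i powr t))"
      using jen by (intro sum_mono) auto
    also have "\<dots> = (\<Sum>k<n. \<Sum>j<a. r k * (\<Sum>i<a. C j k i * q k i powr t))" by (rule sum.swap)
    also have "\<dots> = (\<Sum>k<n. r k * (\<Sum>j<a. \<Sum>i<a. C j k i * q k i powr t))" by (simp only: sum_distrib_left)
    also have "\<dots> = (\<Sum>k<n. r k * (\<Sum>i<a. \<Sum>j<a. C j k i * q k i powr t))"
      by (subst sum.swap) (rule refl)
    also have "\<dots> = (\<Sum>k<n. r k * (\<Sum>i<a. q k i powr t))"
      unfolding sum_distrib_right[symmetric] using Cj by (intro sum.cong refl arg_cong2[where f = "(*)"]) auto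
    also have "\<dots> \<le> (\<Sum>k<n. r k * m powr t)"
      using qm r by (intro sum_mono mult_left_mono) auto
    also have "\<dots> = m powr t" using r(2) by (simp add: sum_distrib_right[symmetric])
    finally have "(\<Sum>j<a. l j powr t) powr (1 / t) \<le> (m powr t) powr (1 / t)"
      using 2 by (intro powr_mono2 sum_nonneg) auto
    also have "\<dots> = m" using 2 m0 by (simp add: powr_powr)
    finally show ?thesis using 2 by (simp add: lp_norm_def)
  qed
  then show ?thesis using schatten_norm_eig_dec[OF u l(1) a p] by simp
qed

section \<open>Product indices and concrete Kraus operators\<close>

lemma sum_lessThan_add:
  fixes f :: "nat \<Rightarrow> 'a :: comm_monoid_add"
  shows "(\<Sum>x<m + b. f x) = (\<Sum>x<m. f x) + (\<Sum>k<b. f (m + k))"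
  by (induction b) (simp_all add: add.assoc)

lemma sum_mult_add:
  fixes f :: "nat \<Rightarrow> 'a :: comm_monoid_add"
  shows "(\<Sum>i<a. \<Sum>k<b. f (i * b + k)) = (\<Sum>x<a * b. f x)"
proof (induction a)
  case (Suc a)
  have "(\<Sum>x<Suc a * b. f x) = (\<Sum>x<a * b + b. f x)" by (simp add: add.commute)
  also have "\<dots> = (\<Sum>x<a * b. f x) + (\<Sum>k<b. f (a * b + k))"
    by (rule sum_lessThan_add)
  finally show ?case using Suc by simp
qed simp

lemma sum_div_mod:
  fixes g :: "nat \<Rightarrow> nat \<Rightarrow> 'a :: comm_monoid_add"
  shows "(\<Sum>x<a * b. g (x div b) (x mod b)) = (\<Sum>i<a. \<Sum>k<b. g i k)"
  unfolding sum_mult_add[symmetric] by (intro sum.cong refl) auto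

lemma div_mod_less:
  assumes "x < a * b"
  shows "x div b < a" "x mod b < (b :: nat)"
  using assms by (cases "b = 0"; simp add: less_mult_imp_div_less)+

lemma mult_add_less:
  assumes "r < a" "m < b"
  shows "r * b + m < a * (b :: nat)"
proof -
  have "r * b + m < Suc r * b" using assms(2) by simp
  also have "\<dots> \<le> a * b" using assms(1) by (intro mult_le_mono1 Suc_leI)
  finally show ?thesis .
qed

lemma index_sandwich:
  fixes V X W :: "complex mat"
  assumes "V \<in> carrier_mat m s" "X \<in> carrier_mat s s" "W \<in> carrier_mat s m" "x < m" "y < m"
  shows "(V * X * W) $$ (x, y) = (\<Sum>i<s. \<Sum>j<s. V $$ (x, i) * X $$ (i, j) * W $$ (j, y))"
proof -
  have c: "V * X \<in> carrier_mat m s" using assms by auto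
  have "(V * X * W) $$ (x, y) = (\<Sum>j<s. (V * X) $$ (x, j) * W $$ (j, y))"
    by (rule index_mult_mat_lessThan[OF c assms(3-5)])
  also have "\<dots> = (\<Sum>j<s. \<Sum>i<s. V $$ (x, i) * X $$ (i, j) * W $$ (j, y))"
    using assms by (intro sum.cong refl) (simp add: index_mult_mat_lessThan[OF assms(1,2)] sum_distrib_right del: index_mult_mat)
  finally show ?thesis by (subst sum.swap)
qed

lemma isometry_columns:
  assumes "isometry_mat m s V" "i < s" "j < s"
  shows "(\<Sum>t<m. cnj (V $$ (t, i)) * V $$ (t, j)) = (if i = j then 1 else 0)"
proof -
  have V: "V \<in> carrier_mat m s" "mat_adjoint V * V = 1\<^sub>m s" using assms(1) by (auto simp: isometry_mat_def)
  have "(mat_adjoint V * V) $$ (i, j) = (\<Sum>t<m. mat_adjoint V $$ (i, t) * V $$ (t, j))"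
    by (rule index_mult_mat_lessThan[OF mat_adjoint_carrier[OF V(1)] V(1) assms(2,3)])
  also have "\<dots> = (\<Sum>t<m. cnj (V $$ (t, i)) * V $$ (t, j))"
    using V(1) assms(2) by (intro sum.cong refl) simp
  finally show ?thesis using V(2) assms(2,3) by simp
qed

lemma index_channel:
  assumes V: "V \<in> carrier_mat (d * d) s" and X: "X \<in> carrier_mat s s" and "r < d" "c < d"
  shows "channel d V X $$ (r, c) = (\<Sum>m<d. \<Sum>i<s. \<Sum>j<s. V $$ (r * d + m, i) * X $$ (i, j) * cnj (V $$ (c * d + m, j)))"
proof -
  have lt: "r * d + m < d * d" if "m < d" "r < d" for m r
    using that by (simp add: mult_add_less)
  have "channel d V X $$ (r, c) = (\<Sum>m<d. (V * X * mat_adjoint V) $$ (r * d + m, c * d + m))"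
    using assms by (simp add: channel_def partial_trace_B_def)
  also have "\<dots> = (\<Sum>m<d. \<Sum>i<s. \<Sum>j<s. V $$ (r * d + m, i) * X $$ (i, j) * mat_adjoint V $$ (j, c * d + m))"
    using lt assms by (intro sum.cong refl index_sandwich[OF V X mat_adjoint_carrier[OF V]]) auto
  also have "\<dots> = (\<Sum>m<d. \<Sum>i<s. \<Sum>j<s. V $$ (r * d + m, i) * X $$ (i, j) * cnj (V $$ (c * d + m, j)))"
    using V lt assms by (intro sum.cong refl) simp
  finally show ?thesis .
qed

lemma index_conj_channel:
  assumes V: "V \<in> carrier_mat (d * d) s" and X: "X \<in> carrier_mat s s" and "r < d" "c < d"
  shows "conj_channel d V X $$ (r, c) = (\<Sum>m<d. \<Sum>i<s. \<Sum>j<s. cnj (V $$ (r * d + m, i)) * X $$ (i, j) * V $$ (c * d + m, j))"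
proof -
  have lt: "r * d + m < d * d" if "m < d" "r < d" for m r
    using that by (simp add: mult_add_less)
  have V': "map_mat cnj V \<in> carrier_mat (d * d) s" "transpose_mat V \<in> carrier_mat s (d * d)" using V by auto
  have "conj_channel d V X $$ (r, c) = (\<Sum>m<d. (map_mat cnj V * X * transpose_mat V) $$ (r * d + m, c * d + m))"
    using assms by (simp add: conj_channel_def partial_trace_B_def)
  also have "\<dots> = (\<Sum>m<d. \<Sum>i<s. \<Sum>j<s. map_mat cnj V $$ (r * d + m, i) * X $$ (i, j) * transpose_mat V $$ (j, c * d + m))"
    using lt assms by (intro sum.cong refl index_sandwich[OF V'(1) X V'(2)]) auto
  also have "\<dots> = (\<Sum>m<d. \<Sum>i<s. \<Sum>j<s. cnj (V $$ (r * d + m, i)) * X $$ (i, j) * V $$ (c * d + m, j))"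
    using V lt assms by (intro sum.cong refl) simp
  finally show ?thesis .
qed

lemma kraus_form_channel:
  assumes iso: "isometry_mat (d * d) s V"
  shows "kraus_form s d {..<d} (\<lambda>m r i. V $$ (r * d + m, i)) (channel d V)"
proof -
  have V: "V \<in> carrier_mat (d * d) s" using iso by (simp add: isometry_mat_def)
  have "(\<Sum>m<d. \<Sum>r<d. cnj (V $$ (r * d + m, i)) * V $$ (r * d + m, j)) = (if i = j then 1 else 0)" if "i < s" "j < s" for i j
    by (subst sum.swap) (simp add: sum_mult_add[of "\<lambda>x. cnj (V $$ (x, i)) * V $$ (x, j)"] isometry_columns[OF iso that])
  then show ?thesis
    unfolding kraus_form_def using index_channel[OF V] by (auto simp: channel_def partial_trace_B_def)
qed

lemma kraus_form_conj_channel: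
  assumes iso: "isometry_mat (d * d) s V"
  shows "kraus_form s d {..<d} (\<lambda>m r i. cnj (V $$ (r * d + m, i))) (conj_channel d V)"
proof -
  have V: "V \<in> carrier_mat (d * d) s" using iso by (simp add: isometry_mat_def)
  have "(\<Sum>m<d. \<Sum>r<d. cnj (cnj (V $$ (r * d + m, i))) * cnj (V $$ (r * d + m, j))) = (if i = j then 1 else 0)" if "i < s" "j < s" for i j
  proof -
    have "(\<Sum>m<d. \<Sum>r<d. cnj (cnj (V $$ (r * d + m, i))) * cnj (V $$ (r * d + m, j))) = (\<Sum>r<d. \<Sum>m<d. cnj (V $$ (r * d + m, j)) * V $$ (r * d + m, i))"
      by (subst sum.swap) (simp add: mult.commute)
    also have "\<dots> = (if j = i then 1 else 0)"
      by (simp add: sum_mult_add[of "\<lambda>x. cnj (V $$ (x, j)) * V $$ (x, i)"] isometry_columns[OF iso that(2,1)])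
    finally show ?thesis by auto
  qed
  then show ?thesis
    unfolding kraus_form_def using index_conj_channel[OF V] by (auto simp: conj_channel_def partial_trace_B_def)
qed

lemma index_kraus_mat_unit:
  assumes k: "kraus_form n a I K T" and "i < n" "j < n" "r < a" "c < a"
  shows "T (mat_unit n i j) $$ (r, c) = (\<Sum>m\<in>I. K m r i * cnj (K m c j))"
proof -
  have E: "mat_unit n i j \<in> carrier_mat n n" by (simp add: mat_unit_def)
  have "T (mat_unit n i j) $$ (r, c) = (\<Sum>m\<in>I. \<Sum>k<n. \<Sum>l<n. K m r k * mat_unit n i j $$ (k, l) * cnj (K m c l))"
    by (rule kraus_formD(3)[OF k E assms(4,5)])
  also have "\<dots> = (\<Sum>m\<in>I. \<Sum>k<n. (K m r k * cnj (K m c j)) * (if k = i then 1 else 0))"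
  proof (intro sum.cong refl)
    fix m k' assume "k' \<in> {..<n}"
    then have "(\<Sum>l<n. K m r k' * mat_unit n i j $$ (k', l) * cnj (K m c l)) = (\<Sum>l<n. (K m r k' * (if k' = i then 1 else 0) * cnj (K m c l)) * (if l = j then 1 else 0))"
      by (intro sum.cong refl) (simp add: mat_unit_def)
    also have "\<dots> = K m r k' * (if k' = i then 1 else 0) * cnj (K m c j)"
      by (rule sum_delta_mult(1)[OF assms(3)])
    finally show "(\<Sum>l<n. K m r k' * mat_unit n i j $$ (k', l) * cnj (K m c l)) = (K m r k' * cnj (K m c j)) * (if k' = i then 1 else 0)"
      by simp
  qed
  also have "\<dots> = (\<Sum>m\<in>I. K m r i * cnj (K m c j))"
    by (intro sum.cong refl sum_delta_mult(1)[OF assms(2)])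
  finally show ?thesis .
qed

text \<open>On matrix units, through which \<open>tensor_map\<close> is defined, the two maps give
  products of Kraus entries; so the products K \<otimes> L represent the tensor map, with
  \<open>div\<close> and \<open>mod\<close> decoding the lexicographic index. Trace preservation
  factors in the same way.\<close>

lemma kraus_form_tensor:
  assumes k: "kraus_form n a I K T" and l: "kraus_form m b J L T'"
  shows "kraus_form (n * m) (a * b) (I \<times> J) (\<lambda>z r x. K (fst z) (r div b) (x div m) * L (snd z) (r mod b) (x mod m))
    (tensor_map n a T m b T')"
proof -
  let ?M = "\<lambda>z r x. K (fst z) (r div b) (x div m) * L (snd z) (r mod b) (x mod m)"
  have entry: "tensor_map n a T m b T' X $$ (r, c) = (\<Sum>z\<in>I \<times> J. \<Sum>x<n * m. \<Sum>y<n * m. ?M z r x * X $$ (x, y) * cnj (?M z c y))"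
    if rc: "r < a * b" "c < a * b" for X r c
  proof -
    let ?t = "\<lambda>i j k l p q. X $$ (i * m + k, j * m + l) * ((K p (r div b) i * cnj (K p (c div b) j)) * (L q (r mod b) k * cnj (L q (c mod b) l)))"
    have kr: "kron (T (mat_unit n i j)) (T' (mat_unit m k' l')) $$ (r, c) =
       (\<Sum>p\<in>I. \<Sum>q\<in>J. (K p (r div b) i * cnj (K p (c div b) j)) * (L q (r mod b) k' * cnj (L q (c mod b) l')))"
      if "i < n" "j < n" "k' < m" "l' < m" for i j k' l'
    proof -
      have c1: "T (mat_unit n i j) \<in> carrier_mat a a" "T' (mat_unit m k' l') \<in> carrier_mat b b"
        by (auto intro!: kraus_formD(2)[OF k] kraus_formD(2)[OF l] simp: mat_unit_def)
      then have "kron (T (mat_unit n i j)) (T' (mat_unit m k' l')) $$ (r, c) = T (mat_unit n i j) $$ (r div b, c div b) * T' (mat_unit m k' l') $$ (r mod b, c mod b)"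
        using rc by (simp add: kron_def)
      then show ?thesis
        unfolding index_kraus_mat_unit[OF k that(1,2) div_mod_less(1)[OF rc(1)] div_mod_less(1)[OF rc(2)]]
          index_kraus_mat_unit[OF l that(3,4) div_mod_less(2)[OF rc(1)] div_mod_less(2)[OF rc(2)]]
        by (simp only: sum_product)
    qed
    have "tensor_map n a T m b T' X $$ (r, c) = (\<Sum>i<n. \<Sum>j<n. \<Sum>k<m. \<Sum>l<m. \<Sum>p\<in>I. \<Sum>q\<in>J. ?t i j k l p q)"
    proof -
      have "tensor_map n a T m b T' X $$ (r, c) = (\<Sum>i<n. \<Sum>j<n. \<Sum>k<m. \<Sum>l<m.
          X $$ (i * m + k, j * m + l) * kron (T (mat_unit n i j)) (T' (mat_unit m k l)) $$ (r, c))"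
        using rc by (simp add: tensor_map_def)
      also have "\<dots> = (\<Sum>i<n. \<Sum>j<n. \<Sum>k<m. \<Sum>l<m. \<Sum>p\<in>I. \<Sum>q\<in>J. ?t i j k l p q)"
      proof (intro sum.cong refl)
        fix i j k l assume "i \<in> {..<n}" "j \<in> {..<n}" "k \<in> {..<m}" "l \<in> {..<m}"
        then show "X $$ (i * m + k, j * m + l) * kron (T (mat_unit n i j)) (T' (mat_unit m k l)) $$ (r, c) = (\<Sum>p\<in>I. \<Sum>q\<in>J. ?t i j k l p q)"
          using kr by (simp only: lessThan_iff sum_distrib_left)
      qed
      finally show ?thesis .
    qed
    also have "\<dots> = (\<Sum>i<n. \<Sum>k<m. \<Sum>j<n. \<Sum>l<m. \<Sum>p\<in>I. \<Sum>q\<in>J. ?t i j k l p q)"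
      by (rule sum.cong[OF refl], rule sum.swap)
    also have "\<dots> = (\<Sum>i<n. \<Sum>k<m. \<Sum>j<n. \<Sum>l<m. \<Sum>z\<in>I \<times> J. ?t i j k l (fst z) (snd z))"
      unfolding sum.cartesian_product' by simp
    also have "\<dots> = (\<Sum>x<n * m. \<Sum>j<n. \<Sum>l<m. \<Sum>z\<in>I \<times> J. ?t (x div m) j (x mod m) l (fst z) (snd z))"
      by (rule sum_div_mod[symmetric])
    also have "\<dots> = (\<Sum>x<n * m. \<Sum>y<n * m. \<Sum>z\<in>I \<times> J. ?t (x div m) (y div m) (x mod m) (y mod m) (fst z) (snd z))"
      by (rule sum.cong[OF refl], rule sum_div_mod[symmetric])
    also have "\<dots> = (\<Sum>x<n * m. \<Sum>z\<in>I \<times> J. \<Sum>y<n * m. ?t (x div m) (y div m) (x mod m) (y mod m) (fst z) (snd z))"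
      by (rule sum.cong[OF refl], rule sum.swap)
    also have "\<dots> = (\<Sum>z\<in>I \<times> J. \<Sum>x<n * m. \<Sum>y<n * m. ?t (x div m) (y div m) (x mod m) (y mod m) (fst z) (snd z))"
      by (rule sum.swap)
    also have "\<dots> = (\<Sum>z\<in>I \<times> J. \<Sum>x<n * m. \<Sum>y<n * m. ?M z r x * X $$ (x, y) * cnj (?M z c y))"
      by (intro sum.cong refl) (simp add: mult_ac)
    finally show ?thesis .
  qed
  have iso: "(\<Sum>z\<in>I \<times> J. \<Sum>r<a * b. cnj (?M z r x) * ?M z r y) = (if x = y then 1 else 0)" if xy: "x < n * m" "y < n * m" for x y
  proof -
    have "(\<Sum>r<a * b. cnj (?M (p, q) r x) * ?M (p, q) r y) =
       (\<Sum>i<a. \<Sum>k<b. (cnj (K p i (x div m)) * K p i (y div m)) * (cnj (L q k (x mod m)) * L q k (y mod m)))" for p q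
      by (subst sum_div_mod[symmetric]) (simp add: mult_ac)
    then have "(\<Sum>z\<in>I \<times> J. \<Sum>r<a * b. cnj (?M z r x) * ?M z r y)
       = (\<Sum>p\<in>I. \<Sum>q\<in>J. \<Sum>i<a. \<Sum>k<b. (cnj (K p i (x div m)) * K p i (y div m)) * (cnj (L q k (x mod m)) * L q k (y mod m)))"
      by (simp only: sum.cartesian_product')
    also have "\<dots> = (\<Sum>p\<in>I. \<Sum>i<a. cnj (K p i (x div m)) * K p i (y div m)) * (\<Sum>q\<in>J. \<Sum>k<b. cnj (L q k (x mod m)) * L q k (y mod m))"
    proof -
      have "(\<Sum>i<a. \<Sum>k<b. (cnj (K p i (x div m)) * K p i (y div m)) * (cnj (L q k (x mod m)) * L q k (y mod m)))
        = (\<Sum>i<a. cnj (K p i (x div m)) * K p i (y div m)) * (\<Sum>k<b. cnj (L q k (x mod m)) * L q k (y mod m))" for p q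
        by (simp only: sum_product)
      then show ?thesis by (simp only: sum_product[where A = I and B = J])
    qed
    also have "\<dots> = (if x div m = y div m then 1 else 0) * (if x mod m = y mod m then 1 else 0)"
      using kraus_formD(4)[OF k div_mod_less(1)[OF xy(1)] div_mod_less(1)[OF xy(2)]]
        kraus_formD(4)[OF l div_mod_less(2)[OF xy(1)] div_mod_less(2)[OF xy(2)]] by simp
    also have "\<dots> = (if x = y then 1 else 0)"
    proof -
      have "x = y \<longleftrightarrow> x div m = y div m \<and> x mod m = y mod m" by (metis div_mult_mod_eq)
      then show ?thesis by simp
    qed
    finally show ?thesis .
  qed
  show ?thesis
    unfolding kraus_form_def using entry iso kraus_formD(1)[OF k] kraus_formD(1)[OF l]
    by (auto simp: tensor_map_def simp del: index_mat(1))
qed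

section \<open>The maximally entangled state\<close>

definition max_entangled_vec :: "nat \<Rightarrow> nat \<Rightarrow> complex" where
  "max_entangled_vec s x = (if x div s = x mod s then complex_of_real (1 / sqrt (real s)) else 0)"

lemma max_entangled_alt: "max_entangled s = ketbra (vec (s * s) (max_entangled_vec s))"
  by (simp add: max_entangled_def max_entangled_vec_def[abs_def])

lemma sum_max_entangled_vec:
  "(\<Sum>x<s * s. max_entangled_vec s x * g x) = of_real (1 / sqrt (real s)) * (\<Sum>i<s. g (i * s + i))"
proof -
  have "(\<Sum>x<s * s. max_entangled_vec s x * g x) = (\<Sum>i<s. \<Sum>k<s. max_entangled_vec s (i * s + k) * g (i * s + k))"
    by (rule sum_mult_add[symmetric])
  also have "\<dots> = (\<Sum>i<s. \<Sum>k<s. (of_real (1 / sqrt (real s)) * g (i * s + k)) * (if i = k then 1 else 0))"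
    by (intro sum.cong refl) (auto simp: max_entangled_vec_def)
  also have "\<dots> = (\<Sum>i<s. of_real (1 / sqrt (real s)) * g (i * s + i))"
    by (intro sum.cong refl sum_delta_mult(2)) simp
  finally show ?thesis by (simp only: sum_distrib_left)
qed

lemma sum_cmod_max_entangled_vec:
  assumes "1 \<le> s"
  shows "(\<Sum>x<s * s. (cmod (max_entangled_vec s x))\<^sup>2) = 1"
proof -
  have "complex_of_real (\<Sum>x<s * s. (cmod (max_entangled_vec s x))\<^sup>2) = (\<Sum>x<s * s. max_entangled_vec s x * cnj (max_entangled_vec s x))"
    unfolding of_real_sum complex_norm_square ..
  also have "\<dots> = of_real (1 / sqrt (real s)) * (\<Sum>i<s. cnj (max_entangled_vec s (i * s + i)))"
    by (rule sum_max_entangled_vec)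
  also have "\<dots> = of_real (1 / sqrt (real s)) * (\<Sum>i<s. of_real (1 / sqrt (real s)))"
    by (intro arg_cong2[where f = "(*)"] sum.cong refl) (simp add: max_entangled_vec_def)
  also have "\<dots> = complex_of_real (1 / sqrt (real s) * (real s * (1 / sqrt (real s))))"
    by (simp only: sum_constant card_lessThan of_real_mult of_real_of_nat_eq)
  also have "1 / sqrt (real s) * (real s * (1 / sqrt (real s))) = 1" using assms by simp
  finally show ?thesis by (metis of_real_eq_1_iff of_real_1)
qed

lemma max_entangled_unit: "1 \<le> s \<Longrightarrow> vec (s * s) (max_entangled_vec s) \<in> unit_vectors (s * s)"
  using sum_cmod_max_entangled_vec[of s] by (simp add: unit_vectors_iff)

lemma kraus_form_channel_pair:
  assumes "isometry_mat (d * d) s V"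
  shows "kraus_form (s * s) (d * d) ({..<d} \<times> {..<d})
    (\<lambda>z r x. V $$ ((r div d) * d + fst z, x div s) * cnj (V $$ ((r mod d) * d + snd z, x mod s))) (channel_pair d s V)"
  using kraus_form_tensor[OF kraus_form_channel[OF assms] kraus_form_conj_channel[OF assms]] by simp

text \<open>Keep only the Kraus operators with equal indices and apply Cauchy--Schwarz.\<close>

lemma overlap_channel_pair:
  assumes iso: "isometry_mat (d * d) s V" and s: "1 \<le> s" and d: "1 \<le> d"
  shows "real s / (real d)\<^sup>2 \<le> Re (qform (d * d) (channel_pair d s V (max_entangled s)) (max_entangled_vec d))"
proof -
  let ?M = "\<lambda>z r x. V $$ ((r div d) * d + fst z, x div s) * cnj (V $$ ((r mod d) * d + snd z, x mod s))"
  define w where "w = (\<lambda>z x. \<Sum>r<d * d. cnj (?M z r x) * max_entangled_vec d r)"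
  let ?c = "\<lambda>z. coef (s * s) (\<lambda>x. vec (s * s) (max_entangled_vec s) $ x) (w z)"
  have carr: "ketbra (vec (s * s) (max_entangled_vec s)) \<in> carrier_mat (s * s) (s * s)"
    by (intro ketbra_carrier) simp
  have q: "qform (d * d) (channel_pair d s V (max_entangled s)) (max_entangled_vec d) = (\<Sum>z\<in>{..<d} \<times> {..<d}. of_real ((cmod (?c z))\<^sup>2))"
  proof -
    have "qform (d * d) (channel_pair d s V (ketbra (vec (s * s) (max_entangled_vec s)))) (max_entangled_vec d)
       = (\<Sum>z\<in>{..<d} \<times> {..<d}. qform (s * s) (ketbra (vec (s * s) (max_entangled_vec s))) (w z))"
      unfolding w_def by (rule qform_kraus[OF kraus_form_channel_pair[OF iso] carr])
    also have "\<dots> = (\<Sum>z\<in>{..<d} \<times> {..<d}. of_real ((cmod (?c z))\<^sup>2))"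
      by (intro sum.cong refl qform_ketbra) simp
    finally show ?thesis unfolding max_entangled_alt .
  qed
  \<comment> \<open>Squared Hilbert-Schmidt norms of the Kraus operators, with total s by trace
    preservation. The pair (m, m) contributes (y m)^2 / (s d) to the overlap, and the squares sum to
    at least s^2 / d.\<close>
  define y where "y = (\<lambda>m. \<Sum>i<s. \<Sum>r<d. (cmod (V $$ (r * d + m, i)))\<^sup>2)"
  have sy: "(\<Sum>m<d. y m) = s"
  proof -
    have "complex_of_real (\<Sum>m<d. y m) = (\<Sum>m<d. \<Sum>i<s. \<Sum>r<d. cnj (V $$ (r * d + m, i)) * V $$ (r * d + m, i))"
      unfolding y_def of_real_sum complex_norm_square by (simp only: mult.commute)
    also have "\<dots> = (\<Sum>i<s. \<Sum>m<d. \<Sum>r<d. cnj (V $$ (r * d + m, i)) * V $$ (r * d + m, i))"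
      by (rule sum.swap)
    also have "\<dots> = (\<Sum>i<s. 1)"
      using kraus_formD(4)[OF kraus_form_channel[OF iso]] by (intro sum.cong refl) simp
    finally have "complex_of_real (\<Sum>m<d. y m) = complex_of_real (real s)" by simp
    then show ?thesis using of_real_eq_iff by blast
  qed
  have c: "?c (m, m) = of_real (1 / sqrt (real s) * (1 / sqrt (real d)) * y m)" if m: "m < d" for m
  proof -
    have w: "w (m, m) (i * s + i) = of_real (1 / sqrt (real d)) * (\<Sum>r<d. of_real ((cmod (V $$ (r * d + m, i)))\<^sup>2))" if i: "i < s" for i
    proof -
      have "w (m, m) (i * s + i) = (\<Sum>r<d * d. max_entangled_vec d r * cnj (?M (m, m) r (i * s + i)))"
        unfolding w_def by (simp only: mult.commute)
      also have "\<dots> = of_real (1 / sqrt (real d)) * (\<Sum>r<d. cnj (?M (m, m) (r * d + r) (i * s + i)))"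
        by (rule sum_max_entangled_vec)
      also have "(\<Sum>r<d. cnj (?M (m, m) (r * d + r) (i * s + i))) = (\<Sum>r<d. of_real ((cmod (V $$ (r * d + m, i)))\<^sup>2))"
        unfolding complex_norm_square using i by (intro sum.cong refl) (simp add: mult.commute)
      finally show ?thesis .
    qed
    have "?c (m, m) = (\<Sum>x<s * s. max_entangled_vec s x * w (m, m) x)"
      unfolding coef_def by (intro sum.cong refl) (simp add: max_entangled_vec_def)
    also have "\<dots> = of_real (1 / sqrt (real s)) * (\<Sum>i<s. w (m, m) (i * s + i))"
      by (rule sum_max_entangled_vec)
    also have "(\<Sum>i<s. w (m, m) (i * s + i)) = (\<Sum>i<s. of_real (1 / sqrt (real d)) * (\<Sum>r<d. of_real ((cmod (V $$ (r * d + m, i)))\<^sup>2)))"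
      using w by (intro sum.cong refl) simp
    also have "\<dots> = of_real (1 / sqrt (real d)) * of_real (y m)"
      unfolding y_def of_real_sum by (simp only: sum_distrib_left)
    finally show ?thesis by (simp only: of_real_mult mult.assoc)
  qed
  have "real s / (real d)\<^sup>2 = (1 / (real s * real d)) * ((\<Sum>m<d. y m)\<^sup>2 / real d)"
    unfolding sy using s d by (simp add: field_simps power2_eq_square)
  also have "\<dots> \<le> (1 / (real s * real d)) * (\<Sum>m<d. (y m)\<^sup>2)"
    using sum_squared_le_sum_of_squares[of y "{..<d}"] d by (intro mult_left_mono) (auto simp: divide_le_eq)
  also have "\<dots> = (\<Sum>m<d. (cmod (?c (m, m)))\<^sup>2)"
    unfolding sum_distrib_left
  proof (intro sum.cong refl)
    fix m assume "m \<in> {..<d}"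
    then have "(cmod (?c (m, m)))\<^sup>2 = (1 / sqrt (real s) * (1 / sqrt (real d)) * y m)\<^sup>2"
      using c[of m] by (simp only: lessThan_iff norm_of_real power2_abs)
    also have "\<dots> = 1 / (real s * real d) * (y m)\<^sup>2"
      by (simp add: power_mult_distrib power_divide)
    finally show "1 / (real s * real d) * (y m)\<^sup>2 = (cmod (?c (m, m)))\<^sup>2" ..
  qed
  also have "\<dots> = (\<Sum>z\<in>(\<lambda>m. (m, m)) ` {..<d}. (cmod (?c z))\<^sup>2)"
    by (subst sum.reindex) (auto simp: inj_on_def)
  also have "\<dots> \<le> (\<Sum>z\<in>{..<d} \<times> {..<d}. (cmod (?c z))\<^sup>2)"
    by (intro sum_mono2) auto
  also have "\<dots> = Re (qform (d * d) (channel_pair d s V (max_entangled s)) (max_entangled_vec d))"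
    unfolding q by simp
  finally show ?thesis .
qed

section \<open>Entropies and output norms\<close>

lemma conj_exp_gt:
  assumes "1 < p"
  shows "1 \<le> conj_exp p" "0 < conj_exp p"
  using assms
proof (atomize (full), cases rule: ereal_gt_1_cases)
  case (2 r)
  then show "1 \<le> conj_exp p \<and> 0 < conj_exp p" by (simp add: conj_exp_def field_simps)
qed (simp add: conj_exp_def)

lemma renyi_entropy_density_nonneg:
  assumes "\<rho> \<in> density_ops n" "1 < p"
  shows "0 \<le> renyi_entropy p \<rho>"
  unfolding schatten_norm_density(3)[OF assms]
  using conj_exp_gt[OF assms(2)] schatten_norm_density(1,2)[OF assms] by (simp add: mult_nonneg_nonpos)

text \<open>The infimum over the reals is meaningful only for a set bounded below, here by
  0.\<close>

lemma min_renyi_entropy_lower: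
  assumes k: "kraus_form n a I K T" and p: "1 < p" and \<phi>: "\<phi> \<in> unit_vectors n"
  shows "min_renyi_entropy p n T \<le> renyi_entropy p (T (ketbra \<phi>))"
  unfolding min_renyi_entropy_def
proof (rule cINF_lower[OF _ \<phi>])
  show "bdd_below ((\<lambda>\<phi>. renyi_entropy p (T (ketbra \<phi>))) ` unit_vectors n)"
    using renyi_entropy_density_nonneg[OF density_ops_kraus[OF k ketbra_density] p] by (intro bdd_belowI2[of _ 0])
qed

lemma unit_vectors_nonempty:
  assumes "1 \<le> n"
  shows "unit_vectors n \<noteq> {}"
proof -
  have "(\<Sum>a<n. (cmod (if a = 0 then 1 else 0))\<^sup>2) = (\<Sum>a<n. if a = 0 then 1 else 0)"
    by (intro sum.cong) auto
  also have "\<dots> = 1" using assms by simp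
  finally have "vec n (\<lambda>a. if a = 0 then 1 else 0) \<in> unit_vectors n" by (simp add: unit_vectors_iff)
  then show ?thesis by blast
qed

lemma max_output_norm_upper:
  assumes k: "kraus_form n a I K T" and p: "1 < p" and \<rho>: "\<rho> \<in> density_ops n"
  shows "schatten_norm p (T \<rho>) \<le> max_output_norm p n T"
  unfolding max_output_norm_def
proof (rule cSUP_upper[OF \<rho>])
  show "bdd_above ((\<lambda>\<rho>. schatten_norm p (T \<rho>)) ` density_ops n)"
    using schatten_norm_density(2)[OF density_ops_kraus[OF k] p] by (intro bdd_aboveI2[of _ _ 1])
qed

text \<open>Entropy bounds are known for pure inputs only; \<open>schatten_norm_kraus_le\<close>
  extends the corresponding norm bound to mixed inputs.\<close>

lemma max_output_norm_le_of_entropy: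
  assumes k: "kraus_form n a I K T" and p: "1 < p" and n: "1 \<le> n"
    and H: "\<And>\<phi>. \<phi> \<in> unit_vectors n \<Longrightarrow> B \<le> renyi_entropy p (T (ketbra \<phi>))"
  shows "max_output_norm p n T \<le> exp (- B / conj_exp p)" "0 \<le> max_output_norm p n T"
proof -
  obtain \<phi> where \<phi>: "\<phi> \<in> unit_vectors n" using unit_vectors_nonempty[OF n] by blast
  have le: "schatten_norm p (T (ketbra \<phi>)) \<le> exp (- B / conj_exp p)" if "\<phi> \<in> unit_vectors n" for \<phi>
  proof -
    note d = density_ops_kraus[OF k ketbra_density[OF that]]
    have "B \<le> - conj_exp p * ln (schatten_norm p (T (ketbra \<phi>)))"
      using H[OF that] schatten_norm_density(3)[OF d p] by simp
    then have "ln (schatten_norm p (T (ketbra \<phi>))) \<le> - B / conj_exp p"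
      using conj_exp_gt[OF p] by (simp add: field_simps)
    then show ?thesis using schatten_norm_density(1)[OF d p] by (metis exp_le_cancel_iff exp_ln)
  qed
  show "max_output_norm p n T \<le> exp (- B / conj_exp p)"
    unfolding max_output_norm_def using ketbra_density[OF \<phi>] schatten_norm_kraus_le[OF k p le]
    by (intro cSUP_least) auto
  show "0 \<le> max_output_norm p n T"
    using max_output_norm_upper[OF k p ketbra_density[OF \<phi>]]
      schatten_norm_density(1)[OF density_ops_kraus[OF k ketbra_density[OF \<phi>]] p] by linarith
qed

lemma eig_dec_map_cnj:
  assumes e: "eig_dec n A u l"
  shows "eig_dec n (map_mat cnj A) (\<lambda>i a. cnj (u i a)) l"
  unfolding eig_dec_def
proof (intro conjI allI impI)
  show "map_mat cnj A \<in> carrier_mat n n" using eig_decD(1)[OF e] by simp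
  show "orthonormal n (\<lambda>i a. cnj (u i a))"
    unfolding orthonormal_def
  proof (intro allI impI)
    fix i j assume ij: "i < n" "j < n"
    have "(\<Sum>a<n. cnj (u i a) * cnj (cnj (u j a))) = (\<Sum>a<n. u j a * cnj (u i a))"
      by (simp add: mult.commute)
    then show "(\<Sum>a<n. cnj (u i a) * cnj (cnj (u j a))) = (if i = j then 1 else 0)"
      using orthonormalD[OF eig_decD(2)[OF e] ij(2,1)] by auto
  qed
  fix a b assume ab: "a < n" "b < n"
  then have "map_mat cnj A $$ (a, b) = cnj (A $$ (a, b))" using eig_decD(1)[OF e] by simp
  then show "map_mat cnj A $$ (a, b) = (\<Sum>i<n. of_real (l i) * (cnj (u i a) * cnj (cnj (u i b))))"
    unfolding eig_decD(3)[OF e ab] by simp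
qed

lemma schatten_norm_map_cnj:
  assumes A: "A \<in> density_ops n" and p: "1 < p"
  shows "schatten_norm p (map_mat cnj A) = schatten_norm p A"
proof -
  obtain u l where e: "eig_dec n A u l" and l: "\<And>i. i < n \<Longrightarrow> 0 \<le> l i" "(\<Sum>i<n. l i) = 1"
    using density_ops_eig_dec[OF A] by blast
  note n = density_ops_dim_pos[OF A]
  have "schatten_norm p A = lp_norm p n l" by (rule schatten_norm_eig_dec[OF e l(1) n p])
  moreover have "schatten_norm p (map_mat cnj A) = lp_norm p n l"
    by (rule schatten_norm_eig_dec[OF eig_dec_map_cnj[OF e] l(1) n p])
  ultimately show ?thesis by simp
qed

text \<open>The conjugate channel at \<open>\<phi>\<close> is the entrywise conjugate of the channel
  at the conjugate of \<open>\<phi>\<close>, and conjugation keeps the spectrum. Hence a lower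
  entropy bound for the channel passes to its conjugate.\<close>

lemma renyi_entropy_conj_channel:
  assumes iso: "isometry_mat (d * d) s V" and p: "1 < p" and \<phi>: "\<phi> \<in> unit_vectors s"
  shows "vec s (\<lambda>i. cnj (\<phi> $ i)) \<in> unit_vectors s"
    "renyi_entropy p (conj_channel d V (ketbra \<phi>)) = renyi_entropy p (channel d V (ketbra (vec s (\<lambda>i. cnj (\<phi> $ i)))))"
proof -
  let ?\<psi> = "vec s (\<lambda>i. cnj (\<phi> $ i))"
  have V: "V \<in> carrier_mat (d * d) s" using iso by (simp add: isometry_mat_def)
  have \<phi>c: "\<phi> \<in> carrier_vec s" using \<phi> by (simp add: unit_vectors_iff)
  show \<psi>: "?\<psi> \<in> unit_vectors s" using \<phi> by (simp add: unit_vectors_iff)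
  have \<psi>c: "?\<psi> \<in> carrier_vec s" by simp
  have D: "channel d V (ketbra ?\<psi>) \<in> density_ops d" "conj_channel d V (ketbra \<phi>) \<in> density_ops d"
    using density_ops_kraus[OF kraus_form_channel[OF iso] ketbra_density[OF \<psi>]]
      density_ops_kraus[OF kraus_form_conj_channel[OF iso] ketbra_density[OF \<phi>]] by auto
  have "conj_channel d V (ketbra \<phi>) = map_mat cnj (channel d V (ketbra ?\<psi>))"
  proof (rule eq_matI)
    have c1: "conj_channel d V (ketbra \<phi>) \<in> carrier_mat d d" and c2: "channel d V (ketbra ?\<psi>) \<in> carrier_mat d d"
      by (auto simp: conj_channel_def channel_def partial_trace_B_def)
    show "dim_row (conj_channel d V (ketbra \<phi>)) = dim_row (map_mat cnj (channel d V (ketbra ?\<psi>)))"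
      "dim_col (conj_channel d V (ketbra \<phi>)) = dim_col (map_mat cnj (channel d V (ketbra ?\<psi>)))"
      using c1 c2 by auto
    fix r c assume "r < dim_row (map_mat cnj (channel d V (ketbra ?\<psi>)))" "c < dim_col (map_mat cnj (channel d V (ketbra ?\<psi>)))"
    then have rc: "r < d" "c < d" using c2 by auto
    have "map_mat cnj (channel d V (ketbra ?\<psi>)) $$ (r, c) = cnj (channel d V (ketbra ?\<psi>) $$ (r, c))"
      using rc c2 by simp
    also have "\<dots> = (\<Sum>m<d. \<Sum>i<s. \<Sum>j<s. cnj (V $$ (r * d + m, i)) * ketbra \<phi> $$ (i, j) * V $$ (c * d + m, j))"
      unfolding index_channel[OF V ketbra_carrier[OF \<psi>c] rc] cnj_sum
      using index_ketbra[OF \<psi>c] index_ketbra[OF \<phi>c] by (intro sum.cong refl) simp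
    finally show "conj_channel d V (ketbra \<phi>) $$ (r, c) = map_mat cnj (channel d V (ketbra ?\<psi>)) $$ (r, c)"
      using index_conj_channel[OF V ketbra_carrier[OF \<phi>c] rc] by simp
  qed
  then show "renyi_entropy p (conj_channel d V (ketbra \<phi>)) = renyi_entropy p (channel d V (ketbra ?\<psi>))"
    unfolding schatten_norm_density(3)[OF D(1) p] schatten_norm_density(3)[OF D(2) p]
    using schatten_norm_map_cnj[OF D(1) p] by simp
qed

text \<open>The entangled input has entropy at most \<open>U\<close>, less than the 2
  \<open>B\<close> guaranteed by the two factors. This holds for every isometry with such bounds,
  which the universally quantified half of the theorem requires.\<close>

lemma multiplicativity_violation:
  assumes iso: "isometry_mat (d * d) s V" and s: "1 \<le> s" and p: "1 < p"
    and B: "B \<le> min_renyi_entropy p s (channel d V)"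
    and U: "renyi_entropy p (channel_pair d s V (max_entangled s)) \<le> U" and UB: "U < 2 * B"
  shows "max_output_norm p s (channel d V) * max_output_norm p s (conj_channel d V) < max_output_norm p (s * s) (channel_pair d s V)"
    and "min_renyi_entropy p (s * s) (channel_pair d s V) < min_renyi_entropy p s (channel d V) + min_renyi_entropy p s (conj_channel d V)"
proof -
  note kc = kraus_form_channel[OF iso] and kcc = kraus_form_conj_channel[OF iso] and kp = kraus_form_channel_pair[OF iso]
  note q = conj_exp_gt(2)[OF p]
  have H1: "B \<le> renyi_entropy p (channel d V (ketbra \<phi>))" if "\<phi> \<in> unit_vectors s" for \<phi>
    using min_renyi_entropy_lower[OF kc p that] B by linarith
  have H2: "B \<le> renyi_entropy p (conj_channel d V (ketbra \<phi>))" if "\<phi> \<in> unit_vectors s" for \<phi>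
    using H1[OF renyi_entropy_conj_channel(1)[OF iso p that]] renyi_entropy_conj_channel(2)[OF iso p that] by simp
  have \<Phi>: "max_entangled s \<in> density_ops (s * s)"
    unfolding max_entangled_alt by (rule ketbra_density[OF max_entangled_unit[OF s]])
  note D = density_ops_kraus[OF kp \<Phi>]
  have "max_output_norm p s (channel d V) * max_output_norm p s (conj_channel d V) \<le> exp (- B / conj_exp p) * exp (- B / conj_exp p)"
    using max_output_norm_le_of_entropy[OF kc p s H1] max_output_norm_le_of_entropy[OF kcc p s H2]
    by (intro mult_mono) auto
  also have "\<dots> = exp (- (2 * B) / conj_exp p)" by (simp add: exp_add[symmetric] add_divide_distrib[symmetric])
  also have "\<dots> < exp (- U / conj_exp p)" using UB q by (simp add: divide_strict_right_mono)
  also have "\<dots> \<le> schatten_norm p (channel_pair d s V (max_entangled s))"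
  proof -
    have "- U / conj_exp p \<le> ln (schatten_norm p (channel_pair d s V (max_entangled s)))"
      using U q unfolding schatten_norm_density(3)[OF D p] by (simp add: field_simps)
    then show ?thesis using schatten_norm_density(1)[OF D p] by (metis exp_le_cancel_iff exp_ln)
  qed
  also have "\<dots> \<le> max_output_norm p (s * s) (channel_pair d s V)" by (rule max_output_norm_upper[OF kp p \<Phi>])
  finally show "max_output_norm p s (channel d V) * max_output_norm p s (conj_channel d V) < max_output_norm p (s * s) (channel_pair d s V)" .
  have "min_renyi_entropy p (s * s) (channel_pair d s V) \<le> U"
    using min_renyi_entropy_lower[OF kp p max_entangled_unit[OF s]] U unfolding max_entangled_alt by linarith
  moreover have "B \<le> min_renyi_entropy p s (conj_channel d V)"
    unfolding min_renyi_entropy_def using unit_vectors_nonempty[OF s] H2 by (intro cINF_greatest) auto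
  ultimately show "min_renyi_entropy p (s * s) (channel_pair d s V) < min_renyi_entropy p s (channel d V) + min_renyi_entropy p s (conj_channel d V)"
    using B UB by linarith
qed

text \<open>The overlap with the maximally entangled output vector bounds the p-norm from below by s
  / d^2.\<close>

lemma renyi_entropy_channel_pair_le:
  assumes iso: "isometry_mat (d * d) s V" and s: "1 \<le> s" and d: "1 \<le> d" and p: "1 < p"
  shows "renyi_entropy p (channel_pair d s V (max_entangled s)) \<le> conj_exp p * ln ((real d)\<^sup>2 / real s)"
proof -
  have \<Phi>: "max_entangled s \<in> density_ops (s * s)"
    unfolding max_entangled_alt by (rule ketbra_density[OF max_entangled_unit[OF s]])
  note D = density_ops_kraus[OF kraus_form_channel_pair[OF iso] \<Phi>]
  have "real s / (real d)\<^sup>2 \<le> schatten_norm p (channel_pair d s V (max_entangled s))"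
    using overlap_channel_pair[OF iso s d] schatten_norm_density(4)[OF D p sum_cmod_max_entangled_vec[OF d]] by linarith
  then have "ln (real s / (real d)\<^sup>2) \<le> ln (schatten_norm p (channel_pair d s V (max_entangled s)))"
    using s d by (subst ln_le_cancel_iff) (auto simp: schatten_norm_density(1)[OF D p])
  moreover have "ln (real s / (real d)\<^sup>2) = - ln ((real d)\<^sup>2 / real s)" using s d by (simp add: ln_div)
  ultimately have "- ln (schatten_norm p (channel_pair d s V (max_entangled s))) \<le> ln ((real d)\<^sup>2 / real s)" by linarith
  then show ?thesis
    unfolding schatten_norm_density(3)[OF D p] using conj_exp_gt(2)[OF p] mult_left_mono by fastforce
qed

section \<open>Existence of the isometry\<close>

definition sign_mat :: "nat \<Rightarrow> (nat \<times> nat \<times> nat \<Rightarrow> real) \<Rightarrow> (nat \<Rightarrow> complex) \<Rightarrow> nat \<Rightarrow> nat \<Rightarrow> complex" where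
  "sign_mat s \<epsilon> x a b = (\<Sum>i<s. of_real (\<epsilon> (i, a, b)) * x i)"

text \<open>\<open>flat_signs\<close> by homogeneity, freed from the normalisation of
  \<open>x\<close>.\<close>

lemma sum_corner_le:
  fixes k :: nat
  assumes fs: "flat_signs s d \<epsilon>" and k: "k \<le> d"
    and u: "\<And>j l. j < k \<Longrightarrow> l < k \<Longrightarrow> (\<Sum>a<d. u j a * cnj (u l a)) = (if j = l then 1 else 0)"
  shows "(\<Sum>j<k. \<Sum>b<d. (cmod (\<Sum>a<d. cnj (u j a) * sign_mat s \<epsilon> x a b))\<^sup>2) \<le> (46 * k * d + 24 * s) * sq_norm {..<s} x"
proof (cases "sq_norm {..<s} x = 0")
  case True
  then have "\<And>i. i < s \<Longrightarrow> x i = 0" unfolding sq_norm_def by (subst (asm) sum_nonneg_eq_0_iff) auto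
  then have "sign_mat s \<epsilon> x a b = 0" for a b by (simp add: sign_mat_def)
  then show ?thesis using True by simp
next
  case False
  then have pos: "0 < sq_norm {..<s} x" by (simp add: less_le)
  define c where "c = 1 / sqrt (sq_norm {..<s} x)"
  have c2: "c\<^sup>2 * sq_norm {..<s} x = 1" using pos by (simp add: c_def power_divide)
  have "sq_norm {..<s} (\<lambda>i. of_real c * x i) = 1"
    using c2 by (simp only: sq_norm_def norm_mult power_mult_distrib norm_of_real power2_abs sum_distrib_left)
  then have "(\<Sum>j<k. \<Sum>b<d. (cmod (\<Sum>a<d. \<Sum>i<s. of_real (\<epsilon> (i, a, b)) * (cnj (u j a) * (of_real c * x i))))\<^sup>2) \<le> 46 * k * d + 24 * s"
    by (rule conjunct2[OF fs[unfolded flat_signs_def], rule_format, OF k]) (rule u)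
  moreover have "(cmod (\<Sum>a<d. \<Sum>i<s. of_real (\<epsilon> (i, a, b)) * (cnj (u j a) * (of_real c * x i))))\<^sup>2 =
      c\<^sup>2 * (cmod (\<Sum>a<d. cnj (u j a) * sign_mat s \<epsilon> x a b))\<^sup>2" for j b
  proof -
    have "(\<Sum>a<d. \<Sum>i<s. of_real (\<epsilon> (i, a, b)) * (cnj (u j a) * (of_real c * x i))) = of_real c * (\<Sum>a<d. cnj (u j a) * sign_mat s \<epsilon> x a b)"
      unfolding sign_mat_def sum_distrib_left by (intro sum.cong refl) (simp only: mult_ac)
    then show ?thesis by (simp only: norm_mult power_mult_distrib norm_of_real power2_abs)
  qed
  ultimately have "c\<^sup>2 * (\<Sum>j<k. \<Sum>b<d. (cmod (\<Sum>a<d. cnj (u j a) * sign_mat s \<epsilon> x a b))\<^sup>2) \<le> 46 * k * d + 24 * s"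
    by (simp only: sum_distrib_left)
  then have "(c\<^sup>2 * (\<Sum>j<k. \<Sum>b<d. (cmod (\<Sum>a<d. cnj (u j a) * sign_mat s \<epsilon> x a b))\<^sup>2)) * sq_norm {..<s} x \<le> (46 * k * d + 24 * s) * sq_norm {..<s} x"
    using pos by (intro mult_right_mono) auto
  moreover have "(c\<^sup>2 * S) * sq_norm {..<s} x = S" for S
    using c2 by (metis mult.commute mult.left_commute mult_1_right)
  ultimately show ?thesis by simp
qed

text \<open>The Hilbert-Schmidt product of sign matrices is the form of their Gram matrix, so its
  eigenvectors are mapped to orthogonal matrices with squared norm the eigenvalue.\<close>

lemma sum_inner_sign_mat:
  assumes e: "eig_dec s (mat s s (\<lambda>(i, j). of_real (\<Sum>a<d. \<Sum>b<d. \<epsilon> (i, a, b) * \<epsilon> (j, a, b)))) e \<mu>"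
    and mn: "m < s" "n < s"
  shows "(\<Sum>a<d. \<Sum>b<d. cnj (sign_mat s \<epsilon> (e m) a b) * sign_mat s \<epsilon> (e n) a b) = (if m = n then of_real (\<mu> m) else 0)"
proof -
  let ?G = "\<lambda>a b i j. of_real (\<epsilon> (i, a, b) * \<epsilon> (j, a, b)) * (cnj (e m i) * e n j)"
  let ?H = "mat s s (\<lambda>(i, j). complex_of_real (\<Sum>a<d. \<Sum>b<d. \<epsilon> (i, a, b) * \<epsilon> (j, a, b)))"
  have "(\<Sum>a<d. \<Sum>b<d. cnj (sign_mat s \<epsilon> (e m) a b) * sign_mat s \<epsilon> (e n) a b)
     = (\<Sum>a<d. \<Sum>b<d. \<Sum>i<s. \<Sum>j<s. ?G a b i j)"
    unfolding sign_mat_def cnj_sum sum_product by (simp add: mult_ac)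
  also have "\<dots> = (\<Sum>a<d. \<Sum>i<s. \<Sum>b<d. \<Sum>j<s. ?G a b i j)"
    by (rule sum.cong[OF refl], rule sum.swap)
  also have "\<dots> = (\<Sum>i<s. \<Sum>a<d. \<Sum>b<d. \<Sum>j<s. ?G a b i j)"
    by (rule sum.swap)
  also have "\<dots> = (\<Sum>i<s. \<Sum>a<d. \<Sum>j<s. \<Sum>b<d. ?G a b i j)"
    by (rule sum.cong[OF refl], rule sum.cong[OF refl], rule sum.swap)
  also have "\<dots> = (\<Sum>i<s. \<Sum>j<s. \<Sum>a<d. \<Sum>b<d. ?G a b i j)"
    by (rule sum.cong[OF refl], rule sum.swap)
  also have "\<dots> = (\<Sum>i<s. \<Sum>j<s. cnj (e m i) * (?H $$ (i, j) * e n j))"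
  proof (intro sum.cong refl)
    fix i j assume ij: "i \<in> {..<s}" "j \<in> {..<s}"
    have "(\<Sum>a<d. \<Sum>b<d. of_real (\<epsilon> (i, a, b) * \<epsilon> (j, a, b)) * (cnj (e m i) * e n j)) = ?H $$ (i, j) * (cnj (e m i) * e n j)"
      using ij by (simp add: sum_distrib_right)
    then show "(\<Sum>a<d. \<Sum>b<d. of_real (\<epsilon> (i, a, b) * \<epsilon> (j, a, b)) * (cnj (e m i) * e n j)) = cnj (e m i) * (?H $$ (i, j) * e n j)"
      by (simp only: mult_ac)
  qed
  also have "\<dots> = (\<Sum>i<s. cnj (e m i) * (\<Sum>j<s. ?H $$ (i, j) * e n j))" by (simp only: sum_distrib_left)
  also have "\<dots> = (\<Sum>i<s. cnj (e m i) * (of_real (\<mu> n) * e n i))"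
    using eig_dec_right[OF e mn(2)] by (intro sum.cong refl) simp
  also have "\<dots> = of_real (\<mu> n) * (\<Sum>i<s. e n i * cnj (e m i))"
    unfolding sum_distrib_left by (intro sum.cong refl) (simp only: mult_ac)
  also have "\<dots> = (if m = n then of_real (\<mu> m) else 0)"
    using orthonormalD[OF eig_decD(2)[OF e] mn(2,1)] by auto
  finally show ?thesis .
qed

text \<open>
  The Gram matrix of the sign matrices has trace \<open>s d\<^sup>2\<close> and eigenvalues at most \<open>70 d\<^sup>2\<close>, so at
  least \<open>s/350\<close> of them are at least \<open>4 d\<^sup>2/5\<close>; the normalised images of the corresponding
  eigenvectors are the columns of \<open>V\<close>.
\<close>

theorem ex_isometry_flat_outputs:
  fixes s d :: nat
  assumes s: "1 \<le> s" and d: "1 \<le> d" and sd: "s \<le> d * d"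
  shows "\<exists>n V. s \<le> 350 * n \<and> isometry_mat (d * d) n V \<and>
    (\<forall>\<phi>\<in>unit_vectors n. \<forall>u l. eig_dec d (channel d V (ketbra \<phi>)) u l \<longrightarrow>
       (\<Sum>j\<in>{j. j < d \<and> 60 / d < l j}. l j) \<le> 720 * (s / (real d)\<^sup>2))"
proof -
  obtain \<epsilon> where fs: "flat_signs s d \<epsilon>" using ex_flat_signs[OF s d] by blast
  have signs: "\<epsilon> (i, a, b) \<in> {-1, 1}" if "i < s" "a < d" "b < d" for i a b
    using conjunct1[OF fs[unfolded flat_signs_def]] that by blast
  note corner = sum_corner_le[OF fs]
  define H where "H = mat s s (\<lambda>(i, j). complex_of_real (\<Sum>a<d. \<Sum>b<d. \<epsilon> (i, a, b) * \<epsilon> (j, a, b)))"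
  have Hc: "H \<in> carrier_mat s s" by (simp add: H_def)
  have "H $$ (i, j) = cnj (H $$ (j, i))" if "i < s" "j < s" for i j
    using that by (simp add: H_def mult.commute)
  then obtain e \<mu> where e: "eig_dec s H e \<mu>" using ex_eig_dec[OF Hc] by blast
  note inner = sum_inner_sign_mat[OF e[unfolded H_def]]
  have d0: "0 < real d" using d by simp
  have trace: "(\<Sum>m<s. \<mu> m) = s * (d * d)"
  proof -
    have "complex_of_real (\<Sum>m<s. \<mu> m) = mat_trace H" using eig_dec_trace[OF e] by simp
    also have "\<dots> = (\<Sum>i<s. of_real (\<Sum>a<d. \<Sum>b<d. \<epsilon> (i, a, b) * \<epsilon> (i, a, b)))"
      by (simp add: mat_trace_def H_def)
    also have "\<dots> = (\<Sum>i<s. of_real (\<Sum>a<d. \<Sum>b<d. 1))"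
    proof (intro sum.cong refl arg_cong[where f = of_real])
      fix i a b assume "i \<in> {..<s}" "a \<in> {..<d}" "b \<in> {..<d}"
      then show "\<epsilon> (i, a, b) * \<epsilon> (i, a, b) = 1" using signs[of i a b] by auto
    qed
    also have "\<dots> = complex_of_real (s * (d * d))" by simp
    finally show ?thesis using of_real_eq_iff by blast
  qed
  \<comment> \<open>The case \<open>k = d\<close> with the standard basis captures the whole
    Frobenius norm: 46 d^2 + 24 s \<le> 70 d^2.\<close>
  have \<mu>_le: "\<mu> m \<le> 70 * (real d * real d)" if m: "m < s" for m
  proof -
    have "complex_of_real (\<mu> m) = (\<Sum>a<d. \<Sum>b<d. cnj (sign_mat s \<epsilon> (e m) a b) * sign_mat s \<epsilon> (e m) a b)"
      using inner[OF m m] by simp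
    also have "\<dots> = complex_of_real (\<Sum>a<d. \<Sum>b<d. (cmod (sign_mat s \<epsilon> (e m) a b))\<^sup>2)"
      unfolding of_real_sum complex_norm_square by (simp only: mult.commute)
    finally have \<mu>: "\<mu> m = (\<Sum>a<d. \<Sum>b<d. (cmod (sign_mat s \<epsilon> (e m) a b))\<^sup>2)" using of_real_eq_iff by blast
    let ?u = "\<lambda>j a. if a = j then 1 else (0 :: complex)"
    have one: "sq_norm {..<s} (e m) = 1"
      unfolding sq_norm_def by (rule sum_cmod_orthonormal[OF eig_decD(2)[OF e] m])
    have "(\<Sum>j<d. \<Sum>b<d. (cmod (\<Sum>a<d. cnj (?u j a) * sign_mat s \<epsilon> (e m) a b))\<^sup>2) \<le> (46 * d * d + 24 * s) * sq_norm {..<s} (e m)"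
    proof (rule corner)
      fix j l assume jl: "j < d" "l < d"
      have "(\<Sum>a<d. ?u j a * cnj (?u l a)) = (\<Sum>a<d. (if a = j then 1 else 0) * (if a = l then 1 else 0))"
        by (intro sum.cong) auto
      also have "\<dots> = (if j = l then 1 else 0)" using sum_delta_mult(3)[OF jl(1), of "\<lambda>a. if a = l then 1 else 0"] by simp
      finally show "(\<Sum>a<d. ?u j a * cnj (?u l a)) = (if j = l then 1 else 0)" .
    qed simp_all
    moreover have "(\<Sum>a<d. cnj (?u j a) * sign_mat s \<epsilon> (e m) a b) = sign_mat s \<epsilon> (e m) j b" if "j < d" for j b
    proof -
      have "(\<Sum>a<d. cnj (?u j a) * sign_mat s \<epsilon> (e m) a b) = (\<Sum>a<d. (if a = j then 1 else 0) * sign_mat s \<epsilon> (e m) a b)"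
        by (intro sum.cong) auto
      then show ?thesis using sum_delta_mult(3)[OF that] by simp
    qed
    ultimately have "\<mu> m \<le> 46 * d * d + 24 * s" unfolding \<mu> one by simp
    also have "\<dots> \<le> 70 * (real d * real d)" using of_nat_mono[OF sd, where ?'a = real] by simp
    finally show ?thesis .
  qed
  \<comment> \<open>A threshold nearer to 1 would reduce the normalisation loss 5/4 at the expense
    of fewer eigenvectors. With 4/5 the trace gives s \<le> 70 n + 4/5 s.\<close>
  define J where "J = {m. m < s \<and> 4 / 5 * (real d * real d) \<le> \<mu> m}"
  define n where "n = card J"
  have J: "finite J" "J \<subseteq> {..<s}" by (auto simp: J_def)
  have "real s * (real d * real d) = (\<Sum>m<s. \<mu> m)" using trace by simp
  also have "\<dots> = (\<Sum>m\<in>J. \<mu> m) + (\<Sum>m\<in>{..<s} - J. \<mu> m)"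
    using J by (subst sum.subset_diff[OF J(2)]) simp_all
  also have "\<dots> \<le> (\<Sum>m\<in>J. 70 * (real d * real d)) + (\<Sum>m\<in>{..<s} - J. 4 / 5 * (real d * real d))"
    using J(2) \<mu>_le by (intro add_mono sum_mono) (auto simp: J_def)
  also have "\<dots> \<le> n * (70 * (real d * real d)) + s * (4 / 5 * (real d * real d))"
  proof -
    have "card ({..<s} - J) \<le> s" using card_mono[of "{..<s}" "{..<s} - J"] by simp
    then have "card ({..<s} - J) * (4 / 5 * (real d * real d)) \<le> s * (4 / 5 * (real d * real d))"
      by (intro mult_right_mono) auto
    then show ?thesis unfolding n_def by (simp only: sum_constant)
  qed
  finally have "real s * (real d * real d) \<le> (70 * real n + 4 / 5 * s) * (real d * real d)" by (simp add: algebra_simps)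
  then have "real s \<le> 70 * real n + 4 / 5 * s" using d0 by simp
  then have "real s \<le> real (350 * n)" by simp
  then have sn: "s \<le> 350 * n" by (simp only: of_nat_le_iff)
  obtain f where f: "bij_betw f {..<n} J" using ex_bij_betw_nat_finite[OF J(1)] by (auto simp: n_def lessThan_atLeast0)
  have fJ: "f m < s" "4 / 5 * (real d * real d) \<le> \<mu> (f m)" if "m < n" for m
    using bij_betwE[OF f] that by (auto simp: J_def)
  have finj: "f m = f m' \<longleftrightarrow> m = m'" if "m < n" "m' < n" for m m'
    using bij_betw_imp_inj_on[OF f] that by (auto simp: inj_on_def)
  have \<mu>pos: "0 < \<mu> (f m)" if "m < n" for m using fJ(2)[OF that] d0 by (smt (verit) mult_pos_pos divide_pos_pos)
  define W where "W = (\<lambda>m a b. of_real (1 / sqrt (\<mu> (f m))) * sign_mat s \<epsilon> (e (f m)) a b)"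
  define V where "V = mat (d * d) n (\<lambda>(t, m). W m (t div d) (t mod d))"
  have Vc: "V \<in> carrier_mat (d * d) n" by (simp add: V_def)
  have lt: "a * d + b < d * d" if "a < d" "b < d" for a b using that by (simp add: mult_add_less)
  have Vi: "V $$ (a * d + b, m) = W m a b" if "a < d" "b < d" "m < n" for a b m
    using that lt by (simp add: V_def)
  have iso: "isometry_mat (d * d) n V"
    unfolding isometry_mat_def
  proof (intro conjI Vc eq_matI)
    have ac: "mat_adjoint V \<in> carrier_mat n (d * d)" by (rule mat_adjoint_carrier[OF Vc])
    show "dim_row (mat_adjoint V * V) = dim_row (1\<^sub>m n)" "dim_col (mat_adjoint V * V) = dim_col (1\<^sub>m n)"
      using ac Vc by auto
    fix i j assume "i < dim_row (1\<^sub>m n :: complex mat)" "j < dim_col (1\<^sub>m n :: complex mat)"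
    then have ij: "i < n" "j < n" by auto
    have "(mat_adjoint V * V) $$ (i, j) = (\<Sum>t<d * d. mat_adjoint V $$ (i, t) * V $$ (t, j))"
      by (rule index_mult_mat_lessThan[OF ac Vc ij])
    also have "\<dots> = (\<Sum>t<d * d. cnj (W i (t div d) (t mod d)) * W j (t div d) (t mod d))"
      using Vc ij by (intro sum.cong refl) (simp add: V_def)
    also have "\<dots> = (\<Sum>a<d. \<Sum>b<d. cnj (W i a b) * W j a b)" by (rule sum_div_mod)
    also have "\<dots> = of_real (1 / sqrt (\<mu> (f i)) * (1 / sqrt (\<mu> (f j)))) * (\<Sum>a<d. \<Sum>b<d. cnj (sign_mat s \<epsilon> (e (f i)) a b) * sign_mat s \<epsilon> (e (f j)) a b)"
      unfolding W_def sum_distrib_left by (intro sum.cong refl) (simp add: mult_ac)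
    also have "\<dots> = (if i = j then 1 else 0)"
    proof (cases "i = j")
      case True
      have "(1 / sqrt (\<mu> (f i)) * (1 / sqrt (\<mu> (f i)))) * \<mu> (f i) = 1" using \<mu>pos[OF ij(1)] by simp
      then have "complex_of_real (1 / sqrt (\<mu> (f i)) * (1 / sqrt (\<mu> (f i)))) * of_real (\<mu> (f i)) = 1"
        by (simp only: of_real_mult[symmetric] of_real_1)
      then show ?thesis
        unfolding True[symmetric] inner[OF fJ(1)[OF ij(1)] fJ(1)[OF ij(1)]] by (simp only: refl if_True)
    next
      case False
      then show ?thesis unfolding inner[OF fJ(1)[OF ij(1)] fJ(1)[OF ij(2)]] using finj[OF ij] by simp
    qed
    finally show "(mat_adjoint V * V) $$ (i, j) = 1\<^sub>m n $$ (i, j)" using ij by simp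
  qed
  have "(\<Sum>j\<in>{j. j < d \<and> 60 / d < l j}. l j) \<le> 720 * (s / (real d)\<^sup>2)"
    if \<phi>: "\<phi> \<in> unit_vectors n" and ul: "eig_dec d (channel d V (ketbra \<phi>)) u l" for \<phi> u l
  proof -
    have \<phi>c: "\<phi> \<in> carrier_vec n" and \<phi>1: "(\<Sum>m<n. (cmod (\<phi> $ m))\<^sup>2) = 1" using \<phi> by (auto simp: unit_vectors_iff)
    define y where "y = (\<lambda>m. \<phi> $ m * of_real (1 / sqrt (\<mu> (f m))))"
    \<comment> \<open>The coefficient vector for which V \<phi>, read as a d x d matrix, is the sign
      matrix of \<open>x\<close>. The output state is then this matrix times its adjoint, and its
      eigenvalues are the amounts captured by single eigenvectors.\<close>
    define x where "x = (\<lambda>i. \<Sum>m<n. y m * e (f m) i)"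
    have Mx: "sign_mat s \<epsilon> x a b = (\<Sum>m<n. W m a b * \<phi> $ m)" for a b
    proof -
      have "sign_mat s \<epsilon> x a b = (\<Sum>i<s. \<Sum>m<n. y m * (of_real (\<epsilon> (i, a, b)) * e (f m) i))"
        unfolding sign_mat_def x_def sum_distrib_left by (intro sum.cong refl) (simp only: mult_ac)
      also have "\<dots> = (\<Sum>m<n. \<Sum>i<s. y m * (of_real (\<epsilon> (i, a, b)) * e (f m) i))" by (rule sum.swap)
      also have "\<dots> = (\<Sum>m<n. y m * sign_mat s \<epsilon> (e (f m)) a b)"
        unfolding sign_mat_def by (simp only: sum_distrib_left)
      also have "\<dots> = (\<Sum>m<n. W m a b * \<phi> $ m)"
        unfolding y_def W_def by (intro sum.cong refl) (simp only: mult_ac)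
      finally show ?thesis .
    qed
    have xn: "sq_norm {..<s} x \<le> 5 / (4 * (real d * real d))"
    proof -
  let ?G = "\<lambda>m m' i. (y m * cnj (y m')) * (e (f m) i * cnj (e (f m') i))"
      have "complex_of_real (sq_norm {..<s} x) = (\<Sum>i<s. \<Sum>m<n. \<Sum>m'<n. ?G m m' i)"
        unfolding sq_norm_def of_real_sum complex_norm_square x_def cnj_sum sum_product by (simp add: mult_ac)
      also have "\<dots> = (\<Sum>m<n. \<Sum>i<s. \<Sum>m'<n. ?G m m' i)"
        by (rule sum.swap)
      also have "\<dots> = (\<Sum>m<n. \<Sum>m'<n. \<Sum>i<s. ?G m m' i)"
        by (rule sum.cong[OF refl], rule sum.swap)
      also have "\<dots> = (\<Sum>m<n. \<Sum>m'<n. (y m * cnj (y m')) * (if m = m' then 1 else 0))"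
      proof (intro sum.cong refl)
        fix m m' assume "m \<in> {..<n}" "m' \<in> {..<n}"
        then have "(\<Sum>i<s. e (f m) i * cnj (e (f m') i)) = (if m = m' then 1 else 0)"
          using orthonormalD[OF eig_decD(2)[OF e] fJ(1) fJ(1)] finj by simp
        then show "(\<Sum>i<s. (y m * cnj (y m')) * (e (f m) i * cnj (e (f m') i))) = (y m * cnj (y m')) * (if m = m' then 1 else 0)"
          by (simp only: sum_distrib_left[symmetric])
      qed
      also have "\<dots> = (\<Sum>m<n. y m * cnj (y m))"
        by (intro sum.cong refl sum_delta_mult(2)) simp
      also have "\<dots> = complex_of_real (\<Sum>m<n. (cmod (y m))\<^sup>2)"
        unfolding of_real_sum complex_norm_square ..
      finally have "sq_norm {..<s} x = (\<Sum>m<n. (cmod (y m))\<^sup>2)" using of_real_eq_iff by blast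
      also have "\<dots> \<le> (\<Sum>m<n. 5 / (4 * (real d * real d)) * (cmod (\<phi> $ m))\<^sup>2)"
      proof (rule sum_mono)
        fix m assume "m \<in> {..<n}"
        then have m: "m < n" by simp
        have "(cmod (y m))\<^sup>2 = 1 / \<mu> (f m) * (cmod (\<phi> $ m))\<^sup>2"
          unfolding y_def norm_mult power_mult_distrib norm_of_real power2_abs using \<mu>pos[OF m] by (simp add: power_divide)
        also have "1 / \<mu> (f m) \<le> 1 / (4 / 5 * (real d * real d))"
          using fJ(2)[OF m] \<mu>pos[OF m] d0 by (intro divide_left_mono mult_pos_pos) auto
        finally show "(cmod (y m))\<^sup>2 \<le> 5 / (4 * (real d * real d)) * (cmod (\<phi> $ m))\<^sup>2"
          by (simp add: mult_right_mono)
      qed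
      also have "\<dots> = 5 / (4 * (real d * real d))" unfolding sum_distrib_left[symmetric] \<phi>1 by simp
      finally show ?thesis .
    qed
    have chan: "channel d V (ketbra \<phi>) $$ (r, c) = (\<Sum>b<d. sign_mat s \<epsilon> x r b * cnj (sign_mat s \<epsilon> x c b))" if rc: "r < d" "c < d" for r c
    proof -
      have "channel d V (ketbra \<phi>) $$ (r, c) = (\<Sum>b<d. \<Sum>i<n. \<Sum>j<n. (W i r b * \<phi> $ i) * (cnj (W j c b) * cnj (\<phi> $ j)))"
        unfolding index_channel[OF Vc ketbra_carrier[OF \<phi>c] rc]
      proof (intro sum.cong refl)
        fix b i j assume "b \<in> {..<d}" "i \<in> {..<n}" "j \<in> {..<n}"
        then have eqs: "V $$ (r * d + b, i) = W i r b" "V $$ (c * d + b, j) = W j c b" "ketbra \<phi> $$ (i, j) = \<phi> $ i * cnj (\<phi> $ j)"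
          using Vi rc index_ketbra[OF \<phi>c] by auto
        show "V $$ (r * d + b, i) * ketbra \<phi> $$ (i, j) * cnj (V $$ (c * d + b, j)) = (W i r b * \<phi> $ i) * (cnj (W j c b) * cnj (\<phi> $ j))"
          unfolding eqs by (simp only: mult_ac)
      qed
      then show ?thesis unfolding Mx cnj_sum sum_product by simp
    qed
    have lj: "l j = (\<Sum>b<d. (cmod (\<Sum>a<d. cnj (u j a) * sign_mat s \<epsilon> x a b))\<^sup>2)" if j: "j < d" for j
    proof -
  let ?G = "\<lambda>r c b. (cnj (u j r) * sign_mat s \<epsilon> x r b) * (u j c * cnj (sign_mat s \<epsilon> x c b))"
      have "complex_of_real (l j) = qform d (channel d V (ketbra \<phi>)) (u j)" using qform_eigenvector[OF ul j] by simp
      also have "\<dots> = (\<Sum>r<d. \<Sum>c<d. \<Sum>b<d. ?G r c b)"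
        unfolding qform_def by (intro sum.cong refl) (simp add: chan sum_distrib_left sum_distrib_right mult_ac)
      also have "\<dots> = (\<Sum>r<d. \<Sum>b<d. \<Sum>c<d. ?G r c b)"
        by (rule sum.cong[OF refl], rule sum.swap)
      also have "\<dots> = (\<Sum>b<d. \<Sum>r<d. \<Sum>c<d. ?G r c b)"
        by (rule sum.swap)
      also have "\<dots> = (\<Sum>b<d. (\<Sum>a<d. cnj (u j a) * sign_mat s \<epsilon> x a b) * cnj (\<Sum>a<d. cnj (u j a) * sign_mat s \<epsilon> x a b))"
        unfolding cnj_sum sum_product by simp
      also have "\<dots> = complex_of_real (\<Sum>b<d. (cmod (\<Sum>a<d. cnj (u j a) * sign_mat s \<epsilon> x a b))\<^sup>2)"
        unfolding of_real_sum complex_norm_square ..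
      finally show ?thesis using of_real_eq_iff by blast
    qed
    define J' where "J' = {j. j < d \<and> 60 / d < l j}"
    define k where "k = card J'"
    have J': "finite J'" "J' \<subseteq> {..<d}" by (auto simp: J'_def)
    have kd: "k \<le> d" unfolding k_def using card_mono[OF _ J'(2)] by simp
    obtain h where h: "bij_betw h {..<k} J'" using ex_bij_betw_nat_finite[OF J'(1)] by (auto simp: k_def lessThan_atLeast0)
    have hd: "h j < d" if "j < k" for j using bij_betwE[OF h] that by (auto simp: J'_def)
    have hinj: "h j = h j' \<longleftrightarrow> j = j'" if "j < k" "j' < k" for j j'
      using bij_betw_imp_inj_on[OF h] that by (auto simp: inj_on_def)
    define S where "S = (\<Sum>j\<in>J'. l j)"
    have "S = (\<Sum>j<k. l (h j))" unfolding S_def by (rule sum.reindex_bij_betw[OF h, symmetric])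
    also have "\<dots> = (\<Sum>j<k. \<Sum>b<d. (cmod (\<Sum>a<d. cnj (u (h j) a) * sign_mat s \<epsilon> x a b))\<^sup>2)"
      using lj hd by (intro sum.cong refl) simp
    also have "\<dots> \<le> (46 * k * d + 24 * s) * sq_norm {..<s} x"
    proof (rule corner[OF kd])
      fix j j' assume jj: "j < k" "j' < k"
      show "(\<Sum>a<d. u (h j) a * cnj (u (h j') a)) = (if j = j' then 1 else 0)"
        using orthonormalD[OF eig_decD(2)[OF ul] hd[OF jj(1)] hd[OF jj(2)]] hinj[OF jj] by simp
    qed
    also have "\<dots> \<le> (46 * k * d + 24 * s) * (5 / (4 * (real d * real d)))"
      using xn by (intro mult_left_mono) auto
    also have "\<dots> = 115 / 120 * (k * (60 / d)) + 30 * (s / (real d)\<^sup>2)"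
      using d0 by (simp add: field_simps power2_eq_square)
    finally have S1: "S \<le> 115 / 120 * (k * (60 / d)) + 30 * (s / (real d)\<^sup>2)" .
    \<comment> \<open>Self-absorption: 46 * 5/4 = 57.5 is 115/120 of 60, and each eigenvalue counted
      exceeds 60/d. The \<open>k\<close> term is thus at most 115/120 of \<open>S\<close>, leaving
      S/24 \<le> 30 s/d^2.\<close>
    have "k * (60 / d) = (\<Sum>j\<in>J'. 60 / real d)" by (simp add: k_def)
    also have "\<dots> \<le> S" unfolding S_def by (intro sum_mono) (auto simp: J'_def)
    finally have "S \<le> 720 * (s / (real d)\<^sup>2)" using S1 by linarith
    then show ?thesis by (simp add: S_def J'_def)
  qed
  then show ?thesis using sn iso by blast
qed

section \<open>Numerical estimates and choice of the dimension\<close>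

lemma one_minus_inverse_le_ln:
  fixes x :: real
  assumes "0 < x"
  shows "1 - inverse x \<le> ln x"
proof -
  have "ln (inverse x) \<le> inverse x - 1" using assms by (intro ln_le_minus_one) auto
  then show ?thesis using assms by (simp add: ln_inverse)
qed

text \<open>Eigenvalues up to 60/d contribute at most (60/d)^(r-1) since the total mass is 1; the
  others contribute at most S^r, with \<open>S\<close> their total. For infinite \<open>p\<close>,
  an eigenvalue above 64/d would already exceed the bound 1/(25 d) on \<open>S\<close>.\<close>

lemma lp_norm_flat_le:
  fixes l :: "nat \<Rightarrow> real"
  assumes l: "\<And>i. i < d \<Longrightarrow> 0 \<le> l i" and s: "(\<Sum>i<d. l i) = 1" and p: "1 < p" and d: "1 \<le> d"
    and big: "(\<Sum>j\<in>{j. j < d \<and> 60 / d < l j}. l j) \<le> 1 / (25 * conj_exp p) * real d powr (- (1 / conj_exp p))"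
  shows "lp_norm p d l \<le> (64 / d) powr (1 / conj_exp p)"
proof -
  define J where "J = {j. j < d \<and> 60 / d < l j}"
  define S where "S = (\<Sum>j\<in>J. l j)"
  have J: "finite J" "J \<subseteq> {..<d}" by (auto simp: J_def)
  have d0: "0 < real d" using d by simp
  have lS: "l j \<le> S" if "j \<in> J" for j
    unfolding S_def using that J l by (intro member_le_sum) (auto simp: J_def)
  have S0: "0 \<le> S" unfolding S_def using l J(2) by (intro sum_nonneg) auto
  have bigS: "S \<le> 1 / (25 * conj_exp p) * real d powr (- (1 / conj_exp p))" using big by (simp add: S_def J_def)
  show ?thesis
    using p
  proof (cases rule: ereal_gt_1_cases)
    case 1
    then have q: "conj_exp p = 1" by (simp add: conj_exp_def)
    have "l j \<le> 64 / d" if j: "j < d" for j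
    proof (rule ccontr)
      assume "\<not> l j \<le> 64 / d"
      then have gt: "64 / d < l j" by simp
      moreover have "60 / real d \<le> 64 / d" using d0 by (simp add: divide_right_mono)
      ultimately have "j \<in> J" using j by (simp add: J_def)
      then have "l j \<le> 1 / 25 * real d powr (- 1)" using lS bigS unfolding q by fastforce
      also have "real d powr (- 1) = 1 / real d" using d0 by (simp add: powr_minus divide_inverse)
      finally have "l j \<le> (1 / 25) / d" by simp
      moreover have "(1 / 25) / real d \<le> 64 / d" using d0 by (intro divide_right_mono) auto
      ultimately show False using gt by linarith
    qed
    then have "Max (l ` {..<d}) \<le> 64 / d" using d by (subst Max_le_iff) (auto simp: lessThan_empty_iff)
    then show ?thesis using 1 q d0 by (simp add: lp_norm_def)
  next
    case (2 r)
    have q: "conj_exp p = r / (r - 1)" using 2 by (simp add: conj_exp_def)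
    have r: "1 < r" by (rule 2(2))
    have out: "(\<Sum>i\<in>{..<d} - J. l i powr r) \<le> (60 / d) powr (r - 1)"
    proof -
      have "(\<Sum>i\<in>{..<d} - J. l i powr r) \<le> (\<Sum>i\<in>{..<d} - J. (60 / d) powr (r - 1) * l i)"
      proof (rule sum_mono)
        fix i assume "i \<in> {..<d} - J"
        then have i: "0 \<le> l i" "l i \<le> 60 / d" using l by (auto simp: J_def)
        have "l i powr r = l i powr (r - 1) * l i" using powr_mult_base[OF i(1), of "r - 1"] by (simp add: mult.commute)
        also have "\<dots> \<le> (60 / d) powr (r - 1) * l i" using i r by (intro mult_right_mono powr_mono2) auto
        finally show "l i powr r \<le> (60 / d) powr (r - 1) * l i" .
      qed
      also have "\<dots> \<le> (60 / d) powr (r - 1) * (\<Sum>i<d. l i)"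
        unfolding sum_distrib_left[symmetric] using l by (intro mult_left_mono sum_mono2) auto
      finally show ?thesis using s by simp
    qed
    have inn: "(\<Sum>i\<in>J. l i powr r) \<le> S powr r"
    proof -
      have "(\<Sum>i\<in>J. l i powr r) \<le> (\<Sum>i\<in>J. S powr (r - 1) * l i)"
      proof (rule sum_mono)
        fix i assume i: "i \<in> J"
        then have i0: "0 \<le> l i" using l by (auto simp: J_def)
        have "l i powr r = l i powr (r - 1) * l i" using powr_mult_base[OF i0, of "r - 1"] by (simp add: mult.commute)
        also have "\<dots> \<le> S powr (r - 1) * l i" using i0 r lS[OF i] by (intro mult_right_mono powr_mono2) auto
        finally show "l i powr r \<le> S powr (r - 1) * l i" .
      qed
      also have "\<dots> = S powr (r - 1) * S" by (simp add: S_def sum_distrib_left)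
      also have "\<dots> = S powr r" using powr_mult_base[OF S0, of "r - 1"] by (simp add: mult.commute)
      finally show ?thesis .
    qed
    \<comment> \<open>This equals (r-1)/(25 r). Being at most 1, it does not grow under the power r,
      and the factor r-1 survives.\<close>
    let ?t = "1 / (25 * conj_exp p)"
    have t: "0 \<le> ?t" "?t \<le> 1" "?t \<le> (r - 1) / 25"
    proof -
      have t_eq: "?t = (r - 1) / (25 * r)" using r by (simp add: q)
      show "0 \<le> ?t" "?t \<le> 1" unfolding t_eq using r by (auto simp: divide_le_eq)
      show "?t \<le> (r - 1) / 25" unfolding t_eq using r by (intro divide_left_mono) auto
    qed
    have "S powr r \<le> (?t * real d powr (- (1 / conj_exp p))) powr r"
      using bigS S0 r by (intro powr_mono2) auto
    also have "\<dots> = ?t powr r * real d powr (- (r - 1))"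
      unfolding powr_mult powr_powr using r by (simp add: q)
    also have "\<dots> \<le> (r - 1) / 25 * real d powr (- (r - 1))"
    proof (rule mult_right_mono)
      have "?t powr r \<le> ?t powr 1" using t r by (intro powr_mono') auto
      also have "\<dots> = ?t" using t by simp
      finally show "?t powr r \<le> (r - 1) / 25" using t(3) by linarith
    qed simp
    finally have Sr: "S powr r \<le> (r - 1) / 25 * real d powr (- (r - 1))" .
    \<comment> \<open>Dividing by 60^(r-1), which is at least 1, leaves 1 + (r-1)/25 \<le>
      (16/15)^(r-1), valid as ln(16/15) \<ge> 1/16.\<close>
    have key: "60 powr (r - 1) + (r - 1) / 25 \<le> (64 :: real) powr (r - 1)"
    proof -
      have "1 - inverse (16 / 15) \<le> ln (16 / 15 :: real)" by (rule one_minus_inverse_le_ln) simp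
      then have ln: "1 / 16 \<le> ln (16 / 15 :: real)" by simp
      have "1 + (r - 1) / 25 \<le> 1 + (r - 1) * ln (16 / 15)" using r ln mult_left_mono[of "1 / 25" "ln (16 / 15)" "r - 1"] by simp
      also have "\<dots> \<le> exp ((r - 1) * ln (16 / 15))" by (rule exp_ge_add_one_self)
      also have "\<dots> = (16 / 15) powr (r - 1)" by (simp add: powr_def)
      finally have a: "1 + (r - 1) / 25 \<le> (16 / 15 :: real) powr (r - 1)" .
      have b: "1 \<le> (60 :: real) powr (r - 1)" using r by (intro ge_one_powr_ge_zero) auto
      have "60 powr (r - 1) + (r - 1) / 25 \<le> 60 powr (r - 1) + 60 powr (r - 1) * ((r - 1) / 25)"
        using b r mult_right_mono[of 1 "60 powr (r - 1)" "(r - 1) / 25"] by simp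
      also have "\<dots> = 60 powr (r - 1) * (1 + (r - 1) / 25)" by (simp only: distrib_left mult_1_right)
      also have "\<dots> \<le> 60 powr (r - 1) * (16 / 15) powr (r - 1)" using a by (intro mult_left_mono) auto
      also have "\<dots> = (64 :: real) powr (r - 1)" by (simp add: powr_mult[symmetric])
      finally show ?thesis .
    qed
    have "(\<Sum>i<d. l i powr r) = (\<Sum>i\<in>J. l i powr r) + (\<Sum>i\<in>{..<d} - J. l i powr r)"
      by (subst sum.subset_diff[OF J(2)]) simp_all
    also have "\<dots> \<le> (r - 1) / 25 * real d powr (- (r - 1)) + (60 / d) powr (r - 1)"
      using inn Sr out by linarith
    also have "(60 / d) powr (r - 1) = 60 powr (r - 1) * real d powr (- (r - 1))"
      unfolding powr_minus_divide using d0 by (simp add: powr_divide)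
    also have "(r - 1) / 25 * real d powr (- (r - 1)) + 60 powr (r - 1) * real d powr (- (r - 1))
        = (60 powr (r - 1) + (r - 1) / 25) * real d powr (- (r - 1))" by (simp add: algebra_simps)
    also have "\<dots> \<le> 64 powr (r - 1) * real d powr (- (r - 1))" using key by (intro mult_right_mono) auto
    also have "\<dots> = (64 / d) powr (r - 1)" unfolding powr_minus_divide using d0 by (simp add: powr_divide)
    finally have "(\<Sum>i<d. l i powr r) powr (1 / r) \<le> ((64 / d) powr (r - 1)) powr (1 / r)"
      using r by (intro powr_mono2 sum_nonneg) auto
    also have "\<dots> = (64 / d) powr (1 / conj_exp p)"
      unfolding powr_powr q by simp
    finally show ?thesis using 2 by (simp add: lp_norm_def)
  qed
qed

text \<open>Gives 64 \<le> 2 exp(7/2), the numerical use of \<gamma> > 3. The fraction 41/32 is the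
  quadratic Taylor value of exp(1/4).\<close>

lemma exp_7_2_ge: "32 \<le> exp (7 / 2 :: real)"
proof -
  have "(32 :: real) \<le> (41 / 32) ^ 14" by (simp add: power_divide)
  also have "\<dots> \<le> exp (1 / 4) ^ 14"
    using exp_lower_Taylor_quadratic[of "1 / 4"] by (intro power_mono) (simp_all add: power2_eq_square)
  also have "\<dots> = exp (7 / 2)" by (simp flip: exp_of_nat_mult)
  finally show ?thesis .
qed

text \<open>Absorbs the linear term 24 q of the entropy bound into a multiple of 1 + q ln q.\<close>

lemma le_one_plus_times_ln:
  fixes q :: real
  assumes "1 \<le> q"
  shows "q \<le> 1 + q * ln q"
proof -
  have "1 - inverse q \<le> ln q" using assms by (intro one_minus_inverse_le_ln) auto
  then have "q * (1 - inverse q) \<le> q * ln q" using assms by (intro mult_left_mono) auto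
  then show ?thesis using assms by (simp add: algebra_simps)
qed

lemma one_minus_recip_exp:
  assumes "1 < p"
  shows "1 - recip_exp p = inverse (conj_exp p)"
  using assms by (cases rule: ereal_gt_1_cases) (auto simp: recip_exp_def conj_exp_def field_simps)

lemma one_plus_times_ln_le:
  assumes "1 < p"
  shows "1 + conj_exp p * ln (conj_exp p) \<le> 2 * (1 - recip_exp p) powi (-2)"
proof -
  let ?q = "conj_exp p"
  have q: "1 \<le> ?q" using conj_exp_gt[OF assms] by simp
  have "ln ?q \<le> ?q - 1" using q by (intro ln_le_minus_one) auto
  then have "?q * ln ?q \<le> ?q * ?q" using q by (intro mult_left_mono) auto
  moreover have "1 \<le> ?q * ?q" using q mult_mono[of 1 ?q 1 ?q] by simp
  moreover have "(1 - recip_exp p) powi (-2) = ?q * ?q"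
    unfolding one_minus_recip_exp[OF assms] by (simp add: power_int_def power2_eq_square)
  ultimately show ?thesis by simp
qed

lemma ex_channel_pair_counterexample:
  assumes p: "1 < p" and \<gamma>: "3 < \<gamma>" and d: "1 \<le> d" and dq: "20000 * conj_exp p \<le> real d"
  shows "\<exists>s V. 1 \<le> s \<and> isometry_mat (d * d) s V \<and>
     min_renyi_entropy p s (channel d V) \<ge> ln (real d) - \<gamma> - 1 / 2 - ln 2 \<and>
     renyi_entropy p (channel_pair d s V (max_entangled s))
       \<le> ln (real d) + 25 * (1 + conj_exp p * ln (conj_exp p))"
proof -
  define q where "q = conj_exp p"
  have q: "1 \<le> q" "0 < q" using conj_exp_gt[OF p] by (auto simp: q_def)
  have d0: "0 < real d" "1 \<le> real d" using d by auto
  \<comment> \<open>Target for the number of sign matrices. The captured mass is at most 720 X/d^2,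
    and 720/20000 < 1/25 fits the hypothesis of \<open>lp_norm_flat_le\<close>. Since 2 - 1/q \<ge>
    1, the assumption on \<open>d\<close> gives X \<ge> 1, so rounding down loses at most a factor
    2.\<close>
  define X where "X = 1 / (20000 * q) * real d powr (2 - 1 / q)"
  have pd: "real d powr (2 - 1 / q) = (real d)\<^sup>2 * real d powr (- (1 / q))"
    unfolding powr_minus_divide powr_diff using d0 by (simp add: powr_numeral)
  have X1: "1 \<le> X"
  proof -
    have "real d powr 1 \<le> real d powr (2 - 1 / q)" using d0 q by (intro powr_mono) (auto simp: field_simps)
    then have "20000 * q \<le> real d powr (2 - 1 / q)" using dq d0 by (simp add: q_def)
    then show ?thesis using q by (simp add: X_def field_simps)
  qed
  define s where "s = nat \<lfloor>X\<rfloor>"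
  have s: "1 \<le> s" "real s \<le> X" "X \<le> 2 * real s"
  proof -
    have "real s = of_int \<lfloor>X\<rfloor>" using X1 by (simp add: s_def)
    moreover have "1 \<le> \<lfloor>X\<rfloor>" using X1 by simp
    moreover have "of_int \<lfloor>X\<rfloor> \<le> X" "X < of_int \<lfloor>X\<rfloor> + 1" by linarith+
    ultimately show "1 \<le> s" "real s \<le> X" "X \<le> 2 * real s" by linarith+
  qed
  have "real s \<le> real (d * d)"
  proof -
    have "X \<le> 1 * real d powr 2"
      unfolding X_def using q d0 by (intro mult_mono powr_mono) (auto simp: field_simps)
    then show ?thesis using s(2) d0 by (simp add: powr_numeral power2_eq_square)
  qed
  then have sd: "s \<le> d * d" by (simp only: of_nat_le_iff)
  obtain n V where n: "s \<le> 350 * n" and iso: "isometry_mat (d * d) n V"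
    and flat: "\<And>\<phi> u l. \<phi> \<in> unit_vectors n \<Longrightarrow> eig_dec d (channel d V (ketbra \<phi>)) u l \<Longrightarrow>
       (\<Sum>j\<in>{j. j < d \<and> 60 / d < l j}. l j) \<le> 720 * (s / (real d)\<^sup>2)"
    using ex_isometry_flat_outputs[OF s(1) d sd] by blast
  have n1: "1 \<le> n" using n s(1) by (cases n) auto
  have "ln (real d) - \<gamma> - 1 / 2 - ln 2 \<le> min_renyi_entropy p n (channel d V)"
    unfolding min_renyi_entropy_def
  proof (rule cINF_greatest[OF unit_vectors_nonempty[OF n1]])
    fix \<phi> assume \<phi>: "\<phi> \<in> unit_vectors n"
    have D: "channel d V (ketbra \<phi>) \<in> density_ops d"
      by (rule density_ops_kraus[OF kraus_form_channel[OF iso] ketbra_density[OF \<phi>]])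
    obtain u l where e: "eig_dec d (channel d V (ketbra \<phi>)) u l" and l: "\<And>i. i < d \<Longrightarrow> 0 \<le> l i" "(\<Sum>i<d. l i) = 1"
      using density_ops_eig_dec[OF D] by blast
    have "(\<Sum>j\<in>{j. j < d \<and> 60 / d < l j}. l j) \<le> 720 * (X / (real d)\<^sup>2)"
      using flat[OF \<phi> e] s(2) d0 by (smt (verit) divide_right_mono zero_le_power2)
    also have "\<dots> \<le> 1 / (25 * q) * real d powr (- (1 / q))"
      unfolding X_def pd using d0 q by (simp add: field_simps)
    finally have "lp_norm p d l \<le> (64 / d) powr (1 / q)"
      unfolding q_def by (intro lp_norm_flat_le l p d) auto
    then have N: "schatten_norm p (channel d V (ketbra \<phi>)) \<le> (64 / d) powr (1 / q)"
      using schatten_norm_eig_dec[OF e l(1) _ p] d by simp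
    have "ln (schatten_norm p (channel d V (ketbra \<phi>))) \<le> ln ((64 / d) powr (1 / q))"
      using N schatten_norm_density(1)[OF D p] d0 by (subst ln_le_cancel_iff) auto
    also have "\<dots> = 1 / q * (ln 64 - ln d)" using d0 by (simp add: ln_powr ln_div)
    finally have "- (ln 64 - ln d) \<le> - q * ln (schatten_norm p (channel d V (ketbra \<phi>)))"
      using q by (simp add: field_simps)
    also have "\<dots> = renyi_entropy p (channel d V (ketbra \<phi>))"
      unfolding schatten_norm_density(3)[OF D p] q_def ..
    finally have R: "ln d - ln 64 \<le> renyi_entropy p (channel d V (ketbra \<phi>))" by simp
    have "ln 64 = ln (2 * 32 :: real)" by simp
    also have "\<dots> = ln 2 + ln (32 :: real)" by (rule ln_mult_pos) auto
    also have "ln (32 :: real) \<le> ln (exp (7 / 2))" using exp_7_2_ge by (subst ln_le_cancel_iff) auto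
    finally have "ln 64 \<le> ln 2 + (7 / 2 :: real)" by simp
    then show "ln (real d) - \<gamma> - 1 / 2 - ln 2 \<le> renyi_entropy p (channel d V (ketbra \<phi>))" using R \<gamma> by linarith
  qed
  moreover have "renyi_entropy p (channel_pair d n V (max_entangled n)) \<le> ln (real d) + 25 * (1 + conj_exp p * ln (conj_exp p))"
  proof -
    \<comment> \<open>The factor is 20000 from \<open>X\<close>, 2 from rounding down and 350 from
      passing to the isometry: 14000000 < 2^24.\<close>
    have "(real d)\<^sup>2 / n \<le> 2 ^ 24 * q * real d powr (1 / q)"
    proof -
      have "1 / (20000 * q) * ((real d)\<^sup>2 * real d powr (- (1 / q))) \<le> 700 * n"
        using s(3) n unfolding X_def pd by linarith
      then have "(real d)\<^sup>2 \<le> 14000000 * (n * q * real d powr (1 / q))"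
        using q d0 by (simp add: powr_minus field_simps)
      also have "\<dots> \<le> 2 ^ 24 * (n * q * real d powr (1 / q))" using q by (intro mult_right_mono) auto
      finally show ?thesis using n1 by (simp add: field_simps)
    qed
    then have "ln ((real d)\<^sup>2 / n) \<le> ln (2 ^ 24 * q * real d powr (1 / q))"
      using d0 n1 q by (subst ln_le_cancel_iff) auto
    also have "\<dots> = ln (2 ^ 24) + ln q + ln (real d powr (1 / q))"
    proof -
      have "ln (a * b * c) = ln a + ln b + ln c" if "0 < a" "0 < b" "0 < c" for a b c :: real
        using that by (simp add: ln_mult_pos)
      then show ?thesis using q d0 by simp
    qed
    also have "\<dots> = 24 * ln 2 + ln q + 1 / q * ln d"
    proof -
      have "ln (2 ^ 24) = 24 * ln (2 :: real)" by (subst ln_realpow) simp_all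
      then show ?thesis using d0 by (simp only: ln_powr)
    qed
    also have "\<dots> \<le> 24 + ln q + 1 / q * ln d" using ln_le_minus_one[of 2] by simp
    finally have "q * ln ((real d)\<^sup>2 / n) \<le> q * (24 + ln q + 1 / q * ln d)" using q by (intro mult_left_mono) auto
    \<comment> \<open>Multiplication by q turns the exponent 1/q of d into 1, so ln d appears with
      coefficient exactly one.\<close>
    also have "\<dots> = ln d + 24 * q + q * ln q" using q by (simp add: algebra_simps)
    also have "\<dots> \<le> ln d + 25 * (1 + q * ln q)" using le_one_plus_times_ln[OF q(1)] by simp
    finally show ?thesis using renyi_entropy_channel_pair_le[OF iso n1 d p] by (simp add: q_def)
  qed
  ultimately show ?thesis using n1 iso by blast
qed

theorem mainTheorem2:
  shows "\<exists>C C' :: real. C > 0 \<and> C' > 0 \<and>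
    (\<forall>(p :: ereal) (\<gamma> :: real). 1 < p \<and> 3 < \<gamma> \<longrightarrow>
      (\<forall>\<^sub>F d :: nat in sequentially.
        (\<exists>(s :: nat) V. 1 \<le> s \<and> isometry_mat (d * d) s V \<and>
           min_renyi_entropy p s (channel d V) \<ge> ln (real d) - \<gamma> - 1 / 2 - ln 2 \<and>
           renyi_entropy p (channel_pair d s V (max_entangled s))
             \<le> ln (real d) + C * (1 + conj_exp p * ln (conj_exp p)) \<and>
           ln (real d) + C * (1 + conj_exp p * ln (conj_exp p))
             \<le> ln (real d) + C' * (1 - recip_exp p) powi (-2)) \<and>
        (\<forall>(s :: nat) V. 1 \<le> s \<and> isometry_mat (d * d) s V \<and>
           min_renyi_entropy p s (channel d V) \<ge> ln (real d) - \<gamma> - 1 / 2 - ln 2 \<and>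
           renyi_entropy p (channel_pair d s V (max_entangled s))
             \<le> ln (real d) + C * (1 + conj_exp p * ln (conj_exp p)) \<longrightarrow>
           max_output_norm p (s * s) (channel_pair d s V)
             > max_output_norm p s (channel d V) * max_output_norm p s (conj_channel d V) \<and>
           min_renyi_entropy p (s * s) (channel_pair d s V)
             < min_renyi_entropy p s (channel d V) + min_renyi_entropy p s (conj_channel d V))))"
proof (rule exI[of _ "25 :: real"], rule exI[of _ "50 :: real"], intro conjI allI impI, goal_cases)
  case (3 p \<gamma>)
  then have p: "1 < p" and \<gamma>: "3 < \<gamma>" by auto
  \<comment> \<open>The threshold at which ln d + 25 (1 + q ln q) falls below twice the
    single-channel bound, as \<open>multiplicativity_violation\<close> requires.\<close>
  define K where "K = 25 * (1 + conj_exp p * ln (conj_exp p)) + 2 * (\<gamma> + 1 / 2 + ln 2)"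
  have "\<forall>\<^sub>F d :: nat in sequentially. K < ln (real d)"
    using filterlim_compose[OF ln_at_top filterlim_real_sequentially] by (simp add: filterlim_at_top_dense)
  moreover have "\<forall>\<^sub>F d :: nat in sequentially. 20000 * conj_exp p \<le> real d"
    using filterlim_real_sequentially by (simp add: filterlim_at_top)
  moreover have "\<forall>\<^sub>F d :: nat in sequentially. 1 \<le> d" by (rule eventually_ge_at_top)
  ultimately show ?case
  proof eventually_elim
    case (elim d)
    have "ln (real d) + 25 * (1 + conj_exp p * ln (conj_exp p)) \<le> ln (real d) + 50 * (1 - recip_exp p) powi (-2)"
      using one_plus_times_ln_le[OF p] by simp
    moreover have "ln (real d) + 25 * (1 + conj_exp p * ln (conj_exp p)) < 2 * (ln (real d) - \<gamma> - 1 / 2 - ln 2)"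
      using elim(1) unfolding K_def by (simp add: algebra_simps)
    ultimately show ?case
      using ex_channel_pair_counterexample[OF p \<gamma> elim(3,2)] multiplicativity_violation[OF _ _ p] by blast
  qed
qed simp_all

end
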